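(* Let $(M,\eta,\phi_1,\phi_2,\phi_3)$ be a normal almost bi-paracontact manifold. 1. There exists a unique linear connection $\nabla^c$ on $M$ preserving the almost bi-paracontact structure (i.e. $\nabla^c\xi=0$ and $\nabla^c\phi_\alpha=0$ for $\alpha=1,2,3$) and whose torsion is $T^c=2d\eta\otimes\xi$. 2. The curvature tensor field $R^c$ of $\nabla^c$ satisfies, for all $X,Y\in\Gamma(TM)$, $$R^c(\phi_1X,\phi_1Y)=R^c(\phi_2X,\phi_2Y)=-R^c(\phi_3X,\phi_3Y)=-R^c(X,Y).$$ In particular $R^c(X,\xi)=0$ for all $X\in\Gamma(TM)$. 3. The Ricci tensor of $\nabla^c$, defined as $\mathrm{Ric}^c(X,Y):=\mathrm{trace}(Z\mapsto R^c(Z,X)Y)$, is given by $$\mathrm{Ric}^c(X,Y)=-\tfrac12\,\mathrm{trace}(R^c(X,Y)).$$ In particular the Ricci tensor is skew-symmetric and $\mathrm{Ric}^c(\phi_1\cdot,\phi_1\cdot)=\mathrm{Ric}^c(\phi_2\cdot,\phi_2\cdot)=-\mathrm{Ric}^c(\phi_3\cdot,\phi_3\cdot)=-\mathrm{Ric}^c$. 4. The connection $\nabla^c$ and the connections $\nabla^1,\nabla^2,\nabla^3$ (defined in the context) all coincide.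
   Context: Everything is smooth. A contact manifold $(M,\eta)$ is a $(2n+1)$-dimensional manifold with a $1$-form $\eta$ such that $\eta\wedge(d\eta)^n\neq 0$ everywhere; its Reeb vector field $\xi$ is determined by $\eta(\xi)=1$, $d\eta(\xi,\cdot)=0$. Normalization: $2d\eta(X,Y)=X(\eta(Y))-Y(\eta(X))-\eta([X,Y])$. An almost bi-paracontact structure on $(M,\eta)$ is a triplet $(\phi_1,\phi_2,\phi_3)$ of $(1,1)$-tensor fields with $\phi_1\phi_2=-\phi_2\phi_1$, $\phi_1^2=\phi_2^2=I-\eta\otimes\xi$, $\phi_3=\phi_1\phi_2$, and $\phi_3^2=-I+\eta\otimes\xi$; $(M,\eta,\phi_1,\phi_2,\phi_3)$ is then an almost bi-paracontact manifold. With $[\phi,\phi](X,Y)=\phi^2[X,Y]+[\phi X,\phi Y]-\phi[\phi X,Y]-\phi[X,\phi Y]$, put $N^{(1)}_{\phi_\alpha}=[\phi_\alpha,\phi_\alpha]-2d\eta\otimes\xi$ for $\alpha=1,2$ and $N^{(1)}_{\phi_3}=[\phi_3,\phi_3]+2d\eta\otimes\xi$. The structure is normal if $N^{(1)}_{\phi_\alpha}=0$ for $\alpha=1,2,3$. Put $h_\alpha:=\frac12\mathcal L_\xi\phi_\alpha$; $\nabla\phi=\eta\otimes B$ means $(\nabla_X\phi)Y=\eta(X)BY$. On any almost bi-paracontact manifold, for each $\alpha\in\{1,2,3\}$, $\nabla^\alpha$ denotes the unique linear connection, with torsion $T^\alpha$, such that: (i) $\nabla^\alpha\xi=0$; (ii)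 $\nabla^1\phi_1=0$, $\nabla^1\phi_2=\eta\otimes(2h_2-h_1\phi_3+\phi_3h_1)$, $\nabla^1\phi_3=\eta\otimes(2h_3-h_1\phi_2+\phi_2h_1)$; $\nabla^2\phi_1=\eta\otimes(2h_1+h_2\phi_3-\phi_3h_2)$, $\nabla^2\phi_2=0$, $\nabla^2\phi_3=\eta\otimes(2h_3+h_2\phi_1-\phi_1h_2)$; $\nabla^3\phi_1=\eta\otimes(2h_1-h_3\phi_2+\phi_2h_3)$, $\nabla^3\phi_2=\eta\otimes(2h_2+h_3\phi_1-\phi_1h_3)$, $\nabla^3\phi_3=0$; (iii) $T^\alpha(\phi_\alpha X,Y)-T^\alpha(X,\phi_\alpha Y)=2(d\eta(\phi_\alpha X,Y)-d\eta(X,\phi_\alpha Y))\xi+\eta(Y)h_\alpha X+\eta(X)h_\alpha Y$ for all $X,Y$. *)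

theory Defs
  imports "HOL-Analysis.Analysis" "HOL-Library.Function_Algebras"
begin

text \<open>
  Tangent vectors are functionals on real functions and vector fields are functions into those, so
  with the pointwise operations they can be added and scaled directly, and the library notions
  \<open>independent\<close>, \<open>span\<close> and \<open>representation\<close> apply to tangent spaces.
\<close>

instantiation "fun" :: (type, real_vector) real_vector
begin

definition scaleR_fun :: "real \<Rightarrow> ('a \<Rightarrow> 'b) \<Rightarrow> 'a \<Rightarrow> 'b" where
  "scaleR_fun c f = (\<lambda>x. c *\<^sub>R f x)"

instance
  by standard (simp_all add: scaleR_fun_def fun_eq_iff scaleR_add_right scaleR_add_left)

end

lemma scaleR_fun_apply [simp]: "(c *\<^sub>R f) x = c *\<^sub>R f x"
  by (simp add: scaleR_fun_def)

primrec Ck_on :: "nat \<Rightarrow> 'a::real_normed_vector set \<Rightarrow> ('a \<Rightarrow> 'b::real_normed_vector) \<Rightarrow> bool" where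
  "Ck_on 0 S f \<longleftrightarrow> continuous_on S f"
| "Ck_on (Suc k) S f \<longleftrightarrow>
     (\<forall>x\<in>S. f differentiable (at x)) \<and> (\<forall>v. Ck_on k S (\<lambda>x. frechet_derivative f (at x) v))"

text \<open>Only used for open \<open>S\<close>, since \<open>Ck_on\<close> takes unrestricted derivatives at the points of \<open>S\<close>.\<close>

definition smooth_on :: "'a::real_normed_vector set \<Rightarrow> ('a \<Rightarrow> 'b::real_normed_vector) \<Rightarrow> bool" where
  "smooth_on S f \<longleftrightarrow> (\<forall>k. Ck_on k S f)"

text \<open>
  The manifold is the whole type \<open>'a\<close>, Hausdorff and second countable by its type class. A chart
  is a pair of its domain and its coordinate map. The atlas need not be maximal.
\<close>

type_synonym ('a, 'e) chart = "'a set \<times> ('a \<Rightarrow> 'e)"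

definition smooth_atlas ::
    "('a::{t2_space,second_countable_topology}, 'e::euclidean_space) chart set \<Rightarrow> bool" where
  "smooth_atlas M \<longleftrightarrow>
     (\<Union>(U, c)\<in>M. U) = UNIV \<and>
     (\<forall>(U, c)\<in>M. open U \<and> open (c ` U) \<and> homeomorphism U (c ` U) c (inv_into U c)) \<and>
     (\<forall>(U, c)\<in>M. \<forall>(V, d)\<in>M. smooth_on (c ` (U \<inter> V)) (d \<circ> inv_into U c))"

definition smooth_functions :: "('a, 'e::euclidean_space) chart set \<Rightarrow> ('a \<Rightarrow> real) set" where
  "smooth_functions M = {f. \<forall>(U, c)\<in>M. smooth_on (c ` U) (f \<circ> inv_into U c)}"

type_synonym 'a tangent = "('a \<Rightarrow> real) \<Rightarrow> real"
type_synonym 'a vfield = "'a \<Rightarrow> 'a tangent"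
type_synonym 'a oneform = "'a \<Rightarrow> 'a tangent \<Rightarrow> real"
type_synonym 'a endofield = "'a \<Rightarrow> 'a tangent \<Rightarrow> 'a tangent"

text \<open>
  Tangent vectors at \<open>p\<close> are the derivations at \<open>p\<close> of the algebra of smooth functions. Off the
  smooth functions they are set to 0, so that equality of functionals is equality of derivations.
\<close>

definition tangent_space :: "('a, 'e::euclidean_space) chart set \<Rightarrow> 'a \<Rightarrow> 'a tangent set" where
  "tangent_space M p = {v.
     (\<forall>f\<in>smooth_functions M. \<forall>g\<in>smooth_functions M.
        v (f + g) = v f + v g \<and> v (f * g) = f p * v g + g p * v f) \<and>
     (\<forall>c. \<forall>f\<in>smooth_functions M. v (c *\<^sub>R f) = c * v f) \<and>
     (\<forall>f. f \<notin> smooth_functions M \<longrightarrow> v f = 0)}"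

definition directional :: "'a vfield \<Rightarrow> ('a \<Rightarrow> real) \<Rightarrow> 'a \<Rightarrow> real" (infixr "\<rhd>" 76) where
  "X \<rhd> f = (\<lambda>p. X p f)"

definition vector_fields :: "('a, 'e::euclidean_space) chart set \<Rightarrow> 'a vfield set" where
  "vector_fields M = {X. (\<forall>p. X p \<in> tangent_space M p) \<and>
     (\<forall>f\<in>smooth_functions M. X \<rhd> f \<in> smooth_functions M)}"

definition fscale :: "('a \<Rightarrow> real) \<Rightarrow> 'a vfield \<Rightarrow> 'a vfield" (infixr "\<odot>" 75) where
  "f \<odot> X = (\<lambda>p. f p *\<^sub>R X p)"

definition lie_bracket :: "'a vfield \<Rightarrow> 'a vfield \<Rightarrow> 'a vfield" where
  "lie_bracket X Y = (\<lambda>p f. X p (Y \<rhd> f) - Y p (X \<rhd> f))"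

definition field_app :: "('a \<Rightarrow> 'b \<Rightarrow> 'c) \<Rightarrow> ('a \<Rightarrow> 'b) \<Rightarrow> 'a \<Rightarrow> 'c" ("_\<langle>_\<rangle>" [1000, 0] 1000) where
  "T\<langle>X\<rangle> = (\<lambda>p. T p (X p))"

definition one_form :: "('a, 'e::euclidean_space) chart set \<Rightarrow> 'a oneform \<Rightarrow> bool" where
  "one_form M \<eta> \<longleftrightarrow>
     (\<forall>p. \<forall>v\<in>tangent_space M p. (\<forall>w\<in>tangent_space M p. \<eta> p (v + w) = \<eta> p v + \<eta> p w) \<and>
        (\<forall>c. \<eta> p (c *\<^sub>R v) = c * \<eta> p v)) \<and>
     (\<forall>X\<in>vector_fields M. \<eta>\<langle>X\<rangle> \<in> smooth_functions M)"

definition tensor11 :: "('a, 'e::euclidean_space) chart set \<Rightarrow> 'a endofield \<Rightarrow> bool" where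
  "tensor11 M \<phi> \<longleftrightarrow>
     (\<forall>p. \<forall>v\<in>tangent_space M p. \<phi> p v \<in> tangent_space M p \<and>
        (\<forall>w\<in>tangent_space M p. \<phi> p (v + w) = \<phi> p v + \<phi> p w) \<and>
        (\<forall>c. \<phi> p (c *\<^sub>R v) = c *\<^sub>R \<phi> p v)) \<and>
     (\<forall>X\<in>vector_fields M. \<phi>\<langle>X\<rangle> \<in> vector_fields M)"

text \<open>Exterior derivative in the normalization \<open>2 d\<eta>(X,Y) = X \<eta>(Y) - Y \<eta>(X) - \<eta>([X,Y])\<close>.\<close>

definition ext_d :: "'a oneform \<Rightarrow> 'a vfield \<Rightarrow> 'a vfield \<Rightarrow> 'a \<Rightarrow> real" where
  "ext_d \<eta> X Y = (1/2) *\<^sub>R (X \<rhd> \<eta>\<langle>Y\<rangle> - Y \<rhd> \<eta>\<langle>X\<rangle> - \<eta>\<langle>lie_bracket X Y\<rangle>)"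

text \<open>
  A \<open>k\<close>-form acts on sequences of vector fields, of which only the first \<open>k\<close> entries are used. The
  factor \<open>1/(k+l)!\<close> is the convention that goes with the factor \<open>1/2\<close> in \<open>ext_d\<close>.
\<close>

type_synonym 'a form = "(nat \<Rightarrow> 'a vfield) \<Rightarrow> 'a \<Rightarrow> real"

definition wedge :: "nat \<Rightarrow> nat \<Rightarrow> 'a form \<Rightarrow> 'a form \<Rightarrow> 'a form" where
  "wedge k l \<alpha> \<beta> = (\<lambda>X p. (\<Sum>\<sigma> | \<sigma> permutes {..<k + l}.
     of_int (sign \<sigma>) * \<alpha> (X \<circ> \<sigma>) p * \<beta> (\<lambda>i. X (\<sigma> (k + i))) p) / fact (k + l))"

primrec wedge_power2 :: "'a form \<Rightarrow> nat \<Rightarrow> 'a form" where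
  "wedge_power2 \<omega> 0 = (\<lambda>X p. 1)"
| "wedge_power2 \<omega> (Suc n) = wedge 2 (2 * n) \<omega> (wedge_power2 \<omega> n)"

definition contact_volume :: "'a oneform \<Rightarrow> nat \<Rightarrow> 'a form" where
  "contact_volume \<eta> n =
     wedge 1 (2 * n) (\<lambda>X. \<eta>\<langle>X 0\<rangle>) (wedge_power2 (\<lambda>X. ext_d \<eta> (X 0) (X 1)) n)"

definition contact_manifold ::
    "('a::{t2_space,second_countable_topology}, 'e::euclidean_space) chart set \<Rightarrow> nat
      \<Rightarrow> 'a oneform \<Rightarrow> bool" where
  "contact_manifold M n \<eta> \<longleftrightarrow> smooth_atlas M \<and> DIM('e) = 2 * n + 1 \<and> one_form M \<eta> \<and>
     (\<forall>p. \<exists>X. (\<forall>i. X i \<in> vector_fields M) \<and> contact_volume \<eta> n X p \<noteq> 0)"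

text \<open>On a contact manifold exactly one field satisfies the following.\<close>

definition reeb_field ::
    "('a, 'e::euclidean_space) chart set \<Rightarrow> 'a oneform \<Rightarrow> 'a vfield \<Rightarrow> bool" where
  "reeb_field M \<eta> \<xi> \<longleftrightarrow> \<xi> \<in> vector_fields M \<and> \<eta>\<langle>\<xi>\<rangle> = 1 \<and> (\<forall>X\<in>vector_fields M. ext_d \<eta> \<xi> X = 0)"

definition almost_bi_paracontact ::
    "('a::{t2_space,second_countable_topology}, 'e::euclidean_space) chart set \<Rightarrow> nat
      \<Rightarrow> 'a oneform \<Rightarrow> 'a vfield \<Rightarrow> 'a endofield \<Rightarrow> 'a endofield \<Rightarrow> 'a endofield \<Rightarrow> bool" where
  "almost_bi_paracontact M n \<eta> \<xi> \<phi>1 \<phi>2 \<phi>3 \<longleftrightarrow>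
     contact_manifold M n \<eta> \<and> reeb_field M \<eta> \<xi> \<and>
     tensor11 M \<phi>1 \<and> tensor11 M \<phi>2 \<and> tensor11 M \<phi>3 \<and>
     (\<forall>p. \<forall>v\<in>tangent_space M p.
        \<phi>1 p (\<phi>2 p v) = - \<phi>2 p (\<phi>1 p v) \<and>
        \<phi>1 p (\<phi>1 p v) = v - \<eta> p v *\<^sub>R \<xi> p \<and>
        \<phi>2 p (\<phi>2 p v) = v - \<eta> p v *\<^sub>R \<xi> p \<and>
        \<phi>3 p v = \<phi>1 p (\<phi>2 p v) \<and>
        \<phi>3 p (\<phi>3 p v) = - v + \<eta> p v *\<^sub>R \<xi> p)"

definition nijenhuis :: "'a endofield \<Rightarrow> 'a vfield \<Rightarrow> 'a vfield \<Rightarrow> 'a vfield" where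
  "nijenhuis \<phi> X Y = \<phi>\<langle>\<phi>\<langle>lie_bracket X Y\<rangle>\<rangle> + lie_bracket \<phi>\<langle>X\<rangle> \<phi>\<langle>Y\<rangle>
     - \<phi>\<langle>lie_bracket \<phi>\<langle>X\<rangle> Y\<rangle> - \<phi>\<langle>lie_bracket X \<phi>\<langle>Y\<rangle>\<rangle>"

definition normal_almost_bi_paracontact ::
    "('a::{t2_space,second_countable_topology}, 'e::euclidean_space) chart set \<Rightarrow> nat
      \<Rightarrow> 'a oneform \<Rightarrow> 'a vfield \<Rightarrow> 'a endofield \<Rightarrow> 'a endofield \<Rightarrow> 'a endofield \<Rightarrow> bool" where
  "normal_almost_bi_paracontact M n \<eta> \<xi> \<phi>1 \<phi>2 \<phi>3 \<longleftrightarrow>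
     almost_bi_paracontact M n \<eta> \<xi> \<phi>1 \<phi>2 \<phi>3 \<and>
     (\<forall>X\<in>vector_fields M. \<forall>Y\<in>vector_fields M.
        nijenhuis \<phi>1 X Y - (2 *\<^sub>R ext_d \<eta> X Y) \<odot> \<xi> = 0 \<and>
        nijenhuis \<phi>2 X Y - (2 *\<^sub>R ext_d \<eta> X Y) \<odot> \<xi> = 0 \<and>
        nijenhuis \<phi>3 X Y + (2 *\<^sub>R ext_d \<eta> X Y) \<odot> \<xi> = 0)"

type_synonym 'a connection = "'a vfield \<Rightarrow> 'a vfield \<Rightarrow> 'a vfield"

text \<open>
  \<open>D X Y\<close> stands for \<open>\<nabla>\<^sub>X Y\<close>. The extensional function space makes equality of connections as
  HOL functions coincide with their equality on vector fields.
\<close>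

definition linear_connection ::
    "('a, 'e::euclidean_space) chart set \<Rightarrow> 'a connection \<Rightarrow> bool" where
  "linear_connection M D \<longleftrightarrow>
     D \<in> vector_fields M \<rightarrow>\<^sub>E (vector_fields M \<rightarrow>\<^sub>E vector_fields M) \<and>
     (\<forall>X\<in>vector_fields M. \<forall>Y\<in>vector_fields M. \<forall>Z\<in>vector_fields M.
        D (X + Y) Z = D X Z + D Y Z \<and> D X (Y + Z) = D X Y + D X Z) \<and>
     (\<forall>f\<in>smooth_functions M. \<forall>X\<in>vector_fields M. \<forall>Y\<in>vector_fields M.
        D (f \<odot> X) Y = f \<odot> D X Y \<and> D X (f \<odot> Y) = (X \<rhd> f) \<odot> Y + f \<odot> D X Y)"

definition torsion :: "'a connection \<Rightarrow> 'a vfield \<Rightarrow> 'a vfield \<Rightarrow> 'a vfield" where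
  "torsion D X Y = D X Y - D Y X - lie_bracket X Y"

definition curvature ::
    "'a connection \<Rightarrow> 'a vfield \<Rightarrow> 'a vfield \<Rightarrow> 'a vfield \<Rightarrow> 'a vfield" where
  "curvature D X Y Z = D X (D Y Z) - D Y (D X Z) - D (lie_bracket X Y) Z"

text \<open>\<open>nabla_tensor D \<phi> X Y\<close> is \<open>(\<nabla>\<^sub>X \<phi>) Y\<close>.\<close>

definition nabla_tensor :: "'a connection \<Rightarrow> 'a endofield \<Rightarrow> 'a vfield \<Rightarrow> 'a vfield \<Rightarrow> 'a vfield" where
  "nabla_tensor D \<phi> X Y = D X \<phi>\<langle>Y\<rangle> - \<phi>\<langle>D X Y\<rangle>"

text \<open>
  The endomorphism of \<open>T\<^sub>pM\<close> induced by an endomorphism \<open>F\<close> of the vector fields that is linear over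
  the smooth functions: for such \<open>F\<close> the value \<open>F Z p\<close> depends only on \<open>Z p\<close>.
\<close>

definition value_at ::
    "('a, 'e::euclidean_space) chart set \<Rightarrow> ('a vfield \<Rightarrow> 'a vfield) \<Rightarrow> 'a
      \<Rightarrow> 'a tangent \<Rightarrow> 'a tangent" where
  "value_at M F p v = F (SOME Z. Z \<in> vector_fields M \<and> Z p = v) p"

definition trace_field ::
    "('a, 'e::euclidean_space) chart set \<Rightarrow> ('a vfield \<Rightarrow> 'a vfield) \<Rightarrow> 'a \<Rightarrow> real" where
  "trace_field M F = (\<lambda>p. let B = (SOME B. independent B \<and> span B = tangent_space M p)
     in \<Sum>b\<in>B. representation B (value_at M F p b) b)"

definition ricci ::
    "('a, 'e::euclidean_space) chart set \<Rightarrow> 'a connection \<Rightarrow> 'a vfield \<Rightarrow> 'a vfield \<Rightarrow> 'a \<Rightarrow> real" where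
  "ricci M D X Y = trace_field M (\<lambda>Z. curvature D Z X Y)"

definition bi_paracontact_connection ::
    "('a, 'e::euclidean_space) chart set \<Rightarrow> 'a oneform \<Rightarrow> 'a vfield
      \<Rightarrow> 'a endofield \<Rightarrow> 'a endofield \<Rightarrow> 'a endofield \<Rightarrow> 'a connection \<Rightarrow> bool" where
  "bi_paracontact_connection M \<eta> \<xi> \<phi>1 \<phi>2 \<phi>3 D \<longleftrightarrow>
     linear_connection M D \<and>
     (\<forall>X\<in>vector_fields M. D X \<xi> = 0) \<and>
     (\<forall>X\<in>vector_fields M. \<forall>Y\<in>vector_fields M.
        nabla_tensor D \<phi>1 X Y = 0 \<and> nabla_tensor D \<phi>2 X Y = 0 \<and> nabla_tensor D \<phi>3 X Y = 0) \<and>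
     (\<forall>X\<in>vector_fields M. \<forall>Y\<in>vector_fields M.
        torsion D X Y = (2 *\<^sub>R ext_d \<eta> X Y) \<odot> \<xi>)"

definition lie_deriv_tensor :: "'a vfield \<Rightarrow> 'a endofield \<Rightarrow> 'a vfield \<Rightarrow> 'a vfield" where
  "lie_deriv_tensor V \<phi> X = lie_bracket V \<phi>\<langle>X\<rangle> - \<phi>\<langle>lie_bracket V X\<rangle>"

definition h_op :: "'a vfield \<Rightarrow> 'a endofield \<Rightarrow> 'a vfield \<Rightarrow> 'a vfield" where
  "h_op \<xi> \<phi> X = (1/2) *\<^sub>R lie_deriv_tensor \<xi> \<phi> X"

text \<open>Used with \<open>\<phi> = \<phi>\<^sub>\<alpha>\<close> for the torsion of \<open>\<nabla>\<^sup>\<alpha>\<close>.\<close>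

definition torsion_condition ::
    "('a, 'e::euclidean_space) chart set \<Rightarrow> 'a oneform \<Rightarrow> 'a vfield \<Rightarrow> 'a endofield
      \<Rightarrow> 'a connection \<Rightarrow> bool" where
  "torsion_condition M \<eta> \<xi> \<phi> D \<longleftrightarrow>
     (\<forall>X\<in>vector_fields M. \<forall>Y\<in>vector_fields M.
        torsion D \<phi>\<langle>X\<rangle> Y - torsion D X \<phi>\<langle>Y\<rangle>
          = (2 *\<^sub>R (ext_d \<eta> \<phi>\<langle>X\<rangle> Y - ext_d \<eta> X \<phi>\<langle>Y\<rangle>)) \<odot> \<xi>
            + \<eta>\<langle>Y\<rangle> \<odot> h_op \<xi> \<phi> X + \<eta>\<langle>X\<rangle> \<odot> h_op \<xi> \<phi> Y)"

definition canonical_connection1 ::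
    "('a, 'e::euclidean_space) chart set \<Rightarrow> 'a oneform \<Rightarrow> 'a vfield
      \<Rightarrow> 'a endofield \<Rightarrow> 'a endofield \<Rightarrow> 'a endofield \<Rightarrow> 'a connection \<Rightarrow> bool" where
  "canonical_connection1 M \<eta> \<xi> \<phi>1 \<phi>2 \<phi>3 D \<longleftrightarrow>
     (let h1 = h_op \<xi> \<phi>1; h2 = h_op \<xi> \<phi>2; h3 = h_op \<xi> \<phi>3 in
     linear_connection M D \<and>
     (\<forall>X\<in>vector_fields M. D X \<xi> = 0) \<and>
     (\<forall>X\<in>vector_fields M. \<forall>Y\<in>vector_fields M.
        nabla_tensor D \<phi>1 X Y = 0 \<and>
        nabla_tensor D \<phi>2 X Y = \<eta>\<langle>X\<rangle> \<odot> (2 *\<^sub>R h2 Y - h1 \<phi>3\<langle>Y\<rangle> + \<phi>3\<langle>h1 Y\<rangle>) \<and>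
        nabla_tensor D \<phi>3 X Y = \<eta>\<langle>X\<rangle> \<odot> (2 *\<^sub>R h3 Y - h1 \<phi>2\<langle>Y\<rangle> + \<phi>2\<langle>h1 Y\<rangle>)) \<and>
     torsion_condition M \<eta> \<xi> \<phi>1 D)"

definition canonical_connection2 ::
    "('a, 'e::euclidean_space) chart set \<Rightarrow> 'a oneform \<Rightarrow> 'a vfield
      \<Rightarrow> 'a endofield \<Rightarrow> 'a endofield \<Rightarrow> 'a endofield \<Rightarrow> 'a connection \<Rightarrow> bool" where
  "canonical_connection2 M \<eta> \<xi> \<phi>1 \<phi>2 \<phi>3 D \<longleftrightarrow>
     (let h1 = h_op \<xi> \<phi>1; h2 = h_op \<xi> \<phi>2; h3 = h_op \<xi> \<phi>3 in
     linear_connection M D \<and>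
     (\<forall>X\<in>vector_fields M. D X \<xi> = 0) \<and>
     (\<forall>X\<in>vector_fields M. \<forall>Y\<in>vector_fields M.
        nabla_tensor D \<phi>1 X Y = \<eta>\<langle>X\<rangle> \<odot> (2 *\<^sub>R h1 Y + h2 \<phi>3\<langle>Y\<rangle> - \<phi>3\<langle>h2 Y\<rangle>) \<and>
        nabla_tensor D \<phi>2 X Y = 0 \<and>
        nabla_tensor D \<phi>3 X Y = \<eta>\<langle>X\<rangle> \<odot> (2 *\<^sub>R h3 Y + h2 \<phi>1\<langle>Y\<rangle> - \<phi>1\<langle>h2 Y\<rangle>)) \<and>
     torsion_condition M \<eta> \<xi> \<phi>2 D)"

definition canonical_connection3 ::
    "('a, 'e::euclidean_space) chart set \<Rightarrow> 'a oneform \<Rightarrow> 'a vfield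
      \<Rightarrow> 'a endofield \<Rightarrow> 'a endofield \<Rightarrow> 'a endofield \<Rightarrow> 'a connection \<Rightarrow> bool" where
  "canonical_connection3 M \<eta> \<xi> \<phi>1 \<phi>2 \<phi>3 D \<longleftrightarrow>
     (let h1 = h_op \<xi> \<phi>1; h2 = h_op \<xi> \<phi>2; h3 = h_op \<xi> \<phi>3 in
     linear_connection M D \<and>
     (\<forall>X\<in>vector_fields M. D X \<xi> = 0) \<and>
     (\<forall>X\<in>vector_fields M. \<forall>Y\<in>vector_fields M.
        nabla_tensor D \<phi>1 X Y = \<eta>\<langle>X\<rangle> \<odot> (2 *\<^sub>R h1 Y - h3 \<phi>2\<langle>Y\<rangle> + \<phi>2\<langle>h3 Y\<rangle>) \<and>
        nabla_tensor D \<phi>2 X Y = \<eta>\<langle>X\<rangle> \<odot> (2 *\<^sub>R h2 Y + h3 \<phi>1\<langle>Y\<rangle> - \<phi>1\<langle>h3 Y\<rangle>) \<and>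
        nabla_tensor D \<phi>3 X Y = 0) \<and>
     torsion_condition M \<eta> \<xi> \<phi>3 D)"

end

theory Submission
  imports Defs
begin

text \<open>
  On the horizontal bundle \<open>ker \<eta>\<close> the tensors \<open>\<phi>\<^sub>1, \<phi>\<^sub>2\<close> are anticommuting product structures. One
  algebraic observation is used three times: a biadditive map \<open>S\<close> on vector fields with horizontal
  values that satisfies \<open>S(\<phi>X, Y) = \<phi>S(X, Y) = S(X, \<phi>Y)\<close> for two anticommuting structures \<open>\<phi>, \<psi>\<close>
  vanishes, because \<open>S(\<phi>X, \<psi>Y)\<close> equals both \<open>\<phi>\<psi>S\<close> and \<open>\<psi>\<phi>S = - \<phi>\<psi>S\<close> (\<open>bilinear_0\<close>). It applies

  \<^item> to the difference of two connections that preserve the structure and have the same torsion, which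
    is symmetric because the torsions agree; this is uniqueness (\<open>canonical_unique\<close>);
  \<^item> to \<open>T - 2 d\<eta> \<otimes> \<xi>\<close> for a structure preserving connection whose torsion satisfies the condition of
    one of the connections \<open>\<nabla>\<^sup>\<alpha>\<close>; normality, rewritten as an identity for the torsion, first gives
    linearity over \<open>\<phi>\<^sub>\<alpha>\<close> and then over a second structure (\<open>horizontal_torsion_0\<close>). Normality also
    gives \<open>h\<^sub>\<alpha> = 0\<close> (\<open>h_op_0\<close>), so the three connections \<open>\<nabla>\<^sup>\<alpha>\<close> all preserve the structure, and they
    are the connection of the theorem;
  \<^item> to \<open>R(\<xi>, X)Y\<close>, symmetric in \<open>X, Y\<close> by the Bianchi identity (\<open>curvature_xi\<close>).

  For existence, let \<open>P\<^sub>\<plusminus>\<close> be the projections to the eigenbundles of \<open>\<phi>\<^sub>1\<close> in \<open>ker \<eta>\<close>. The torsion and parallelism of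
  \<open>\<phi>\<^sub>1\<close> force \<open>\<nabla>\<^sub>X Y = P\<^sub>-[X, Y]\<close> for \<open>X\<close> in the \<open>+1\<close> and \<open>Y\<close> in the \<open>-1\<close> eigenbundle, parallelism of \<open>\<phi>\<^sub>2\<close> then forces
  \<open>\<nabla>\<^sub>X Y = \<phi>\<^sub>2 P\<^sub>-[X, \<phi>\<^sub>2 Y]\<close> when \<open>X\<close> and \<open>Y\<close> are both in the \<open>+1\<close> eigenbundle, and \<open>\<nabla>\<^sub>\<xi> Y = [\<xi>, Y]\<close> for
  horizontal \<open>Y\<close>. The resulting connection is \<open>nabla\<close>; it has the right torsion by the normality
  conditions of \<open>\<phi>\<^sub>1\<close> and \<open>\<phi>\<^sub>2\<close> (\<open>nabla4_commutator\<close>).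

  The torsion \<open>2 d\<eta> \<otimes> \<xi>\<close> contributes to the first Bianchi identity only in direction \<open>\<xi>\<close>, while the
  curvature is horizontal, so the identity holds as in the torsion free case (\<open>bianchi\<close>). Combining its
  instances at \<open>(X, Y)\<close>, \<open>(\<phi>X, Y)\<close>, \<open>(X, \<phi>Y)\<close> and \<open>(\<phi>X, \<phi>Y)\<close> gives \<open>R(\<phi>X, \<phi>Y) + \<epsilon>R(X, Y) = \<phi>G\<close>, where \<open>\<phi>\<^sup>2 = \<epsilon>\<close>
  on \<open>ker \<eta>\<close> and \<open>G\<close> and the left side commute with \<open>\<psi>\<close>, whence both sides vanish
  (\<open>curvature_phi_phi\<close>). The statements on the Ricci tensor follow by taking traces of such identities
  (\<open>ricci_skew\<close>, \<open>ricci_trace\<close>).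

  The trace is taken pointwise, so it needs the facts that every tangent vector extends to a vector
  field and that the value at \<open>p\<close> of a tensor applied to a field depends only on the value of the field
  at \<open>p\<close>. Tangent vectors are derivations of global functions, and both facts come from a local frame
  multiplied by bump functions (\<open>cutoff_frame\<close>), which rests on Hadamard's lemma.
\<close>

section \<open>Functions of class \<open>C\<^sup>k\<close> and bump functions\<close>

lemma frechet_derivative_transform_open:
  assumes "open S" "x \<in> S" "\<And>y. y \<in> S \<Longrightarrow> f y = g y"
  shows "f differentiable (at x) \<longleftrightarrow> g differentiable (at x)"
    and "frechet_derivative f (at x) = frechet_derivative g (at x)"
proof -
  have "(f has_derivative D) (at x) \<longleftrightarrow> (g has_derivative D) (at x)" for D
    using assms has_derivative_transform_within_open[of f D x UNIV S g]
      has_derivative_transform_within_open[of g D x UNIV S f]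
    by auto
  then show "f differentiable (at x) \<longleftrightarrow> g differentiable (at x)"
    and "frechet_derivative f (at x) = frechet_derivative g (at x)"
    unfolding differentiable_def frechet_derivative_def by simp_all
qed

lemma Ck_on_cong:
  assumes "open S" "\<And>x. x \<in> S \<Longrightarrow> f x = g x"
  shows "Ck_on k S f \<longleftrightarrow> Ck_on k S g"
  using assms
proof (induction k arbitrary: f g)
  case 0
  then show ?case by (simp cong: continuous_on_cong)
next
  case (Suc k)
  have "f differentiable (at x) \<longleftrightarrow> g differentiable (at x)"
    and "frechet_derivative f (at x) = frechet_derivative g (at x)" if "x \<in> S" for x
    using frechet_derivative_transform_open[of S x f g] Suc.prems that by auto
  then have "Ck_on k S (\<lambda>x. frechet_derivative f (at x) v)
      = Ck_on k S (\<lambda>x. frechet_derivative g (at x) v)" for v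
    by (intro Suc.IH Suc.prems(1)) simp
  with \<open>\<And>x. x \<in> S \<Longrightarrow> f differentiable (at x) \<longleftrightarrow> g differentiable (at x)\<close> show ?case
    by simp
qed

lemma Ck_on_subset: "Ck_on k S f \<Longrightarrow> T \<subseteq> S \<Longrightarrow> Ck_on k T f"
  by (induction k arbitrary: f) (auto intro: continuous_on_subset)

lemma Ck_on_Un:
  "open S \<Longrightarrow> open T \<Longrightarrow> Ck_on k S f \<Longrightarrow> Ck_on k T f \<Longrightarrow> Ck_on k (S \<union> T) f"
  by (induction k arbitrary: f) (auto intro: continuous_on_open_Un)

lemma Ck_on_SucD: "Ck_on (Suc k) S f \<Longrightarrow> Ck_on k S f"
proof (induction k arbitrary: f)
  case 0
  then show ?case
    by (auto intro!: continuous_at_imp_continuous_on differentiable_imp_continuous_within)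
next
  case (Suc k)
  have "Ck_on k S (\<lambda>x. frechet_derivative f (at x) v)" for v
    using Suc.prems by (intro Suc.IH) (simp only: Ck_on.simps(2)[of "Suc k"])
  moreover have "\<forall>x\<in>S. f differentiable (at x)"
    using Suc.prems unfolding Ck_on.simps(2)[of "Suc k"] by (rule conjunct1)
  ultimately show ?case by simp
qed

text \<open>
  Derivatives are computed as \<open>has_derivative\<close> facts with explicit derivatives, but the recursion for
  \<open>Ck_on\<close> refers to \<open>frechet_derivative\<close>. The next two rules translate, so that the closure properties
  reduce to the differentiation rules.
\<close>

lemma Ck_on_SucI:
  assumes "open S" "\<And>x. x \<in> S \<Longrightarrow> (f has_derivative D x) (at x)" "\<And>v. Ck_on k S (\<lambda>x. D x v)"
  shows "Ck_on (Suc k) S f"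
proof -
  have "frechet_derivative f (at x) = D x" if "x \<in> S" for x
    using frechet_derivative_at[OF assms(2)[OF that]] by simp
  then have "Ck_on k S (\<lambda>x. frechet_derivative f (at x) v)" for v
    using assms(3)[of v] Ck_on_cong[OF assms(1), of "\<lambda>x. frechet_derivative f (at x) v" "\<lambda>x. D x v"]
    by simp
  moreover have "\<forall>x\<in>S. f differentiable (at x)"
    using assms(2) by (auto simp: differentiable_def)
  ultimately show ?thesis by simp
qed

lemma Ck_on_SucE:
  assumes "Ck_on (Suc k) S f"
  obtains D where "\<And>x. x \<in> S \<Longrightarrow> (f has_derivative D x) (at x)" "\<And>v. Ck_on k S (\<lambda>x. D x v)"
proof (rule that)
  show "(f has_derivative frechet_derivative f (at x)) (at x)" if "x \<in> S" for x
    using assms that frechet_derivative_works by (simp, blast)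
qed (use assms in simp)

lemma Ck_on_const [simp]: "Ck_on k S (\<lambda>x. c)"
  by (induction k arbitrary: c) auto

lemma Ck_on_bounded_linear:
  assumes "bounded_linear L" "open S" "Ck_on k S f"
  shows "Ck_on k S (\<lambda>x. L (f x))"
  using assms(3)
proof (induction k arbitrary: f)
  case 0
  then show ?case using bounded_linear.continuous_on[OF assms(1)] by simp
next
  case (Suc k)
  obtain D where D: "\<And>x. x \<in> S \<Longrightarrow> (f has_derivative D x) (at x)" "\<And>v. Ck_on k S (\<lambda>x. D x v)"
    using Suc.prems by (rule Ck_on_SucE) (rule that)
  show ?case
    by (rule Ck_on_SucI[OF assms(2), where D="\<lambda>x v. L (D x v)"])
      (auto intro!: D Suc.IH bounded_linear.has_derivative[OF assms(1)])
qed

lemma Ck_on_ident: "open S \<Longrightarrow> Ck_on k S (\<lambda>x. x)"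
proof (cases k)
  case (Suc j)
  assume "open S"
  then show ?thesis unfolding Suc
    by (intro Ck_on_SucI[where D="\<lambda>x v. v"]) (auto intro: derivative_intros)
qed (simp add: continuous_on_id)

lemma Ck_on_add:
  assumes "open S" "Ck_on k S f" "Ck_on k S g"
  shows "Ck_on k S (\<lambda>x. f x + g x)"
  using assms(2,3)
proof (induction k arbitrary: f g)
  case 0
  then show ?case by (simp add: continuous_on_add)
next
  case (Suc k)
  obtain D where D: "\<And>x. x \<in> S \<Longrightarrow> (f has_derivative D x) (at x)" "\<And>v. Ck_on k S (\<lambda>x. D x v)"
    using Suc.prems(1) by (rule Ck_on_SucE) (rule that)
  obtain E where E: "\<And>x. x \<in> S \<Longrightarrow> (g has_derivative E x) (at x)" "\<And>v. Ck_on k S (\<lambda>x. E x v)"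
    using Suc.prems(2) by (rule Ck_on_SucE) (rule that)
  show ?case
    by (rule Ck_on_SucI[OF assms(1), where D="\<lambda>x v. D x v + E x v"])
      (auto intro!: D E Suc.IH derivative_intros)
qed

lemma Ck_on_mult:
  fixes f g :: "'a::real_normed_vector \<Rightarrow> real"
  assumes "open S" "Ck_on k S f" "Ck_on k S g"
  shows "Ck_on k S (\<lambda>x. f x * g x)"
  using assms(2,3)
proof (induction k arbitrary: f g)
  case 0
  then show ?case by (simp add: continuous_on_mult)
next
  case (Suc k)
  obtain D where D: "\<And>x. x \<in> S \<Longrightarrow> (f has_derivative D x) (at x)" "\<And>v. Ck_on k S (\<lambda>x. D x v)"
    using Suc.prems(1) by (rule Ck_on_SucE) (rule that)
  obtain E where E: "\<And>x. x \<in> S \<Longrightarrow> (g has_derivative E x) (at x)" "\<And>v. Ck_on k S (\<lambda>x. E x v)"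
    using Suc.prems(2) by (rule Ck_on_SucE) (rule that)
  note [intro] = Ck_on_SucD[OF Suc.prems(1)] Ck_on_SucD[OF Suc.prems(2)]
  show ?case
    by (rule Ck_on_SucI[OF assms(1), where D="\<lambda>x v. f x * E x v + D x v * g x"])
      (auto intro!: D E Suc.IH derivative_intros Ck_on_add assms(1))
qed

lemma Ck_on_sum:
  assumes "open S" "\<And>i. i \<in> I \<Longrightarrow> Ck_on k S (f i)"
  shows "Ck_on k S (\<lambda>x. \<Sum>i\<in>I. f i x)"
  using assms(2) by (induction I rule: infinite_finite_induct) (auto intro: Ck_on_add assms(1))

text \<open>
  The derivative of the composite is a sum over a basis of products of a component of the derivative
  of \<open>f\<close> with a directional derivative of \<open>g\<close> composed with \<open>f\<close>, to which the induction hypothesis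
  applies because \<open>g\<close> is arbitrary in it.
\<close>

lemma Ck_on_compose:
  fixes f :: "'a::real_normed_vector \<Rightarrow> 'b::euclidean_space" and g :: "'b \<Rightarrow> real"
  assumes "open S" "open T" "f ` S \<subseteq> T" "Ck_on k S f" "Ck_on k T g"
  shows "Ck_on k S (\<lambda>x. g (f x))"
  using assms(4,5)
proof (induction k arbitrary: g)
  case 0
  then show ?case
    using assms(3) by (auto intro: continuous_on_compose2)
next
  case (Suc k)
  obtain D where D: "\<And>x. x \<in> S \<Longrightarrow> (f has_derivative D x) (at x)" "\<And>v. Ck_on k S (\<lambda>x. D x v)"
    using Suc.prems(1) by (rule Ck_on_SucE) (rule that)
  obtain E where E: "\<And>x. x \<in> T \<Longrightarrow> (g has_derivative E x) (at x)" "\<And>v. Ck_on k T (\<lambda>x. E x v)"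
    using Suc.prems(2) by (rule Ck_on_SucE) (rule that)
  have "E (f x) (D x v) = (\<Sum>i\<in>Basis. (D x v \<bullet> i) * E (f x) i)" if "x \<in> S" for x v
  proof -
    interpret bounded_linear "E (f x)"
      using E(1) assms(3) that by (auto intro: has_derivative_bounded_linear)
    have "E (f x) (D x v) = E (f x) (\<Sum>i\<in>Basis. (D x v \<bullet> i) *\<^sub>R i)"
      by (simp add: euclidean_representation)
    then show ?thesis by (simp add: sum scaleR)
  qed
  moreover have "((\<lambda>x. g (f x)) has_derivative (\<lambda>v. E (f x) (D x v))) (at x)" if "x \<in> S" for x
    using diff_chain_at[OF D(1)[OF that] E(1)[of "f x"]] assms(3) that by (auto simp: o_def)
  ultimately have "((\<lambda>x. g (f x)) has_derivative (\<lambda>v. \<Sum>i\<in>Basis. (D x v \<bullet> i) * E (f x) i)) (at x)"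
    if "x \<in> S" for x using that by simp
  moreover have "Ck_on k S (\<lambda>x. \<Sum>i\<in>Basis. (D x v \<bullet> i) * E (f x) i)" for v
    by (intro Ck_on_sum Ck_on_mult Ck_on_bounded_linear[OF bounded_linear_inner_left] D
        Suc.IH E Ck_on_SucD[OF Suc.prems(1)] assms(1))
  ultimately show ?case by (rule Ck_on_SucI[OF assms(1)])
qed

lemma Ck_on_inverse: "Ck_on k {0<..} (inverse :: real \<Rightarrow> real)"
proof (induction k)
  case 0
  then show ?case by (auto intro!: continuous_intros)
next
  case (Suc k)
  show ?case
  proof (rule Ck_on_SucI[where D="\<lambda>x v. (- v) * (inverse x * inverse x)"])
    show "Ck_on k {0<..} (\<lambda>x. (- v) * (inverse x * inverse x))" for v :: real
      by (intro Ck_on_mult Suc Ck_on_const open_greaterThan)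
  qed (auto intro!: derivative_eq_intros)
qed

text \<open>
  The powers \<open>x\<^sup>-\<^sup>m\<close> are included because the derivative of each of these functions is a combination of
  the two with the next exponents; smoothness is then one induction for all \<open>m\<close>.
\<close>

definition flat_exp :: "nat \<Rightarrow> real \<Rightarrow> real" where
  "flat_exp m x = (if x > 0 then inverse x ^ m * exp (- inverse x) else 0)"

lemma flat_exp_tendsto_0: "(flat_exp m \<longlongrightarrow> 0) (at 0)"
proof -
  have "((\<lambda>x. inverse x ^ m / exp (inverse x)) \<longlongrightarrow> (0::real)) (at_right 0)"
    by (rule filterlim_compose[OF tendsto_power_div_exp_0 filterlim_inverse_at_top_right])
  then have "(flat_exp m \<longlongrightarrow> 0) (at_right 0)"
    by (rule Lim_transform_eventually)
      (auto simp: eventually_at_filter flat_exp_def exp_minus divide_inverse)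
  moreover have "(flat_exp m \<longlongrightarrow> 0) (at_left 0)"
    by (rule Lim_transform_eventually[OF tendsto_const])
      (auto simp: eventually_at_filter flat_exp_def)
  ultimately show ?thesis by (rule filterlim_split_at_real[rotated])
qed

lemma flat_exp_DERIV:
  "(flat_exp m has_field_derivative (flat_exp (m + 2) x - real m * flat_exp (m + 1) x)) (at x)"
proof -
  consider "x > 0" | "x < 0" | "x = 0" by linarith
  then show ?thesis
  proof cases
    case 1
    have inv: "((\<lambda>x. inverse x) has_field_derivative - (inverse x * inverse x)) (at x)"
      using 1 DERIV_inverse[of x UNIV] by (simp add: power2_eq_square)
    have pow: "((\<lambda>x. inverse x ^ m) has_field_derivative
        real m * (- (inverse x * inverse x) * inverse x ^ (m - Suc 0))) (at x)"
      using DERIV_power[OF inv, of m] by (simp add: mult.assoc)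
    have exp: "((\<lambda>x. exp (- inverse x)) has_field_derivative
        exp (- inverse x) * (inverse x * inverse x)) (at x)"
      using DERIV_fun_exp[OF DERIV_minus[OF inv]] by simp
    have "real m * (- (inverse x * inverse x) * inverse x ^ (m - Suc 0)) = - real m * inverse x ^ (m + 1)"
      by (cases m) (simp_all add: algebra_simps)
    note DERIV_mult[OF pow[unfolded this] exp]
    then have "((\<lambda>x. inverse x ^ m * exp (- inverse x)) has_field_derivative
        (flat_exp (m + 2) x - real m * flat_exp (m + 1) x)) (at x)"
      by (rule DERIV_cong) (use 1 in \<open>simp add: flat_exp_def power2_eq_square algebra_simps\<close>)
    then show ?thesis
      by (rule has_field_derivative_transform_within_open[of _ _ _ "{0<..}"])
        (use 1 in \<open>auto simp: flat_exp_def\<close>)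
  next
    case 2
    have "((\<lambda>x. 0) has_field_derivative
        (flat_exp (m + 2) x - real m * flat_exp (m + 1) x)) (at x)"
      using 2 by (simp add: flat_exp_def)
    then show ?thesis
      by (rule has_field_derivative_transform_within_open[of _ _ _ "{..<0}"])
        (use 2 in \<open>auto simp: flat_exp_def\<close>)
  next
    case 3
    have "((\<lambda>h. (flat_exp m h - flat_exp m 0) / h) \<longlongrightarrow> 0) (at 0)"
      by (rule Lim_transform_eventually[OF flat_exp_tendsto_0[of "Suc m"]])
        (auto simp: eventually_at_filter flat_exp_def field_simps)
    then show ?thesis unfolding 3 DERIV_def by (simp add: flat_exp_def)
  qed
qed

lemma Ck_on_flat_exp: "Ck_on k UNIV (flat_exp m)"
proof (induction k arbitrary: m)
  case 0
  then show ?case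
    by (auto intro!: continuous_at_imp_continuous_on DERIV_isCont flat_exp_DERIV)
next
  case (Suc k)
  show ?case
  proof (rule Ck_on_SucI[where D="\<lambda>x v. (flat_exp (m + 2) x + (- real m) * flat_exp (m + 1) x) * v"])
    show "Ck_on k UNIV (\<lambda>x. (flat_exp (m + 2) x + (- real m) * flat_exp (m + 1) x) * v)" for v
      by (intro Ck_on_add Ck_on_mult Suc Ck_on_const open_UNIV)
  qed (use flat_exp_DERIV[of m] in \<open>simp_all add: has_field_derivative_def\<close>)
qed

text \<open>
  The quotient \<open>u / (u + w)\<close>, where \<open>u\<close> vanishes exactly outside the ball of radius \<open>R\<close> and \<open>w\<close> exactly
  on the closed ball of radius \<open>r\<close>, so that the denominator is never 0.
\<close>

lemma smooth_bump:
  fixes a :: "'e::euclidean_space"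
  assumes "0 < r" "r < R"
  obtains b :: "'e \<Rightarrow> real" where "smooth_on UNIV b"
    "\<And>x. dist a x \<le> r \<Longrightarrow> b x = 1" "\<And>x. R \<le> dist a x \<Longrightarrow> b x = 0"
proof -
  define q where "q = (\<lambda>x::'e. (x - a) \<bullet> (x - a))"
  have q: "q x = (dist a x)\<^sup>2" for x
    by (simp add: q_def dist_norm power2_norm_eq_inner[symmetric] norm_minus_commute)
  define u where "u = (\<lambda>x. flat_exp 0 (R\<^sup>2 - q x))"
  define w where "w = (\<lambda>x. flat_exp 0 (q x - r\<^sup>2))"
  have "u x > 0 \<or> w x > 0" "u x \<ge> 0" "w x \<ge> 0" for x
    using assms power_strict_mono[of r R 2] by (auto simp: u_def w_def flat_exp_def)
  then have pos: "u x + w x > 0" for x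
    by (smt (verit))
  have lin: "Ck_on k UNIV (\<lambda>x::'e. x + c)" for k c
    by (intro Ck_on_add Ck_on_ident) auto
  have Cq: "Ck_on k UNIV q" for k
  proof -
    have "Ck_on k UNIV (\<lambda>x. \<Sum>i\<in>Basis. ((x + (- a)) \<bullet> i) * ((x + (- a)) \<bullet> i))"
      by (intro Ck_on_sum Ck_on_mult Ck_on_bounded_linear[OF bounded_linear_inner_left] lin) auto
    then show ?thesis
      unfolding q_def by (subst euclidean_inner) simp
  qed
  have Cu: "Ck_on k UNIV u" for k
    unfolding u_def
    by (rule Ck_on_compose[of _ UNIV _ _ "flat_exp 0"])
      (use Ck_on_add[OF _ Ck_on_const[of _ _ "R\<^sup>2"] Ck_on_mult[OF _ Ck_on_const[of _ _ "-1"] Cq[of k]]]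
        in \<open>auto simp: Ck_on_flat_exp\<close>)
  have Cw: "Ck_on k UNIV w" for k
    unfolding w_def
    by (rule Ck_on_compose[of _ UNIV _ _ "flat_exp 0"])
      (use Ck_on_add[OF _ Ck_on_const[of _ _ "-r\<^sup>2"] Cq[of k]]
        in \<open>auto simp: Ck_on_flat_exp\<close>)
  have "Ck_on k UNIV (\<lambda>x. inverse (u x + w x))" for k
    by (rule Ck_on_compose[of _ "{0<..}"])
      (use pos in \<open>auto intro: Ck_on_inverse Ck_on_add Cu Cw\<close>)
  then have "Ck_on k UNIV (\<lambda>x. u x * inverse (u x + w x))" for k
    using Ck_on_mult[OF open_UNIV Cu] by blast
  moreover have "u x * inverse (u x + w x) = 1" if "dist a x \<le> r" for x
  proof -
    have "w x = 0" using power_mono[OF that zero_le_dist, of 2] by (simp add: w_def q flat_exp_def)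
    then show ?thesis using pos[of x] by simp
  qed
  moreover have "u x * inverse (u x + w x) = 0" if "R \<le> dist a x" for x
  proof -
    have "u x = 0"
      using power_mono[OF that, of 2] assms by (simp add: u_def q flat_exp_def del: power_mono_iff)
    then show ?thesis by simp
  qed
  ultimately show ?thesis
    by (intro that[of "\<lambda>x. u x * inverse (u x + w x)"]) (auto simp: smooth_on_def)
qed


section \<open>Hadamard's lemma\<close>

text \<open>
  Differentiation under the integral sign replaces \<open>H\<close> by a directional derivative and brings out one
  more factor \<open>t\<close>. The weight \<open>t\<^sup>m\<close> makes the statement stable under this step.
\<close>

lemma Ck_on_ray_integral:
  fixes H :: "'e::euclidean_space \<Rightarrow> real"
  assumes "Ck_on k (ball a R) H"
  shows "Ck_on k (ball a R) (\<lambda>x. integral {0..1} (\<lambda>t. t ^ m * H (a + t *\<^sub>R (x - a))))"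
  using assms
proof (induction k arbitrary: H m)
  have ray: "a + t *\<^sub>R (x - a) \<in> ball a R" if "x \<in> ball a R" "t \<in> {0..1}" for x t
    using mult_left_le_one_le[of "norm (x - a)" t] that
    by (auto simp: dist_norm norm_minus_commute)
  have cont: "continuous_on (ball a R \<times> {0..1}) (\<lambda>z. snd z ^ m * K (a + snd z *\<^sub>R (fst z - a)))"
    if "continuous_on (ball a R) K" for K :: "'e \<Rightarrow> real" and m
  proof -
    have "continuous_on (ball a R \<times> {0..1}) (\<lambda>z. K (a + snd z *\<^sub>R (fst z - a)))"
      by (rule continuous_on_compose2[OF that])
        (use ray in \<open>auto intro!: continuous_intros simp del: mem_ball\<close>)
    then show ?thesis by (intro continuous_intros)
  qed
  {
    case 0
    then show ?case
      using integral_continuous_on_param[of "ball a R" 0 1 "\<lambda>x t. t ^ m * H (a + t *\<^sub>R (x - a))"] cont[of H m]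
      by (simp add: split_beta)
  next
    case (Suc k)
    obtain D where D: "\<And>x. x \<in> ball a R \<Longrightarrow> (H has_derivative D x) (at x)"
        "\<And>v. Ck_on k (ball a R) (\<lambda>x. D x v)"
      using Suc.prems by (rule Ck_on_SucE) (rule that)
    have Dcont: "continuous_on (ball a R) (\<lambda>x. D x v)" for v
    proof -
      have "Ck_on 0 (ball a R) (\<lambda>x. D x v)"
        using D(2)[of v] by (induction k) (auto dest: Ck_on_SucD simp del: Ck_on.simps)
      then show ?thesis by simp
    qed
    have Hcont: "continuous_on (ball a R) H"
      using D(1) by (auto intro!: continuous_at_imp_continuous_on has_derivative_continuous)
    define L where "L = (\<lambda>x t. Blinfun (\<lambda>v. t ^ Suc m * D (a + t *\<^sub>R (x - a)) v))"
    have lin: "bounded_linear (\<lambda>v. t ^ Suc m * D (a + t *\<^sub>R (x - a)) v)"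
      if "x \<in> ball a R" "t \<in> {0..1}" for x t
      using D(1)[OF ray[OF that]] by (intro bounded_linear_const_mult has_derivative_bounded_linear)
    have L: "blinfun_apply (L x t) v = t ^ Suc m * D (a + t *\<^sub>R (x - a)) v"
      if "x \<in> ball a R" "t \<in> {0..1}" for x t v
      unfolding L_def by (simp only: bounded_linear_Blinfun_apply[OF lin[OF that]])
    have Lcont: "continuous_on (ball a R \<times> {0..1}) (\<lambda>z. L (fst z) (snd z))"
    proof (rule continuous_on_blinfun_componentwise)
      fix i :: 'e
      show "continuous_on (ball a R \<times> {0..1}) (\<lambda>z. blinfun_apply (L (fst z) (snd z)) i)"
        using cont[OF Dcont[of i], of "Suc m"]
        by (rule continuous_on_eq) (auto simp: L simp del: mem_ball)
    qed
    have der: "((\<lambda>x. t ^ m * H (a + t *\<^sub>R (x - a))) has_derivative blinfun_apply (L x t)) (at x within ball a R)"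
      if "x \<in> ball a R" "t \<in> cbox 0 1" for x t
    proof -
      have "((\<lambda>x. H (a + t *\<^sub>R (x - a))) has_derivative (\<lambda>v. D (a + t *\<^sub>R (x - a)) (t *\<^sub>R v))) (at x)"
        using that by (intro has_derivative_compose[OF _ D(1)] ray) (auto intro!: derivative_eq_intros)
      moreover have "D (a + t *\<^sub>R (x - a)) (t *\<^sub>R v) = t * D (a + t *\<^sub>R (x - a)) v" for v
        using linear_scale[OF has_derivative_linear[OF D(1)[OF ray]], of x t t v] that by simp
      ultimately have "((\<lambda>x. H (a + t *\<^sub>R (x - a))) has_derivative (\<lambda>v. t * D (a + t *\<^sub>R (x - a)) v)) (at x)"
        by (simp only:)
      then have der: "((\<lambda>x. t ^ m * H (a + t *\<^sub>R (x - a))) has_derivative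
          (\<lambda>v. t ^ m * (t * D (a + t *\<^sub>R (x - a)) v))) (at x)"
        by (rule has_derivative_mult_right)
      show ?thesis
      proof (rule has_derivative_at_withinI)
        have "blinfun_apply (L x t) = (\<lambda>v. t ^ m * (t * D (a + t *\<^sub>R (x - a)) v))"
        proof
          have "t \<in> {0..1}" using that by simp
          then show "blinfun_apply (L x t) v = t ^ m * (t * D (a + t *\<^sub>R (x - a)) v)" for v
            by (simp only: L[OF that(1)] power_Suc2 mult.assoc)
        qed
        with der
        show "((\<lambda>x. t ^ m * H (a + t *\<^sub>R (x - a))) has_derivative blinfun_apply (L x t)) (at x)"
          by (simp only:)
      qed
    qed
    have slice: "continuous_on {0..1} (\<lambda>t. K (x, t))"
      if "continuous_on (ball a R \<times> {0..1}) K" "x \<in> ball a R"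
      for x and K :: "'e \<times> real \<Rightarrow> 'c::real_normed_vector"
      by (rule continuous_on_compose2[OF that(1)])
        (use that(2) in \<open>auto intro!: continuous_intros\<close>)
    have int: "(\<lambda>t. t ^ m * H (a + t *\<^sub>R (x - a))) integrable_on cbox 0 1" if "x \<in> ball a R" for x
      using slice[OF cont[OF Hcont, of m] that] by (simp add: integrable_continuous_interval)
    have intL: "L x integrable_on cbox 0 1" if "x \<in> ball a R" for x
      using slice[OF Lcont that] by (simp add: integrable_continuous_interval)
    show ?case
    proof (rule Ck_on_SucI)
      fix x assume x: "x \<in> ball a R"
      have "((\<lambda>x. integral (cbox 0 1) (\<lambda>t. t ^ m * H (a + t *\<^sub>R (x - a)))) has_derivative
          blinfun_apply (integral (cbox 0 1) (L x))) (at x within ball a R)"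
        using Lcont by (intro leibniz_rule der int x convex_ball) (auto simp: split_beta)
      moreover have "blinfun_apply (integral (cbox 0 1) (L x))
          = (\<lambda>v. integral {0..1} (\<lambda>t. t ^ Suc m * D (a + t *\<^sub>R (x - a)) v))"
      proof
        fix v
        have "blinfun_apply (integral (cbox 0 1) (L x)) v
            = integral (cbox 0 1) ((\<lambda>b. blinfun_apply b v) \<circ> L x)"
          using integral_linear[OF intL[OF x] blinfun.bounded_linear_left] by simp
        also have "\<dots> = integral {0..1} (\<lambda>t. t ^ Suc m * D (a + t *\<^sub>R (x - a)) v)"
          using L[OF x] by (auto intro!: integral_cong simp del: power_Suc)
        finally show "blinfun_apply (integral (cbox 0 1) (L x)) v
          = integral {0..1} (\<lambda>t. t ^ Suc m * D (a + t *\<^sub>R (x - a)) v)" .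
      qed
      ultimately show "((\<lambda>x. integral {0..1} (\<lambda>t. t ^ m * H (a + t *\<^sub>R (x - a)))) has_derivative
          (\<lambda>v. integral {0..1} (\<lambda>t. t ^ Suc m * D (a + t *\<^sub>R (x - a)) v))) (at x)"
        using x by (simp add: at_within_open[OF _ open_ball] del: power_Suc mem_ball)
    next
      fix v
      show "Ck_on k (ball a R) (\<lambda>x. integral {0..1} (\<lambda>t. t ^ Suc m * D (a + t *\<^sub>R (x - a)) v))"
        by (rule Suc.IH[OF D(2)])
    qed simp
  }
qed

text \<open>
  The fundamental theorem of calculus along the segment from \<open>a\<close> to \<open>x\<close>. This is what makes a
  derivation at a point determined by its values on coordinate functions.
\<close>

lemma hadamard:
  fixes F :: "'e::euclidean_space \<Rightarrow> real"
  assumes F: "smooth_on (ball a R) F" and "0 < R"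
  obtains g where "\<And>i. smooth_on (ball a R) (g i)" "\<And>i. g i a = frechet_derivative F (at a) i"
    "\<And>x. x \<in> ball a R \<Longrightarrow> F x = F a + (\<Sum>i\<in>Basis. g i x * ((x - a) \<bullet> i))"
proof -
  define D where "D = (\<lambda>x. frechet_derivative F (at x))"
  have Ck: "Ck_on (Suc k) (ball a R) F" for k
    using F by (simp only: smooth_on_def)
  have D: "(F has_derivative D x) (at x)" if "x \<in> ball a R" for x
    using Ck[of 0] that frechet_derivative_works[of F "at x"] by (simp add: D_def)
  have CD: "Ck_on k (ball a R) (\<lambda>x. D x v)" for k v
    using Ck[of k] by (simp add: D_def)
  define g where "g = (\<lambda>i x. integral {0..1} (\<lambda>t. t ^ 0 * D (a + t *\<^sub>R (x - a)) i))"
  show ?thesis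
  proof
    show "smooth_on (ball a R) (g i)" for i
      unfolding g_def smooth_on_def by (intro allI Ck_on_ray_integral CD)
    show "g i a = frechet_derivative F (at a) i" for i
      by (simp add: g_def D_def)
    fix x assume x: "x \<in> ball a R"
    have ray: "a + t *\<^sub>R (x - a) \<in> ball a R" if "t \<in> {0..1}" for t
      using mult_left_le_one_le[of "norm (x - a)" t] that x
      by (auto simp: dist_norm norm_minus_commute)
    have lin: "D (a + t *\<^sub>R (x - a)) (x - a) = (\<Sum>i\<in>Basis. ((x - a) \<bullet> i) * D (a + t *\<^sub>R (x - a)) i)"
      if "t \<in> {0..1}" for t
    proof -
      interpret linear "D (a + t *\<^sub>R (x - a))"
        using D[OF ray[OF that]] by (rule has_derivative_linear)
      have "D (a + t *\<^sub>R (x - a)) (x - a)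
          = D (a + t *\<^sub>R (x - a)) (\<Sum>i\<in>Basis. ((x - a) \<bullet> i) *\<^sub>R i)"
        by (simp only: euclidean_representation)
      then show ?thesis by (simp add: sum scaleR)
    qed
    have "((\<lambda>t. F (a + t *\<^sub>R (x - a))) has_vector_derivative D (a + t *\<^sub>R (x - a)) (x - a)) (at t within {0..1})"
      if "t \<in> {0..1}" for t
    proof -
      have "((\<lambda>t. F (a + t *\<^sub>R (x - a))) has_derivative
          (\<lambda>s. D (a + t *\<^sub>R (x - a)) (s *\<^sub>R (x - a)))) (at t within {0..1})"
        by (intro has_derivative_compose[OF _ D] ray that) (auto intro!: derivative_eq_intros)
      then show ?thesis
        unfolding has_vector_derivative_def
        using linear_scale[OF has_derivative_linear[OF D[OF ray[OF that]]]] by simp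
    qed
    then have "((\<lambda>t. D (a + t *\<^sub>R (x - a)) (x - a)) has_integral
        (F (a + 1 *\<^sub>R (x - a)) - F (a + 0 *\<^sub>R (x - a)))) {0..1}"
      by (intro fundamental_theorem_of_calculus) auto
    then have "F x - F a = integral {0..1} (\<lambda>t. D (a + t *\<^sub>R (x - a)) (x - a))"
      by (simp add: integral_unique)
    also have "\<dots> = integral {0..1} (\<lambda>t. \<Sum>i\<in>Basis. ((x - a) \<bullet> i) * D (a + t *\<^sub>R (x - a)) i)"
      using lin by (rule integral_cong)
    also have "\<dots> = (\<Sum>i\<in>Basis. ((x - a) \<bullet> i) * g i x)"
    proof (subst integral_sum)
      show "(\<lambda>t. (x - a) \<bullet> i * D (a + t *\<^sub>R (x - a)) i) integrable_on {0..1}" for i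
      proof -
        have "continuous_on (ball a R) (\<lambda>x. D x i)"
          using CD[of 0 i] by simp
        then have "continuous_on {0..1} (\<lambda>t. D (a + t *\<^sub>R (x - a)) i)"
          by (rule continuous_on_compose2) (use ray in \<open>auto intro!: continuous_intros simp del: mem_ball\<close>)
        then show ?thesis
          by (intro integrable_continuous_interval continuous_intros)
      qed
    qed (simp_all add: g_def)
    finally show "F x = F a + (\<Sum>i\<in>Basis. g i x * ((x - a) \<bullet> i))"
      by (simp add: mult.commute)
  qed
qed

section \<open>Smooth functions, tangent vectors and vector fields\<close>

lemma smooth_on_add: "open S \<Longrightarrow> smooth_on S f \<Longrightarrow> smooth_on S g \<Longrightarrow> smooth_on S (\<lambda>x. f x + g x)"
  by (simp add: smooth_on_def Ck_on_add)

lemma smooth_on_mult: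
  fixes f g :: "'a::real_normed_vector \<Rightarrow> real"
  shows "open S \<Longrightarrow> smooth_on S f \<Longrightarrow> smooth_on S g \<Longrightarrow> smooth_on S (\<lambda>x. f x * g x)"
  by (simp add: smooth_on_def Ck_on_mult)

lemma smooth_on_const: "smooth_on S (\<lambda>x. c)"
  by (simp add: smooth_on_def)

lemma smooth_on_Un: "open S \<Longrightarrow> open T \<Longrightarrow> smooth_on S f \<Longrightarrow> smooth_on T f \<Longrightarrow> smooth_on (S \<union> T) f"
  by (simp add: smooth_on_def Ck_on_Un)

lemma smooth_on_subset: "smooth_on S f \<Longrightarrow> T \<subseteq> S \<Longrightarrow> smooth_on T f"
  by (meson smooth_on_def Ck_on_subset)

lemma smooth_on_cong:
  assumes "open S" "\<And>x. x \<in> S \<Longrightarrow> f x = g x"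
  shows "smooth_on S f \<longleftrightarrow> smooth_on S g"
  using Ck_on_cong[OF assms] by (simp add: smooth_on_def)

lemma smooth_on_compose:
  fixes f :: "'a::real_normed_vector \<Rightarrow> 'b::euclidean_space" and g :: "'b \<Rightarrow> real"
  assumes "open S" "open T" "f ` S \<subseteq> T" "smooth_on S f" "smooth_on T g"
  shows "smooth_on S (\<lambda>x. g (f x))"
  using assms Ck_on_compose[OF assms(1-3)] by (simp add: smooth_on_def)

lemma smooth_on_differentiable: "smooth_on S f \<Longrightarrow> x \<in> S \<Longrightarrow> f differentiable (at x)"
  unfolding smooth_on_def by (drule spec[of _ "Suc 0"]) simp

lemma smooth_on_derivative:
  assumes "smooth_on S f" shows "smooth_on S (\<lambda>x. frechet_derivative f (at x) v)"
  unfolding smooth_on_def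
proof
  fix k
  have "Ck_on (Suc k) S f" using assms by (simp only: smooth_on_def)
  then show "Ck_on k S (\<lambda>x. frechet_derivative f (at x) v)" by simp
qed

lemma smooth_on_inner_left: "open S \<Longrightarrow> smooth_on S (\<lambda>x. (x - a) \<bullet> i)"
proof -
  assume S: "open S"
  have "Ck_on k S (\<lambda>x. (x + - a) \<bullet> i)" for k
    by (intro Ck_on_bounded_linear[OF bounded_linear_inner_left] Ck_on_add Ck_on_ident Ck_on_const S)
  then show ?thesis by (simp add: smooth_on_def)
qed

text \<open>
  The product vanishes on the open complement of \<open>K\<close>, whatever the values of \<open>g\<close>, and this set covers the
  space together with \<open>S\<close>.
\<close>

lemma smooth_on_cutoff:
  fixes \<rho> g :: "'a::real_normed_vector \<Rightarrow> real"
  assumes "smooth_on UNIV \<rho>" "\<And>x. x \<notin> K \<Longrightarrow> \<rho> x = 0" "closed K" "K \<subseteq> S" "open S" "smooth_on S g"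
  shows "smooth_on UNIV (\<lambda>x. \<rho> x * g x)"
proof -
  have "smooth_on S (\<lambda>x. \<rho> x * g x)"
    using assms smooth_on_subset by (blast intro: smooth_on_mult)
  moreover have "smooth_on (- K) (\<lambda>x. \<rho> x * g x)"
    using smooth_on_cong[of "- K" "\<lambda>x. \<rho> x * g x" "\<lambda>x. 0"] assms smooth_on_const by auto
  moreover have "S \<union> - K = UNIV" using assms(4) by auto
  ultimately show ?thesis
    using smooth_on_Un[of S "- K" "\<lambda>x. \<rho> x * g x"] assms by auto
qed

lemma sum_fun_apply: "(\<Sum>i\<in>I. f i) x = (\<Sum>i\<in>I. f i x)"
  by (induction I rule: infinite_finite_induct) auto

lemma fscale_simps:
  "(f + g) \<odot> X = f \<odot> X + g \<odot> X" "(f - g) \<odot> X = f \<odot> X - g \<odot> X" "(- f) \<odot> X = - (f \<odot> X)"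
  "f \<odot> (X + Y) = f \<odot> X + f \<odot> Y" "f \<odot> (X - Y) = f \<odot> X - f \<odot> Y" "f \<odot> (- X) = - (f \<odot> X)"
  "f \<odot> (g \<odot> X) = (f * g) \<odot> X" "1 \<odot> X = X" "0 \<odot> X = 0" "f \<odot> (0 :: 'a vfield) = 0"
  "(k *\<^sub>R f) \<odot> X = k *\<^sub>R (f \<odot> X)" "f \<odot> (k *\<^sub>R X) = k *\<^sub>R (f \<odot> X)"
  by (auto simp: fscale_def fun_eq_iff algebra_simps)

lemma fscale_const: "(\<lambda>p. k) \<odot> X = k *\<^sub>R X"
  by (auto simp: fscale_def fun_eq_iff)

locale smooth_manifold =
  fixes M :: "('a::{t2_space,second_countable_topology}, 'e::euclidean_space) chart set"
  assumes atlas: "smooth_atlas M"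
begin

abbreviation "C \<equiv> smooth_functions M"
abbreviation "\<Gamma> \<equiv> vector_fields M"

lemma chart:
  assumes "(U, c) \<in> M"
  shows "open U" "open (c ` U)" "homeomorphism U (c ` U) c (inv_into U c)" "inj_on c U"
proof -
  show "open U" "open (c ` U)" and h: "homeomorphism U (c ` U) c (inv_into U c)"
    using atlas assms by (auto simp: smooth_atlas_def)
  show "inj_on c U" using h by (metis homeomorphism_def inj_on_inverseI)
qed

lemma chart_at: obtains U c where "(U, c) \<in> M" "p \<in> U"
proof -
  have "p \<in> (\<Union>(U, c)\<in>M. U)" using atlas by (simp add: smooth_atlas_def)
  then show ?thesis using that by auto
qed

lemma transition_smooth:
  "(U, c) \<in> M \<Longrightarrow> (V, d) \<in> M \<Longrightarrow> smooth_on (c ` (U \<inter> V)) (d \<circ> inv_into U c)"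
  using atlas by (auto simp: smooth_atlas_def)

lemma chart_open_image:
  assumes "(U, c) \<in> M" "open W" "W \<subseteq> U"
  shows "open (c ` W)"
proof -
  have "openin (top_of_set (c ` U)) (c ` W)"
    using assms chart(3)[OF assms(1)]
    by (intro homeomorphism_imp_open_map) (auto simp: openin_open)
  then show ?thesis using chart(2)[OF assms(1)] by (metis openin_open_eq)
qed

lemma in_C_iff: "f \<in> C \<longleftrightarrow> (\<forall>(U, c)\<in>M. smooth_on (c ` U) (\<lambda>x. f (inv_into U c x)))"
  by (simp add: smooth_functions_def o_def)

lemma C_const: "(\<lambda>p. k) \<in> C"
  by (auto simp: in_C_iff smooth_on_const)

lemma C_add: "f \<in> C \<Longrightarrow> g \<in> C \<Longrightarrow> f + g \<in> C"
  using chart(2) by (fastforce simp: in_C_iff intro!: smooth_on_add)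

lemma C_mult: "f \<in> C \<Longrightarrow> g \<in> C \<Longrightarrow> f * g \<in> C"
  using chart(2) by (fastforce simp: in_C_iff intro!: smooth_on_mult)

lemma C_scaleR: "f \<in> C \<Longrightarrow> k *\<^sub>R f \<in> C"
  using C_mult[OF C_const[of k]] by (simp add: times_fun_def scaleR_fun_def)

lemma C_0: "0 \<in> C" and C_1: "1 \<in> C"
  using C_const[of 0] C_const[of 1] by (simp_all add: zero_fun_def one_fun_def)

lemma C_uminus: "f \<in> C \<Longrightarrow> - f \<in> C"
  using C_scaleR[of f "-1"] by (simp add: scaleR_fun_def fun_Compl_def)

lemma C_diff: "f \<in> C \<Longrightarrow> g \<in> C \<Longrightarrow> f - g \<in> C"
  using C_add[OF _ C_uminus, of f g] by simp

lemma C_sum: "(\<And>i. i \<in> I \<Longrightarrow> f i \<in> C) \<Longrightarrow> (\<Sum>i\<in>I. f i) \<in> C"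
  by (induction I rule: infinite_finite_induct) (auto intro: C_0 C_add)

lemmas C_closed = C_const C_add C_mult C_scaleR C_0 C_1 C_uminus C_diff C_sum

abbreviation "T \<equiv> tangent_space M"

lemma tangent_rules:
  assumes "v \<in> T p"
  shows "f \<in> C \<Longrightarrow> g \<in> C \<Longrightarrow> v (f + g) = v f + v g"
    and "f \<in> C \<Longrightarrow> g \<in> C \<Longrightarrow> v (f * g) = f p * v g + g p * v f"
    and "f \<in> C \<Longrightarrow> v (k *\<^sub>R f) = k * v f"
    and "f \<notin> C \<Longrightarrow> v f = 0"
  using assms by (auto simp: tangent_space_def)

lemma tangent_0 [simp]: "v \<in> T p \<Longrightarrow> v 0 = 0"
  using tangent_rules(3)[of v p 0 0] by (simp add: C_0)

lemma tangent_1 [simp]: "v \<in> T p \<Longrightarrow> v 1 = 0"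
  using tangent_rules(2)[of v p 1 1] by (simp add: C_1)

lemma tangent_const [simp]: "v \<in> T p \<Longrightarrow> v (\<lambda>q. k) = 0"
proof -
  assume v: "v \<in> T p"
  have "(\<lambda>q. k) = k *\<^sub>R (1 :: 'a \<Rightarrow> real)" by (simp add: fun_eq_iff)
  then show ?thesis using tangent_rules(3)[OF v C_1, of k] v by simp
qed

lemma tangent_diff:
  assumes "v \<in> T p" "f \<in> C" "g \<in> C" shows "v (f - g) = v f - v g"
proof -
  have "f - g = f + (-1) *\<^sub>R g" by (simp add: fun_eq_iff)
  then show ?thesis
    using tangent_rules(1)[OF assms(1,2) C_scaleR[OF assms(3)], of "-1"]
      tangent_rules(3)[OF assms(1,3), of "-1"]
    by (simp only: mult_minus1 add_uminus_conv_diff)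
qed

lemma tangent_sum:
  assumes "v \<in> T p" "\<And>i. i \<in> I \<Longrightarrow> f i \<in> C" shows "v (\<Sum>i\<in>I. f i) = (\<Sum>i\<in>I. v (f i))"
  using assms(2)
proof (induction I rule: infinite_finite_induct)
  case (insert i I)
  then show ?case
    using tangent_rules(1)[OF assms(1), of "f i" "\<Sum>i\<in>I. f i"]
    by (simp only: sum.insert insert_iff C_sum simp_thms)
qed (use assms(1) in auto)

lemma subspace_T: "subspace (T p)"
  by (auto simp: subspace_def tangent_space_def algebra_simps)

lemma T_closed:
  "0 \<in> T p" "v \<in> T p \<Longrightarrow> w \<in> T p \<Longrightarrow> v + w \<in> T p" "v \<in> T p \<Longrightarrow> k *\<^sub>R v \<in> T p"
  "v \<in> T p \<Longrightarrow> - v \<in> T p" "v \<in> T p \<Longrightarrow> w \<in> T p \<Longrightarrow> v - w \<in> T p"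
  using subspace_T by (auto intro: subspace_0 subspace_add subspace_scale subspace_neg subspace_diff)

lemma vf_at: "X \<in> \<Gamma> \<Longrightarrow> X p \<in> T p"
  by (simp add: vector_fields_def)

lemma vf_C: "X \<in> \<Gamma> \<Longrightarrow> f \<in> C \<Longrightarrow> X \<rhd> f \<in> C"
  by (simp add: vector_fields_def)

lemma directional_apply: "(X \<rhd> f) p = X p f"
  by (simp add: directional_def)

lemma directional_rules:
  "(X + Y) \<rhd> f = X \<rhd> f + Y \<rhd> f" "(X - Y) \<rhd> f = X \<rhd> f - Y \<rhd> f"
  "(k *\<^sub>R X) \<rhd> f = k *\<^sub>R (X \<rhd> f)" "(g \<odot> X) \<rhd> f = g * (X \<rhd> f)"
  by (auto simp: directional_def fun_eq_iff fscale_def)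

lemma fscale_in_vf: "f \<in> C \<Longrightarrow> X \<in> \<Gamma> \<Longrightarrow> f \<odot> X \<in> \<Gamma>"
  unfolding vector_fields_def
  by (auto simp: directional_rules C_mult) (simp add: fscale_def T_closed)

lemma subspace_vf: "subspace \<Gamma>"
  using C_add C_scaleR C_0 T_closed
  by (auto simp: subspace_def vector_fields_def directional_rules)
    (auto simp: directional_def zero_fun_def)

lemma vf_closed:
  "0 \<in> \<Gamma>" "X \<in> \<Gamma> \<Longrightarrow> Y \<in> \<Gamma> \<Longrightarrow> X + Y \<in> \<Gamma>" "X \<in> \<Gamma> \<Longrightarrow> k *\<^sub>R X \<in> \<Gamma>"
  "X \<in> \<Gamma> \<Longrightarrow> - X \<in> \<Gamma>" "X \<in> \<Gamma> \<Longrightarrow> Y \<in> \<Gamma> \<Longrightarrow> X - Y \<in> \<Gamma>"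
  "(\<And>i. i \<in> I \<Longrightarrow> Z i \<in> \<Gamma>) \<Longrightarrow> (\<Sum>i\<in>I. Z i) \<in> \<Gamma>"
  using subspace_vf by (auto intro: subspace_0 subspace_add subspace_scale subspace_neg subspace_diff subspace_sum)

lemma directional_fun_rules:
  assumes "X \<in> \<Gamma>" "f \<in> C" "g \<in> C"
  shows "X \<rhd> (f + g) = X \<rhd> f + X \<rhd> g" "X \<rhd> (f - g) = X \<rhd> f - X \<rhd> g"
    "X \<rhd> (f * g) = f * (X \<rhd> g) + g * (X \<rhd> f)" "X \<rhd> (k *\<^sub>R f) = k *\<^sub>R (X \<rhd> f)"
    "X \<rhd> (\<lambda>p. k) = 0"
  using assms tangent_rules[OF vf_at[OF assms(1)]] tangent_diff[OF vf_at[OF assms(1)]]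
    tangent_const[OF vf_at[OF assms(1)]]
  by (auto simp: directional_def fun_eq_iff)

text \<open>
  The mixed products of first derivatives cancel in the commutator.
\<close>

lemma bracket_in_vf:
  assumes "X \<in> \<Gamma>" "Y \<in> \<Gamma>"
  shows "lie_bracket X Y \<in> \<Gamma>"
proof -
  note closed = C_closed vf_C assms
  have "lie_bracket X Y p \<in> T p" for p
    unfolding tangent_space_def
  proof (intro CollectI conjI ballI allI impI)
    fix f g assume fg: "f \<in> C" "g \<in> C"
    note rules = tangent_rules[OF vf_at[OF assms(1)]] tangent_rules[OF vf_at[OF assms(2)]]
      directional_fun_rules[OF assms(1)] directional_fun_rules[OF assms(2)] directional_apply
    show "lie_bracket X Y p (f + g) = lie_bracket X Y p f + lie_bracket X Y p g"
      by (simp add: lie_bracket_def rules fg closed)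
    show "lie_bracket X Y p (f * g) = f p * lie_bracket X Y p g + g p * lie_bracket X Y p f"
      by (simp add: lie_bracket_def rules fg closed algebra_simps)
  next
    fix k f assume f: "f \<in> C"
    show "lie_bracket X Y p (k *\<^sub>R f) = k * lie_bracket X Y p f"
      by (simp add: lie_bracket_def f closed tangent_rules[OF vf_at[OF assms(1)]]
          tangent_rules[OF vf_at[OF assms(2)]] directional_fun_rules[OF assms(1) f f]
          directional_fun_rules[OF assms(2) f f] algebra_simps)
  next
    fix f assume "f \<notin> C"
    then have "Y \<rhd> f = 0" "X \<rhd> f = 0"
      using tangent_rules(4)[OF vf_at[OF assms(1)]] tangent_rules(4)[OF vf_at[OF assms(2)]]
      by (auto simp: directional_def fun_eq_iff)
    then show "lie_bracket X Y p f = 0"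
      by (simp add: lie_bracket_def tangent_0[OF vf_at[OF assms(1)]] tangent_0[OF vf_at[OF assms(2)]])
  qed
  moreover have "lie_bracket X Y \<rhd> f = X \<rhd> Y \<rhd> f - Y \<rhd> X \<rhd> f" for f
    by (simp add: directional_def lie_bracket_def fun_eq_iff)
  ultimately show ?thesis
    using closed by (simp add: vector_fields_def)
qed

section \<open>Extension from charts and local frames\<close>

definition zero_extension :: "'a set \<Rightarrow> ('a \<Rightarrow> 'e) \<Rightarrow> ('e \<Rightarrow> real) \<Rightarrow> 'a \<Rightarrow> real" where
  "zero_extension U c g = (\<lambda>q. if q \<in> U then g (c q) else 0)"

text \<open>
  The preimage \<open>L\<close> of \<open>K\<close> is compact, hence closed because the manifold is Hausdorff. So in any other
  chart the function is smooth on two open sets that cover the chart: on the overlap it is \<open>g\<close> after a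
  transition map, and off \<open>L\<close> it is 0.
\<close>

lemma zero_extension_in_C:
  assumes Uc: "(U, c) \<in> M" and g: "smooth_on UNIV g"
    and K: "compact K" "K \<subseteq> c ` U" "\<And>x. x \<notin> K \<Longrightarrow> g x = 0"
  shows "zero_extension U c g \<in> C"
  unfolding in_C_iff
proof safe
  fix V d assume Vd: "(V, d) \<in> M"
  define L where "L = inv_into U c ` K"
  have inv_c: "inv_into U c (c q) = q" if "q \<in> U" for q
    using chart(4)[OF Uc] that by simp
  have inv_d: "inv_into V d (d q) = q" if "q \<in> V" for q
    using chart(4)[OF Vd] that by simp
  have "continuous_on K (inv_into U c)"
    using homeomorphism_cont2[OF chart(3)[OF Uc]] K(2) by (rule continuous_on_subset)
  then have "closed L"
    unfolding L_def using K(1) by (intro compact_imp_closed compact_continuous_image)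
  then have o2: "open (d ` (V - L))"
    using chart(1)[OF Vd] by (intro chart_open_image[OF Vd]) auto
  have o1: "open (d ` (V \<inter> U))"
    using chart(1)[OF Vd] chart(1)[OF Uc] by (intro chart_open_image[OF Vd]) auto
  have "smooth_on (d ` (V \<inter> U)) (\<lambda>x. g ((c \<circ> inv_into V d) x))"
    by (rule smooth_on_compose[OF o1 open_UNIV _ transition_smooth[OF Vd Uc] g]) simp
  then have s1: "smooth_on (d ` (V \<inter> U)) (\<lambda>x. zero_extension U c g (inv_into V d x))"
    by (subst smooth_on_cong[OF o1, of _ "\<lambda>x. g ((c \<circ> inv_into V d) x)"])
      (auto simp: zero_extension_def inv_d)
  have "zero_extension U c g (inv_into V d x) = 0" if x: "x \<in> d ` (V - L)" for x
  proof -
    obtain q where q: "q \<in> V" "q \<notin> L" "x = d q" using x by blast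
    have "c q \<notin> K" if "q \<in> U"
      using q(2) that inv_c[OF that] unfolding L_def by force
    then show ?thesis using q K(3) by (auto simp: zero_extension_def inv_d)
  qed
  then have s2: "smooth_on (d ` (V - L)) (\<lambda>x. zero_extension U c g (inv_into V d x))"
    by (subst smooth_on_cong[OF o2, of _ "\<lambda>x. 0"]) (auto simp: smooth_on_const)
  have "L \<subseteq> U" using K(2) by (auto simp: L_def inv_c)
  then have "d ` V = d ` (V \<inter> U) \<union> d ` (V - L)" by auto
  then show "smooth_on (d ` V) (\<lambda>x. zero_extension U c g (inv_into V d x))"
    using smooth_on_Un[OF o1 o2 s1 s2] by simp
qed

lemma smooth_in_chart: "f \<in> C \<Longrightarrow> (U, c) \<in> M \<Longrightarrow> smooth_on (c ` U) (f \<circ> inv_into U c)"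
  by (auto simp: smooth_functions_def)

text \<open>
  With Hadamard's lemma, \<open>f - f(q)\<close> is near \<open>q\<close> a sum of products of smooth functions with coordinates
  that vanish at \<open>q\<close>. Multiplication by bump functions makes this an identity of global functions, to which
  the product rule applies. The functions \<open>Y i\<close> are the cut off coordinates; they do not depend on \<open>f\<close>.
\<close>

lemma tangent_in_chart:
  assumes Uc: "(U, c) \<in> M" and q: "q \<in> U"
  obtains Y where "\<And>v f. v \<in> T q \<Longrightarrow> f \<in> C \<Longrightarrow>
    v f = (\<Sum>i\<in>Basis. frechet_derivative (f \<circ> inv_into U c) (at (c q)) i * v (Y i))"
proof -
  define a where "a = c q"
  have inv_c: "inv_into U c (c r) = r" if "r \<in> U" for r
    using chart(4)[OF Uc] that by simp
  obtain R where R: "R > 0" "ball a R \<subseteq> c ` U"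
    using chart(2)[OF Uc] q by (auto simp: a_def open_contains_ball)
  obtain \<rho> :: "'e \<Rightarrow> real" where \<rho>: "smooth_on UNIV \<rho>"
    "\<And>x. dist a x \<le> R / 3 \<Longrightarrow> \<rho> x = 1" "\<And>x. R / 2 \<le> dist a x \<Longrightarrow> \<rho> x = 0"
    using smooth_bump[of "R / 3" "R / 2" a] R(1) by auto
  have \<rho>_out: "\<rho> x = 0" if "x \<notin> cball a (R / 2)" for x using \<rho>(3)[of x] that by auto
  have sub: "cball a (R / 2) \<subseteq> ball a R" using R(1) by auto
  have cut: "zero_extension U c (\<lambda>x. \<rho> x * g x) \<in> C" if "smooth_on (ball a R) g" for g
    using sub R(2)
    by (intro zero_extension_in_C[OF Uc smooth_on_cutoff[OF \<rho>(1) \<rho>_out closed_cball sub open_ball that]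
          compact_cball]) (auto simp: \<rho>_out)
  define P where "P = zero_extension U c (\<lambda>x. \<rho> x * 1)"
  define Y where "Y = (\<lambda>i. zero_extension U c (\<lambda>x. \<rho> x * ((x - a) \<bullet> i)))"
  have P: "P \<in> C" unfolding P_def by (rule cut[OF smooth_on_const])
  have Y: "Y i \<in> C" for i unfolding Y_def by (rule cut[OF smooth_on_inner_left[OF open_ball]])
  have Pq: "P q = 1" and Yq: "Y i q = 0" for i
    using q \<rho>(2)[of a] R(1) by (auto simp: P_def Y_def zero_extension_def a_def)
  have "v f = (\<Sum>i\<in>Basis. frechet_derivative (f \<circ> inv_into U c) (at (c q)) i * v (Y i))"
    if v: "v \<in> T q" and f: "f \<in> C" for v f
  proof -
    obtain g where g: "\<And>i. smooth_on (ball a R) (g i)"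
      "\<And>i. g i a = frechet_derivative (f \<circ> inv_into U c) (at a) i"
      "\<And>x. x \<in> ball a R \<Longrightarrow> (f \<circ> inv_into U c) x
        = (f \<circ> inv_into U c) a + (\<Sum>i\<in>Basis. g i x * ((x - a) \<bullet> i))"
      using hadamard[OF smooth_on_subset[OF smooth_in_chart[OF f Uc] R(2)] R(1)] by blast
    define G where "G = (\<lambda>i. zero_extension U c (\<lambda>x. \<rho> x * g i x))"
    have G: "G i \<in> C" for i unfolding G_def by (rule cut[OF g(1)])
    have Gq: "G i q = frechet_derivative (f \<circ> inv_into U c) (at (c q)) i" for i
      using q \<rho>(2)[of a] R(1) g(2) by (auto simp: G_def zero_extension_def a_def)
    define f0 where "f0 = f - (\<lambda>r. f q)"
    have f0: "f0 \<in> C" unfolding f0_def by (intro C_closed f)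
    have eq: "P * (P * f0) = (\<Sum>i\<in>Basis. G i * Y i)"
    proof
      fix r
      have "P r * (P r * (f r - f q)) = (\<Sum>i\<in>Basis. G i r * Y i r)"
      proof (cases "r \<in> U \<and> c r \<in> ball a R")
        case True
        then have "f r - f q = (\<Sum>i\<in>Basis. g i (c r) * ((c r - a) \<bullet> i))"
          using g(3)[of "c r"] inv_c[of r] inv_c[OF q] by (simp add: a_def)
        then show ?thesis
          using True by (simp add: P_def G_def Y_def zero_extension_def sum_distrib_left mult_ac)
      next
        case False
        then show ?thesis
          using \<rho>(3)[of "c r"] R(1) by (auto simp: P_def G_def Y_def zero_extension_def)
      qed
      then show "(P * (P * f0)) r = (\<Sum>i\<in>Basis. G i * Y i) r"
        by (simp add: f0_def sum_fun_apply)
    qed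
    have "v (P * (P * f0)) = v f"
      using tangent_rules(2)[OF v P C_mult[OF P f0]] tangent_rules(2)[OF v P f0] tangent_diff[OF v f C_const]
        tangent_const[OF v]
      by (simp add: Pq f0_def)
    moreover have "v (\<Sum>i\<in>Basis. G i * Y i) = (\<Sum>i\<in>Basis. G i q * v (Y i))"
      by (simp add: tangent_sum[OF v] C_mult G Y tangent_rules(2)[OF v G Y] Yq)
    ultimately show ?thesis unfolding eq by (simp add: Gq)
  qed
  then show ?thesis by (rule that)
qed

text \<open>
  The fields \<open>E i\<close> are the coordinate fields of a chart at \<open>p\<close> and the functions \<open>y i\<close> its coordinates, both
  multiplied by bump functions. The bump function for the \<open>y i\<close> is 1 on a neighbourhood of the support of the
  one for the \<open>E i\<close>, so that the \<open>y i\<close> have the derivatives of true coordinates wherever \<open>B\<close> is not 0.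
  The identity therefore holds at every point \<open>q\<close> of the manifold, which allows it to be read as an identity
  of vector fields.
\<close>

lemma cutoff_frame:
  obtains B y E where "B \<in> C" "B p = 1" "\<And>i. y i \<in> C" "\<And>i. E i \<in> \<Gamma>"
    "\<And>q v. v \<in> T q \<Longrightarrow> B q *\<^sub>R v = (\<Sum>i\<in>(Basis :: 'e set). v (y i) *\<^sub>R E i q)"
proof -
  obtain U c where Uc: "(U, c) \<in> M" and p: "p \<in> U" by (rule chart_at)
  define a where "a = c p"
  have inv_c: "inv_into U c (c r) = r" if "r \<in> U" for r
    using chart(4)[OF Uc] that by simp
  obtain R where R: "R > 0" "ball a R \<subseteq> c ` U"
    using chart(2)[OF Uc] p by (auto simp: a_def open_contains_ball)
  \<comment> \<open>The support of \<open>b\<close> has radius \<open>R / 4\<close>, and \<open>b'\<close> is 1 up to radius \<open>R / 3\<close>.\<close>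
  obtain b :: "'e \<Rightarrow> real" where b: "smooth_on UNIV b"
    "\<And>x. dist a x \<le> R / 5 \<Longrightarrow> b x = 1" "\<And>x. R / 4 \<le> dist a x \<Longrightarrow> b x = 0"
    using smooth_bump[of "R / 5" "R / 4" a] R(1) by auto
  obtain b' :: "'e \<Rightarrow> real" where b': "smooth_on UNIV b'"
    "\<And>x. dist a x \<le> R / 3 \<Longrightarrow> b' x = 1" "\<And>x. R / 2 \<le> dist a x \<Longrightarrow> b' x = 0"
    using smooth_bump[of "R / 3" "R / 2" a] R(1) by auto
  have b_out: "b x = 0" if "x \<notin> cball a (R / 4)" for x using b(3)[of x] that by auto
  have b'_out: "b' x = 0" if "x \<notin> cball a (R / 2)" for x using b'(3)[of x] that by auto
  have sub: "cball a (R / 4) \<subseteq> c ` U" "cball a (R / 2) \<subseteq> c ` U"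
  proof -
    have "cball a (R / 4) \<subseteq> ball a R" "cball a (R / 2) \<subseteq> ball a R" using R(1) by auto
    then show "cball a (R / 4) \<subseteq> c ` U" "cball a (R / 2) \<subseteq> c ` U" using R(2) by blast+
  qed
  define B where "B = zero_extension U c b"
  define y where "y = (\<lambda>i. zero_extension U c (\<lambda>x. b' x * ((x - 0) \<bullet> i)))"
  define d where "d = (\<lambda>(f :: 'a \<Rightarrow> real) q i. frechet_derivative (f \<circ> inv_into U c) (at (c q)) i)"
  define E where "E = (\<lambda>i q f. if q \<in> U \<and> f \<in> C then b (c q) * d f q i else 0)"
  have B: "B \<in> C"
    unfolding B_def by (rule zero_extension_in_C[OF Uc b(1) compact_cball sub(1) b_out])
  have y: "y i \<in> C" for i
    unfolding y_def
    by (rule zero_extension_in_C[OF Uc smooth_on_cutoff[OF b'(1) b'_out closed_cball sub(2) chart(2)[OF Uc]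
            smooth_on_inner_left[OF chart(2)[OF Uc]]] compact_cball sub(2)])
      (auto simp: b'_out)
  have diff: "((f \<circ> inv_into U c) has_derivative d f q) (at (c q))" if "q \<in> U" "f \<in> C" for q f
    using smooth_on_differentiable[OF smooth_in_chart[OF that(2) Uc], of "c q"] that(1)
    by (simp add: d_def frechet_derivative_works[symmetric])
  have d_eqI: "d f q = D" if "((f \<circ> inv_into U c) has_derivative D) (at (c q))" for f q D
    using frechet_derivative_at[OF that] by (simp add: d_def)
  have E: "E i \<in> \<Gamma>" for i
    unfolding vector_fields_def
  proof (intro CollectI conjI allI ballI)
    fix q
    have add: "d (f + g) q = (\<lambda>i. d f q i + d g q i)" if "q \<in> U" "f \<in> C" "g \<in> C" for f g
      using has_derivative_add[OF diff[OF that(1,2)] diff[OF that(1,3)]]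
      by (intro d_eqI) (simp add: o_def)
    have mult: "d (f * g) q = (\<lambda>i. f q * d g q i + d f q i * g q)" if "q \<in> U" "f \<in> C" "g \<in> C" for f g
      using has_derivative_mult[OF diff[OF that(1,2)] diff[OF that(1,3)]]
      by (intro d_eqI) (simp add: o_def inv_c[OF that(1)])
    have scale: "d (k *\<^sub>R f) q = (\<lambda>i. k * d f q i)" if "q \<in> U" "f \<in> C" for f k
      using has_derivative_mult_right[OF diff[OF that], of k]
      by (intro d_eqI) (simp add: o_def)
    show "E i q \<in> T q"
      by (auto simp: tangent_space_def E_def add mult scale C_closed algebra_simps)
  next
    fix f assume f: "f \<in> C"
    have "E i \<rhd> f = zero_extension U c (\<lambda>x. b x * frechet_derivative (f \<circ> inv_into U c) (at x) i)"
      using f by (auto simp: directional_def E_def zero_extension_def d_def fun_eq_iff)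
    also have "\<dots> \<in> C"
      by (rule zero_extension_in_C[OF Uc smooth_on_cutoff[OF b(1) b_out closed_cball sub(1) chart(2)[OF Uc]
            smooth_on_derivative[OF smooth_in_chart[OF f Uc]]] compact_cball sub(1)])
        (auto simp: b_out)
    finally show "E i \<rhd> f \<in> C" .
  qed
  have "B q *\<^sub>R v = (\<Sum>i\<in>(Basis :: 'e set). v (y i) *\<^sub>R E i q)" if v: "v \<in> T q" for q v
  proof
    fix f
    have "B q * v f = (\<Sum>i\<in>Basis. v (y i) * E i q f)"
    proof (cases "f \<in> C \<and> q \<in> U \<and> b (c q) \<noteq> 0")
      case False
      then show ?thesis
        using tangent_rules(4)[OF v] by (auto simp: B_def zero_extension_def E_def intro!: sum.neutral)
    next
      case True
      then have f: "f \<in> C" and q: "q \<in> U" and "dist a (c q) < R / 4"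
        using b(3)[of "c q"] by force+
      then have near: "c q \<in> ball a (R / 3)" using R(1) by simp
      obtain Y where Y: "\<And>v f. v \<in> T q \<Longrightarrow> f \<in> C \<Longrightarrow> v f = (\<Sum>i\<in>Basis. d f q i * v (Y i))"
        using tangent_in_chart[OF Uc q] unfolding d_def by blast
      have "d (y j) q i = i \<bullet> j" for i j
      proof -
        have "((\<lambda>x. (x - 0) \<bullet> j) has_derivative (\<lambda>i. i \<bullet> j)) (at (c q))"
          by (auto intro!: derivative_eq_intros)
        then have "((y j \<circ> inv_into U c) has_derivative (\<lambda>i. i \<bullet> j)) (at (c q))"
        proof (rule has_derivative_transform_within_open[OF _ open_ball near])
          fix x assume x: "x \<in> ball a (R / 3)"
          then have "x \<in> ball a R" using R(1) by simp
          then obtain r where "r \<in> U" "x = c r" using R(2) by blast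
          then show "(x - 0) \<bullet> j = (y j \<circ> inv_into U c) x"
            using x b'(2)[of x] by (simp add: y_def zero_extension_def inv_c)
        qed
        then show ?thesis by (simp add: d_eqI)
      qed
      then have "v (y j) = v (Y j)" if "j \<in> Basis" for j
        using Y[OF v y, of j] that by (simp add: inner_Basis if_distrib[of "\<lambda>x. x * _"] sum.delta cong: if_cong)
      then have "v f = (\<Sum>i\<in>Basis. d f q i * v (y i))"
        using Y[OF v f] by simp
      then show ?thesis
        using f q by (simp add: B_def zero_extension_def E_def sum_distrib_left mult_ac)
    qed
    then show "(B q *\<^sub>R v) f = (\<Sum>i\<in>(Basis :: 'e set). v (y i) *\<^sub>R E i q) f"
      by (simp add: sum_fun_apply)
  qed
  moreover have "B p = 1" using p R(1) b(2)[of a] by (simp add: B_def zero_extension_def a_def)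
  ultimately show ?thesis using that B y E by blast
qed

lemma extend_tangent:
  assumes "v \<in> T p" obtains Z where "Z \<in> \<Gamma>" "Z p = v"
proof -
  obtain B y E where "B p = 1" and E: "\<And>i. E i \<in> \<Gamma>"
    and eq: "\<And>q v. v \<in> T q \<Longrightarrow> B q *\<^sub>R v = (\<Sum>i\<in>(Basis :: 'e set). v (y i) *\<^sub>R E i q)"
    by (rule cutoff_frame[of p]) (rule that)
  define Z where "Z = (\<Sum>i\<in>(Basis :: 'e set). v (y i) *\<^sub>R E i)"
  have "Z p = v" using eq[OF assms] \<open>B p = 1\<close> by (simp add: Z_def sum_fun_apply)
  moreover have "Z \<in> \<Gamma>" unfolding Z_def by (intro vf_closed E)
  ultimately show ?thesis using that by blast
qed

definition C_linear :: "('a vfield \<Rightarrow> 'a vfield) \<Rightarrow> bool" where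
  "C_linear F \<longleftrightarrow> (\<forall>Z\<in>\<Gamma>. F Z \<in> \<Gamma>) \<and> (\<forall>Y\<in>\<Gamma>. \<forall>Z\<in>\<Gamma>. F (Y + Z) = F Y + F Z) \<and>
    (\<forall>f\<in>C. \<forall>Z\<in>\<Gamma>. F (f \<odot> Z) = f \<odot> F Z)"

lemma C_linear_sum:
  assumes "C_linear F" "\<And>i. i \<in> I \<Longrightarrow> Z i \<in> \<Gamma>"
  shows "F (\<Sum>i\<in>I. Z i) = (\<Sum>i\<in>I. F (Z i))"
proof -
  have F0: "F 0 = 0"
  proof -
    have "F (0 + 0) = F 0 + F 0" using assms(1) vf_closed(1) unfolding C_linear_def by blast
    then show ?thesis by simp
  qed
  show ?thesis
    using assms(2)
  proof (induction I rule: infinite_finite_induct)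
    case (insert i I)
    then have "F (Z i + (\<Sum>i\<in>I. Z i)) = F (Z i) + F (\<Sum>i\<in>I. Z i)"
      using assms(1) vf_closed(6)[of I Z] by (auto simp: C_linear_def)
    then show ?case using insert by (simp only: sum.insert insert_iff simp_thms)
  qed (simp_all add: F0)
qed

text \<open>
  The frame writes \<open>B \<odot> Z\<close> as a combination of the \<open>E i\<close> with coefficients \<open>Z(y i)\<close>, which vanish at \<open>p\<close>.
\<close>

lemma C_linear_pointwise:
  assumes F: "C_linear F" and Z: "Z \<in> \<Gamma>" "Z p = 0"
  shows "F Z p = 0"
proof -
  obtain B y E where B: "B \<in> C" "B p = 1" and y: "\<And>i. y i \<in> C" and E: "\<And>i. E i \<in> \<Gamma>"
    and eq: "\<And>q v. v \<in> T q \<Longrightarrow> B q *\<^sub>R v = (\<Sum>i\<in>(Basis :: 'e set). v (y i) *\<^sub>R E i q)"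
    by (rule cutoff_frame[of p]) (rule that)
  have "B \<odot> Z = (\<Sum>i\<in>(Basis :: 'e set). (Z \<rhd> y i) \<odot> E i)"
    by (rule ext) (simp add: fscale_def eq[OF vf_at[OF Z(1)]] sum_fun_apply directional_apply)
  then have "F (B \<odot> Z) = (\<Sum>i\<in>(Basis :: 'e set). F ((Z \<rhd> y i) \<odot> E i))"
    by (simp add: C_linear_sum[OF F] fscale_in_vf vf_C Z y E)
  then have "B \<odot> F Z = (\<Sum>i\<in>(Basis :: 'e set). (Z \<rhd> y i) \<odot> F (E i))"
    using F B Z y E vf_C by (simp add: C_linear_def)
  then have "(B \<odot> F Z) p = (\<Sum>i\<in>(Basis :: 'e set). (Z \<rhd> y i) \<odot> F (E i)) p" by simp
  then show ?thesis
    using B(2) Z(2) by (simp add: fscale_def sum_fun_apply directional_apply)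
qed

section \<open>Traces of tensors\<close>

lemma value_at_eq:
  assumes F: "C_linear F" and Z: "Z \<in> \<Gamma>"
  shows "value_at M F p (Z p) = F Z p"
proof -
  define W where "W = (SOME W. W \<in> \<Gamma> \<and> W p = Z p)"
  have W: "W \<in> \<Gamma>" "W p = Z p"
    using someI[of "\<lambda>W. W \<in> \<Gamma> \<and> W p = Z p" Z] Z by (simp_all add: W_def)
  have ZW: "Z - W \<in> \<Gamma>" "(Z - W) p = 0"
    using Z W by (auto intro: vf_closed)
  have "F ((Z - W) + W) = F (Z - W) + F W"
    using F ZW(1) W(1) unfolding C_linear_def by blast
  then have "F Z p = F (Z - W) p + F W p"
    by (metis diff_add_cancel plus_fun_apply)
  also have "F (Z - W) p = 0" by (rule C_linear_pointwise[OF F ZW])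
  finally have "F Z p = F W p" by simp
  then show ?thesis by (simp add: value_at_def W_def)
qed

lemma value_at_linear:
  assumes F: "C_linear F" and v: "v \<in> T p"
  shows "value_at M F p v \<in> T p"
    and "w \<in> T p \<Longrightarrow> value_at M F p (v + w) = value_at M F p v + value_at M F p w"
    and "value_at M F p (k *\<^sub>R v) = k *\<^sub>R value_at M F p v"
proof -
  obtain Z where Z: "Z \<in> \<Gamma>" "Z p = v" using extend_tangent[OF v] .
  have FZ: "F Z \<in> \<Gamma>" using F Z(1) by (auto simp: C_linear_def)
  show "value_at M F p v \<in> T p"
    using value_at_eq[OF F Z(1), of p] vf_at[OF FZ] Z(2) by simp
  show "value_at M F p (v + w) = value_at M F p v + value_at M F p w" if w: "w \<in> T p"
  proof -
    obtain W where W: "W \<in> \<Gamma>" "W p = w" using extend_tangent[OF w] .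
    have "F (Z + W) = F Z + F W" using F Z(1) W(1) unfolding C_linear_def by blast
    then show ?thesis
      using value_at_eq[OF F Z(1), of p] value_at_eq[OF F W(1), of p]
        value_at_eq[OF F vf_closed(2)[OF Z(1) W(1)], of p] Z(2) W(2) by simp
  qed
  have "F ((\<lambda>q. k) \<odot> Z) = (\<lambda>q. k) \<odot> F Z" using F Z(1) C_const unfolding C_linear_def by blast
  then show "value_at M F p (k *\<^sub>R v) = k *\<^sub>R value_at M F p v"
    using value_at_eq[OF F Z(1), of p] value_at_eq[OF F fscale_in_vf[OF C_const Z(1)], of p k] Z(2)
    by (simp add: fscale_def)
qed

definition basis_at :: "'a \<Rightarrow> 'a tangent set" where
  "basis_at p = (SOME B. independent B \<and> span B = T p)"

text \<open>
  The subspace \<open>T p\<close> has a basis, so the choice in \<open>trace_field\<close> succeeds.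
\<close>

lemma basis_at: "independent (basis_at p)" "span (basis_at p) = T p"
proof -
  obtain B where "B \<subseteq> T p" "independent B" "T p \<subseteq> span B"
    using maximal_independent_subset[of "T p"] by blast
  then have "independent B \<and> span B = T p"
    using span_minimal[of B "T p"] subspace_T[of p] by (simp add: subset_antisym)
  then have "independent (basis_at p) \<and> span (basis_at p) = T p"
    unfolding basis_at_def by (rule someI)
  then show "independent (basis_at p)" "span (basis_at p) = T p" by auto
qed

lemma basis_at_in_T: "b \<in> basis_at p \<Longrightarrow> b \<in> T p"
  using span_base[of b "basis_at p"] basis_at(2) by simp

lemma trace_field_eq:
  "trace_field M F p = (\<Sum>b\<in>basis_at p. representation (basis_at p) (value_at M F p b) b)"
  by (simp add: trace_field_def basis_at_def Let_def)

lemma representation_T: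
  "v \<in> T p \<Longrightarrow> w \<in> T p \<Longrightarrow>
     representation (basis_at p) (v + w) b = representation (basis_at p) v b + representation (basis_at p) w b"
  "v \<in> T p \<Longrightarrow> representation (basis_at p) (k *\<^sub>R v) b = k * representation (basis_at p) v b"
  using real_vector.representation_add[OF basis_at(1), of w p v]
    real_vector.representation_scale[OF basis_at(1), of v p k] basis_at(2)[of p]
  by auto

lemma trace_cong:
  assumes "\<And>Z. Z \<in> \<Gamma> \<Longrightarrow> F Z = G Z"
  shows "trace_field M F = trace_field M G"
proof
  fix p
  have "value_at M F p v = value_at M G p v" if v: "v \<in> T p" for v
  proof -
    obtain Z where "Z \<in> \<Gamma>" "Z p = v" using extend_tangent[OF v] .
    then have "(SOME Z. Z \<in> \<Gamma> \<and> Z p = v) \<in> \<Gamma>"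
      using someI[of "\<lambda>Z. Z \<in> \<Gamma> \<and> Z p = v" Z] by simp
    then show ?thesis by (simp add: value_at_def assms)
  qed
  then show "trace_field M F p = trace_field M G p"
    by (simp add: trace_field_eq basis_at_in_T cong: sum.cong)
qed

lemma trace_add:
  assumes "C_linear F" "C_linear G"
  shows "trace_field M (\<lambda>Z. F Z + G Z) = trace_field M F + trace_field M G"
proof
  fix p
  have "value_at M (\<lambda>Z. F Z + G Z) p v = value_at M F p v + value_at M G p v" for v
    by (simp add: value_at_def fun_eq_iff)
  then show "trace_field M (\<lambda>Z. F Z + G Z) p = (trace_field M F + trace_field M G) p"
    using assms
    by (simp add: trace_field_eq basis_at_in_T representation_T value_at_linear(1) sum.distrib
        cong: sum.cong)
qed

lemma trace_scaleR:
  assumes "C_linear F"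
  shows "trace_field M (\<lambda>Z. k *\<^sub>R F Z) = k *\<^sub>R trace_field M F"
proof
  fix p
  have "value_at M (\<lambda>Z. k *\<^sub>R F Z) p v = k *\<^sub>R value_at M F p v" for v
    by (simp add: value_at_def fun_eq_iff)
  then show "trace_field M (\<lambda>Z. k *\<^sub>R F Z) p = (k *\<^sub>R trace_field M F) p"
    using assms
    by (simp add: trace_field_eq basis_at_in_T representation_T value_at_linear(1) sum_distrib_left
        cong: sum.cong)
qed

lemma trace_diff:
  assumes F: "C_linear F" and G: "C_linear G"
  shows "trace_field M (\<lambda>Z. F Z - G Z) = trace_field M F - trace_field M G"
proof -
  have G': "C_linear (\<lambda>Z. (-1) *\<^sub>R G Z)"
    using G by (simp add: C_linear_def fscale_simps vf_closed(4))
  have "trace_field M (\<lambda>Z. F Z - G Z) = trace_field M (\<lambda>Z. F Z + (-1) *\<^sub>R G Z)"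
    by (rule trace_cong) simp
  also have "\<dots> = trace_field M F + trace_field M (\<lambda>Z. (-1) *\<^sub>R G Z)" by (rule trace_add[OF F G'])
  also have "\<dots> = trace_field M F - trace_field M G" unfolding trace_scaleR[OF G] by (simp add: fun_eq_iff)
  finally show ?thesis .
qed

text \<open>
  Both traces are \<open>\<Sum>\<^sub>b \<Sum>\<^sub>c G\<^sub>c\<^sub>b F\<^sub>b\<^sub>c\<close> in terms of matrix entries.
\<close>

lemma trace_commute:
  assumes F: "C_linear F" and G: "C_linear G"
  shows "trace_field M (\<lambda>Z. F (G Z)) = trace_field M (\<lambda>Z. G (F Z))"
proof
  fix p
  define B where "B = basis_at p"
  define r where "r = representation B"
  have expand: "trace_field M (\<lambda>Z. F (G Z)) p
      = (\<Sum>b\<in>B. \<Sum>c\<in>B. r (value_at M G p b) c * r (value_at M F p c) b)"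
    if F: "C_linear F" and G: "C_linear G" for F G
  proof (cases "finite B")
    case False
    \<comment> \<open>Sums over an infinite basis are 0 by convention.\<close>
    then show ?thesis by (simp add: trace_field_eq B_def)
  next
    case True
    have FG: "C_linear (\<lambda>Z. F (G Z))"
      using F G by (simp add: C_linear_def)
    have "r (value_at M (\<lambda>Z. F (G Z)) p b) b
        = (\<Sum>c\<in>B. r (value_at M G p b) c * r (value_at M F p c) b)" if b: "b \<in> B" for b
    proof -
      obtain Z where Z: "Z \<in> \<Gamma>" "Z p = b"
        using extend_tangent[of b p] basis_at_in_T b unfolding B_def by blast
      have Gb: "value_at M G p b \<in> T p"
        using b by (simp add: B_def basis_at_in_T value_at_linear(1)[OF G])
      have "value_at M (\<lambda>Z. F (G Z)) p b = value_at M F p (value_at M G p b)"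
        using value_at_eq[OF FG Z(1), of p] value_at_eq[OF F, of "G Z" p] value_at_eq[OF G Z(1), of p]
          G Z by (simp add: C_linear_def)
      also have "value_at M G p b = (\<Sum>c\<in>B. r (value_at M G p b) c *\<^sub>R c)"
        using real_vector.sum_representation_eq[OF basis_at(1), of "value_at M G p b" p B] Gb True basis_at(2)
        by (simp add: B_def r_def)
      finally have eq: "value_at M (\<lambda>Z. F (G Z)) p b
          = value_at M F p (\<Sum>c\<in>B. r (value_at M G p b) c *\<^sub>R c)" .
      have "S \<subseteq> B \<Longrightarrow> r (value_at M F p (\<Sum>c\<in>S. k c *\<^sub>R c)) b = (\<Sum>c\<in>S. k c * r (value_at M F p c) b)"
        if "finite S" for S k
        using that
      proof (induction S)
        case empty
        then show ?case
          using value_at_linear(3)[OF F T_closed(1), of p 0]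
          by (simp only: sum.empty r_def scaleR_zero_left real_vector.representation_zero)
      next
        case (insert c S)
        have c: "c \<in> T p" using insert.prems by (auto simp: B_def basis_at_in_T)
        have S: "(\<Sum>c\<in>S. k c *\<^sub>R c) \<in> T p"
          using insert.prems basis_at_in_T
          by (intro subspace_sum[OF subspace_T] T_closed) (auto simp: B_def)
        show ?case
          using insert value_at_linear(2)[OF F T_closed(3)[OF c] S, of "k c"] value_at_linear(3)[OF F c, of "k c"]
            representation_T(1)[OF T_closed(3)[OF value_at_linear(1)[OF F c]] value_at_linear(1)[OF F S], of "k c"]
            representation_T(2)[OF value_at_linear(1)[OF F c], of "k c"]
          by (simp only: sum.insert r_def B_def insert_subset simp_thms)
      qed
      from this[OF True order_refl] show ?thesis by (simp add: eq)
    qed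
    then show ?thesis by (simp add: trace_field_eq B_def r_def)
  qed
  show "trace_field M (\<lambda>Z. F (G Z)) p = trace_field M (\<lambda>Z. G (F Z)) p"
    unfolding expand[OF F G] expand[OF G F] by (subst sum.swap) (simp add: mult.commute)
qed

end

section \<open>Brackets, tensors and connections\<close>

text \<open>
  Functions form a ring pointwise, and the simplifier collects \<open>X + X\<close> to a product with a numeral. It is
  brought back to a scalar multiple.
\<close>

lemma numeral_times_field [simp]: "numeral k * (X :: 'a vfield) = numeral k *\<^sub>R X"
  by (simp add: fun_eq_iff)

context smooth_manifold
begin

declare C_const [simp] C_add [simp] C_mult [simp] C_scaleR [simp] C_0 [simp] C_1 [simp] C_uminus [simp] C_diff [simp]
declare vf_closed(1-5) [simp] fscale_in_vf [simp] bracket_in_vf [simp] vf_C [simp]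

lemma vf_eqI:
  assumes "X \<in> \<Gamma>" "Y \<in> \<Gamma>" "\<And>f. f \<in> C \<Longrightarrow> X \<rhd> f = Y \<rhd> f"
  shows "X = Y"
proof (intro ext)
  fix p f
  show "X p f = Y p f"
  proof (cases "f \<in> C")
    case True
    then show ?thesis using assms(3)[OF True] by (metis directional_apply)
  next
    case False
    then show ?thesis
      using tangent_rules(4)[OF vf_at[OF assms(1)]] tangent_rules(4)[OF vf_at[OF assms(2)]] by simp
  qed
qed

lemma bracket_directional: "lie_bracket X Y \<rhd> f = X \<rhd> Y \<rhd> f - Y \<rhd> X \<rhd> f"
  by (simp add: directional_def lie_bracket_def fun_eq_iff)

lemma directional_0 [simp]: "(0 :: 'a vfield) \<rhd> f = 0"
  by (simp add: directional_def fun_eq_iff)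

lemma directional_fun_0 [simp]: "X \<in> \<Gamma> \<Longrightarrow> X \<rhd> 0 = 0" "X \<in> \<Gamma> \<Longrightarrow> X \<rhd> 1 = 0"
  using directional_fun_rules(5)[of X 0 0 0] directional_fun_rules(5)[of X 0 0 1]
  by (simp_all add: zero_fun_def one_fun_def)

lemma directional_uminus:
  "(- X) \<rhd> f = - (X \<rhd> f)"
  by (simp add: directional_def fun_eq_iff)

lemma directional_fun_uminus:
  assumes "X \<in> \<Gamma>" "f \<in> C"
  shows "X \<rhd> (- f) = - (X \<rhd> f)"
  using directional_fun_rules(4)[OF assms assms(2), of "-1"] by simp

lemma bracket_linear:
  assumes "X \<in> \<Gamma>" "Y \<in> \<Gamma>"
  shows "Z \<in> \<Gamma> \<Longrightarrow> lie_bracket (X + Y) Z = lie_bracket X Z + lie_bracket Y Z"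
    and "Z \<in> \<Gamma> \<Longrightarrow> lie_bracket X (Y + Z) = lie_bracket X Y + lie_bracket X Z"
    and "f \<in> C \<Longrightarrow> lie_bracket (f \<odot> X) Y = f \<odot> lie_bracket X Y - (Y \<rhd> f) \<odot> X"
    and "f \<in> C \<Longrightarrow> lie_bracket X (f \<odot> Y) = f \<odot> lie_bracket X Y + (X \<rhd> f) \<odot> Y"
    and "lie_bracket (k *\<^sub>R X) Y = k *\<^sub>R lie_bracket X Y"
    and "lie_bracket X (k *\<^sub>R Y) = k *\<^sub>R lie_bracket X Y"
    and bracket_skew: "lie_bracket Y X = - lie_bracket X Y"
  by (rule vf_eqI; use assms in \<open>simp add: bracket_directional directional_rules directional_fun_rules
      directional_uminus algebra_simps\<close>)+

lemmas bracket_rules = bracket_linear(1-6)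

lemma bracket_minus:
  assumes "X \<in> \<Gamma>" "Y \<in> \<Gamma>"
  shows "lie_bracket (- X) Y = - lie_bracket X Y" "lie_bracket X (- Y) = - lie_bracket X Y"
    and "Z \<in> \<Gamma> \<Longrightarrow> lie_bracket (X - Y) Z = lie_bracket X Z - lie_bracket Y Z"
    and "Z \<in> \<Gamma> \<Longrightarrow> lie_bracket X (Y - Z) = lie_bracket X Y - lie_bracket X Z"
    and "lie_bracket 0 X = 0" "lie_bracket X 0 = 0"
  by (rule vf_eqI; use assms in \<open>simp add: bracket_directional directional_rules directional_fun_rules
      directional_uminus directional_fun_uminus algebra_simps\<close>)+

lemma bracket_self [simp]: "lie_bracket X X = 0"
  by (simp add: lie_bracket_def fun_eq_iff)

lemma jacobi:
  assumes "X \<in> \<Gamma>" "Y \<in> \<Gamma>" "Z \<in> \<Gamma>"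
  shows "lie_bracket X (lie_bracket Y Z) + lie_bracket Y (lie_bracket Z X)
    + lie_bracket Z (lie_bracket X Y) = 0"
  by (rule vf_eqI) (use assms in \<open>simp_all add: bracket_directional directional_rules directional_fun_rules
      algebra_simps\<close>)

lemma tensor_rules:
  assumes "tensor11 M \<phi>"
  shows "X \<in> \<Gamma> \<Longrightarrow> \<phi>\<langle>X\<rangle> \<in> \<Gamma>"
    and "X \<in> \<Gamma> \<Longrightarrow> Y \<in> \<Gamma> \<Longrightarrow> \<phi>\<langle>X + Y\<rangle> = \<phi>\<langle>X\<rangle> + \<phi>\<langle>Y\<rangle>"
    and "X \<in> \<Gamma> \<Longrightarrow> \<phi>\<langle>f \<odot> X\<rangle> = f \<odot> \<phi>\<langle>X\<rangle>"
    and "X \<in> \<Gamma> \<Longrightarrow> \<phi>\<langle>k *\<^sub>R X\<rangle> = k *\<^sub>R \<phi>\<langle>X\<rangle>"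
    and "X \<in> \<Gamma> \<Longrightarrow> \<phi>\<langle>- X\<rangle> = - \<phi>\<langle>X\<rangle>"
    and "X \<in> \<Gamma> \<Longrightarrow> Y \<in> \<Gamma> \<Longrightarrow> \<phi>\<langle>X - Y\<rangle> = \<phi>\<langle>X\<rangle> - \<phi>\<langle>Y\<rangle>"
    and "\<phi>\<langle>0\<rangle> = 0"
proof -
  have add: "\<phi> p (v + w) = \<phi> p v + \<phi> p w" if "v \<in> T p" "w \<in> T p" for p v w
    using assms that by (simp add: tensor11_def)
  have scale: "\<phi> p (k *\<^sub>R v) = k *\<^sub>R \<phi> p v" if "v \<in> T p" for p v k
    using assms that by (simp add: tensor11_def)
  show in_vf: "X \<in> \<Gamma> \<Longrightarrow> \<phi>\<langle>X\<rangle> \<in> \<Gamma>" for X using assms by (simp add: tensor11_def)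
  show add': "\<phi>\<langle>X + Y\<rangle> = \<phi>\<langle>X\<rangle> + \<phi>\<langle>Y\<rangle>" if "X \<in> \<Gamma>" "Y \<in> \<Gamma>" for X Y
    by (rule ext) (simp only: field_app_def plus_fun_apply add vf_at that)
  show "X \<in> \<Gamma> \<Longrightarrow> \<phi>\<langle>f \<odot> X\<rangle> = f \<odot> \<phi>\<langle>X\<rangle>"
    by (rule ext) (simp only: field_app_def fscale_def scale vf_at)
  show scale': "\<phi>\<langle>k *\<^sub>R X\<rangle> = k *\<^sub>R \<phi>\<langle>X\<rangle>" if "X \<in> \<Gamma>" for k X
    by (rule ext) (simp only: field_app_def scaleR_fun_apply scale vf_at that)
  show minus: "\<phi>\<langle>- X\<rangle> = - \<phi>\<langle>X\<rangle>" if "X \<in> \<Gamma>" for X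
    using scale'[OF that, of "-1"] by simp
  show "\<phi>\<langle>X - Y\<rangle> = \<phi>\<langle>X\<rangle> - \<phi>\<langle>Y\<rangle>" if "X \<in> \<Gamma>" "Y \<in> \<Gamma>"
    using add'[of X "- Y"] minus[of Y] that by simp
  show "\<phi>\<langle>0\<rangle> = 0" using scale'[of 0 0] by simp
qed

lemma form_rules:
  assumes "one_form M \<eta>"
  shows "X \<in> \<Gamma> \<Longrightarrow> \<eta>\<langle>X\<rangle> \<in> C"
    and "X \<in> \<Gamma> \<Longrightarrow> Y \<in> \<Gamma> \<Longrightarrow> \<eta>\<langle>X + Y\<rangle> = \<eta>\<langle>X\<rangle> + \<eta>\<langle>Y\<rangle>"
    and "X \<in> \<Gamma> \<Longrightarrow> \<eta>\<langle>f \<odot> X\<rangle> = f * \<eta>\<langle>X\<rangle>"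
    and "X \<in> \<Gamma> \<Longrightarrow> \<eta>\<langle>k *\<^sub>R X\<rangle> = k *\<^sub>R \<eta>\<langle>X\<rangle>"
    and "X \<in> \<Gamma> \<Longrightarrow> \<eta>\<langle>- X\<rangle> = - \<eta>\<langle>X\<rangle>"
    and "X \<in> \<Gamma> \<Longrightarrow> Y \<in> \<Gamma> \<Longrightarrow> \<eta>\<langle>X - Y\<rangle> = \<eta>\<langle>X\<rangle> - \<eta>\<langle>Y\<rangle>"
    and "\<eta>\<langle>0\<rangle> = 0"
proof -
  have add: "\<eta> p (v + w) = \<eta> p v + \<eta> p w" if "v \<in> T p" "w \<in> T p" for p v w
    using assms that by (simp add: one_form_def)
  have scale: "\<eta> p (k *\<^sub>R v) = k * \<eta> p v" if "v \<in> T p" for p v k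
    using assms that by (simp add: one_form_def)
  show "X \<in> \<Gamma> \<Longrightarrow> \<eta>\<langle>X\<rangle> \<in> C" for X using assms by (simp add: one_form_def)
  show add': "\<eta>\<langle>X + Y\<rangle> = \<eta>\<langle>X\<rangle> + \<eta>\<langle>Y\<rangle>" if "X \<in> \<Gamma>" "Y \<in> \<Gamma>" for X Y
    by (rule ext) (simp only: field_app_def plus_fun_apply add vf_at that)
  show "X \<in> \<Gamma> \<Longrightarrow> \<eta>\<langle>f \<odot> X\<rangle> = f * \<eta>\<langle>X\<rangle>"
    by (rule ext) (simp only: field_app_def fscale_def scale vf_at times_fun_apply)
  show scale': "\<eta>\<langle>k *\<^sub>R X\<rangle> = k *\<^sub>R \<eta>\<langle>X\<rangle>" if "X \<in> \<Gamma>" for k X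
    by (rule ext) (simp only: field_app_def scaleR_fun_apply scale vf_at that real_scaleR_def)
  show minus: "\<eta>\<langle>- X\<rangle> = - \<eta>\<langle>X\<rangle>" if "X \<in> \<Gamma>" for X
    using scale'[OF that, of "-1"] by simp
  show "\<eta>\<langle>X - Y\<rangle> = \<eta>\<langle>X\<rangle> - \<eta>\<langle>Y\<rangle>" if "X \<in> \<Gamma>" "Y \<in> \<Gamma>"
    using add'[of X "- Y"] minus[of Y] that by simp
  show "\<eta>\<langle>0\<rangle> = 0" using scale'[of 0 0] by simp
qed

end

locale connection = smooth_manifold M
  for M :: "('a::{t2_space,second_countable_topology}, 'e::euclidean_space) chart set" +
  fixes D :: "'a connection"
  assumes linear_connection: "linear_connection M D"
begin

lemma D_in [simp]: "X \<in> \<Gamma> \<Longrightarrow> Y \<in> \<Gamma> \<Longrightarrow> D X Y \<in> \<Gamma>"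
  using linear_connection by (auto simp: linear_connection_def)

lemma D_rules [simp]:
  assumes "X \<in> \<Gamma>" "Y \<in> \<Gamma>"
  shows "Z \<in> \<Gamma> \<Longrightarrow> D (X + Y) Z = D X Z + D Y Z" "Z \<in> \<Gamma> \<Longrightarrow> D X (Y + Z) = D X Y + D X Z"
    "f \<in> C \<Longrightarrow> D (f \<odot> X) Y = f \<odot> D X Y" "f \<in> C \<Longrightarrow> D X (f \<odot> Y) = (X \<rhd> f) \<odot> Y + f \<odot> D X Y"
  using linear_connection assms by (auto simp: linear_connection_def)

lemma D_scaleR [simp]:
  assumes "X \<in> \<Gamma>" "Y \<in> \<Gamma>"
  shows "D (k *\<^sub>R X) Y = k *\<^sub>R D X Y" "D X (k *\<^sub>R Y) = k *\<^sub>R D X Y"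
  using D_rules(3)[OF assms C_const[of k]] D_rules(4)[OF assms C_const[of k]]
    directional_fun_rules(5)[OF assms(1) C_0 C_0, of k]
  by (simp_all add: fscale_const fscale_simps)

lemma D_minus [simp]:
  assumes "X \<in> \<Gamma>" "Y \<in> \<Gamma>"
  shows "D (- X) Y = - D X Y" "D X (- Y) = - D X Y" "D 0 X = 0" "D X 0 = 0"
    "Z \<in> \<Gamma> \<Longrightarrow> D (X - Y) Z = D X Z - D Y Z" "Z \<in> \<Gamma> \<Longrightarrow> D X (Y - Z) = D X Y - D X Z"
proof -
  have m: "D (- X) Y = - D X Y" "D X (- Y) = - D X Y" if "X \<in> \<Gamma>" "Y \<in> \<Gamma>" for X Y
    using D_scaleR[OF that, of "-1"] by simp_all
  then show "D (- X) Y = - D X Y" "D X (- Y) = - D X Y" using assms by auto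
  show "D 0 X = 0" "D X 0 = 0"
    using D_scaleR[OF vf_closed(1) assms(1), of 0] D_scaleR[OF assms(1) vf_closed(1), of 0] by simp_all
  show "Z \<in> \<Gamma> \<Longrightarrow> D (X - Y) Z = D X Z - D Y Z" "Z \<in> \<Gamma> \<Longrightarrow> D X (Y - Z) = D X Y - D X Z"
    using D_rules(1)[of X "- Y" Z] D_rules(2)[of X Y "- Z"] m assms by simp_all
qed

lemma torsion_in [simp]: "X \<in> \<Gamma> \<Longrightarrow> Y \<in> \<Gamma> \<Longrightarrow> torsion D X Y \<in> \<Gamma>"
  by (simp add: torsion_def)

lemma torsion_skew: "X \<in> \<Gamma> \<Longrightarrow> Y \<in> \<Gamma> \<Longrightarrow> torsion D Y X = - torsion D X Y"
  by (simp add: torsion_def bracket_skew[of X Y] algebra_simps)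

lemma torsion_fscale: "X \<in> \<Gamma> \<Longrightarrow> Y \<in> \<Gamma> \<Longrightarrow> f \<in> C \<Longrightarrow> torsion D X (f \<odot> Y) = f \<odot> torsion D X Y"
  by (simp add: torsion_def bracket_rules fscale_simps algebra_simps)

lemma torsion_add: "X \<in> \<Gamma> \<Longrightarrow> Y \<in> \<Gamma> \<Longrightarrow> Z \<in> \<Gamma> \<Longrightarrow> torsion D X (Y + Z) = torsion D X Y + torsion D X Z"
  by (simp add: torsion_def bracket_rules algebra_simps)

lemma curvature_in [simp]: "X \<in> \<Gamma> \<Longrightarrow> Y \<in> \<Gamma> \<Longrightarrow> Z \<in> \<Gamma> \<Longrightarrow> curvature D X Y Z \<in> \<Gamma>"
  by (simp add: curvature_def)

lemma curvature_skew: "X \<in> \<Gamma> \<Longrightarrow> Y \<in> \<Gamma> \<Longrightarrow> Z \<in> \<Gamma> \<Longrightarrow> curvature D Y X Z = - curvature D X Y Z"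
  by (simp add: curvature_def bracket_skew[of X Y] algebra_simps)

lemma curvature_rules:
  assumes "X \<in> \<Gamma>" "Y \<in> \<Gamma>" "Z \<in> \<Gamma>"
  shows "W \<in> \<Gamma> \<Longrightarrow> curvature D (X - W) Y Z = curvature D X Y Z - curvature D W Y Z"
    and "f \<in> C \<Longrightarrow> curvature D (f \<odot> X) Y Z = f \<odot> curvature D X Y Z"
    and "curvature D (k *\<^sub>R X) Y Z = k *\<^sub>R curvature D X Y Z"
  by (use assms in \<open>simp add: curvature_def bracket_rules bracket_minus fscale_simps algebra_simps\<close>)+

lemma curvature_C_linear_left:
  assumes "X \<in> \<Gamma>" "Y \<in> \<Gamma>"
  shows "C_linear (\<lambda>Z. curvature D Z X Y)"
  unfolding C_linear_def
  by (safe; use assms in \<open>simp add: curvature_def bracket_rules fscale_simps algebra_simps\<close>)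

lemma curvature_C_linear_right:
  assumes "X \<in> \<Gamma>" "Y \<in> \<Gamma>"
  shows "C_linear (curvature D X Y)"
  unfolding C_linear_def
  by (safe; use assms in \<open>simp add: curvature_def bracket_directional fscale_simps algebra_simps\<close>)

end

section \<open>Normal structure tensors\<close>

locale reeb_manifold = smooth_manifold M
  for M :: "('a::{t2_space,second_countable_topology}, 'e::euclidean_space) chart set" +
  fixes \<eta> :: "'a oneform" and \<xi> :: "'a vfield"
  assumes form: "one_form M \<eta>" and reeb: "reeb_field M \<eta> \<xi>"
begin

lemmas eta_rules [simp] = form_rules[OF form]

lemma xi_in [simp]: "\<xi> \<in> \<Gamma>" and eta_xi [simp]: "\<eta>\<langle>\<xi>\<rangle> = 1"
  using reeb by (auto simp: reeb_field_def)

text \<open>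
  The coefficient \<open>2 d\<eta>(X, Y)\<close> that occurs in the normality conditions and in the torsion.
\<close>

definition \<tau> :: "'a vfield \<Rightarrow> 'a vfield \<Rightarrow> 'a \<Rightarrow> real" where
  "\<tau> X Y = 2 *\<^sub>R ext_d \<eta> X Y"

lemma tau_eq: "\<tau> X Y = X \<rhd> \<eta>\<langle>Y\<rangle> - Y \<rhd> \<eta>\<langle>X\<rangle> - \<eta>\<langle>lie_bracket X Y\<rangle>"
  by (simp add: \<tau>_def ext_d_def)

lemma eta_bracket: "\<eta>\<langle>lie_bracket X Y\<rangle> = X \<rhd> \<eta>\<langle>Y\<rangle> - Y \<rhd> \<eta>\<langle>X\<rangle> - \<tau> X Y"
  unfolding tau_eq by simp

lemma tau_in [simp]: "X \<in> \<Gamma> \<Longrightarrow> Y \<in> \<Gamma> \<Longrightarrow> \<tau> X Y \<in> C"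
  unfolding tau_eq by simp

lemma tau_skew: "X \<in> \<Gamma> \<Longrightarrow> Y \<in> \<Gamma> \<Longrightarrow> \<tau> Y X = - \<tau> X Y"
  unfolding tau_eq by (simp add: bracket_skew[of X Y])

lemma tau_fscale: "X \<in> \<Gamma> \<Longrightarrow> Y \<in> \<Gamma> \<Longrightarrow> f \<in> C \<Longrightarrow> \<tau> X (f \<odot> Y) = f * \<tau> X Y"
  unfolding tau_eq
  by (simp add: bracket_rules directional_rules directional_fun_rules algebra_simps)

lemma tau_add: "X \<in> \<Gamma> \<Longrightarrow> Y \<in> \<Gamma> \<Longrightarrow> Z \<in> \<Gamma> \<Longrightarrow> \<tau> X (Y + Z) = \<tau> X Y + \<tau> X Z"
  unfolding tau_eq
  by (simp add: bracket_rules directional_rules directional_fun_rules algebra_simps)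

lemma tau_xi: "X \<in> \<Gamma> \<Longrightarrow> \<tau> \<xi> X = 0" "X \<in> \<Gamma> \<Longrightarrow> \<tau> X \<xi> = 0"
proof -
  show 1: "X \<in> \<Gamma> \<Longrightarrow> \<tau> \<xi> X = 0" using reeb by (simp add: reeb_field_def \<tau>_def)
  then show "X \<in> \<Gamma> \<Longrightarrow> \<tau> X \<xi> = 0" using tau_skew[of \<xi> X] by simp
qed

lemma eta_xi_bracket: "X \<in> \<Gamma> \<Longrightarrow> \<eta>\<langle>lie_bracket \<xi> X\<rangle> = \<xi> \<rhd> \<eta>\<langle>X\<rangle>"
  by (subst eta_bracket) (simp only: tau_xi eta_xi directional_fun_0 diff_0_right)

text \<open>
  Separates the horizontal and the vertical part of an identity by applying \<open>\<eta>\<close>.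
\<close>

lemma horizontal_vertical_0:
  assumes "A \<in> \<Gamma>" "f \<in> C" "\<eta>\<langle>A\<rangle> = 0" "A + f \<odot> \<xi> = 0"
  shows "A = 0" and "f = 0"
proof -
  have "\<eta>\<langle>A + f \<odot> \<xi>\<rangle> = f" using assms(1-3) by simp
  then show "f = 0" using assms(4) by simp
  then show "A = 0" using assms(4) by (simp add: fscale_simps)
qed

end

text \<open>
  A tensor \<open>\<phi>\<close> whose square is \<open>\<epsilon>\<close> times the projection to \<open>ker \<eta>\<close>. The sign also enters the normality condition
  \<open>[\<phi>,\<phi>] = \<epsilon> 2d\<eta> \<otimes> \<xi>\<close>, so that \<open>\<epsilon> = 1\<close> covers \<open>\<phi>\<^sub>1\<close> and \<open>\<phi>\<^sub>2\<close>, and \<open>\<epsilon> = -1\<close> covers \<open>\<phi>\<^sub>3\<close>.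
\<close>

locale normal_tensor = reeb_manifold M \<eta> \<xi>
  for M :: "('a::{t2_space,second_countable_topology}, 'e::euclidean_space) chart set" and \<eta> \<xi> +
  fixes \<phi> :: "'a endofield" and \<epsilon> :: real
  assumes tensor: "tensor11 M \<phi>"
    and square: "X \<in> \<Gamma> \<Longrightarrow> \<phi>\<langle>\<phi>\<langle>X\<rangle>\<rangle> = \<epsilon> *\<^sub>R (X - \<eta>\<langle>X\<rangle> \<odot> \<xi>)"
    and sign: "\<epsilon> * \<epsilon> = 1"
    and normal: "X \<in> \<Gamma> \<Longrightarrow> Y \<in> \<Gamma> \<Longrightarrow> nijenhuis \<phi> X Y = (\<epsilon> *\<^sub>R \<tau> X Y) \<odot> \<xi>"
begin

lemmas app_rules [simp] = tensor_rules[OF tensor]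

lemma sign_nz: "\<epsilon> \<noteq> 0" using sign by auto

text \<open>
  From \<open>\<phi>\<^sup>2\<xi> = 0\<close> the formula for \<open>\<phi>\<^sup>2\<close> at \<open>\<phi>\<xi>\<close> gives \<open>\<phi>\<xi> = a\<xi>\<close> with a function \<open>a\<close>, and then \<open>a\<^sup>2\<xi> = \<phi>\<^sup>2\<xi> = 0\<close>.
\<close>

lemma app_xi [simp]: "\<phi>\<langle>\<xi>\<rangle> = 0"
proof -
  define a where "a = \<eta>\<langle>\<phi>\<langle>\<xi>\<rangle>\<rangle>"
  have sq0: "\<phi>\<langle>\<phi>\<langle>\<xi>\<rangle>\<rangle> = 0" by (simp add: square fscale_simps)
  then have "\<phi>\<langle>\<phi>\<langle>\<phi>\<langle>\<xi>\<rangle>\<rangle>\<rangle> = 0" by simp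
  then have eq: "\<phi>\<langle>\<xi>\<rangle> = a \<odot> \<xi>" using square[of "\<phi>\<langle>\<xi>\<rangle>"] sign_nz by (simp add: a_def)
  then have "\<phi>\<langle>\<phi>\<langle>\<xi>\<rangle>\<rangle> = (a * a) \<odot> \<xi>" using app_rules(3)[of \<xi> a] by (simp add: fscale_simps)
  then have "\<eta>\<langle>(a * a) \<odot> \<xi>\<rangle> = 0" using sq0 by simp
  then have "a * a = 0" by simp
  then have "a = 0" by (metis fun_eq_iff mult_eq_0_iff times_fun_apply zero_fun_apply)
  then show ?thesis using eq by (simp add: fscale_simps)
qed

lemma eta_app [simp]: assumes "X \<in> \<Gamma>" shows "\<eta>\<langle>\<phi>\<langle>X\<rangle>\<rangle> = 0"
proof -
  have "\<phi>\<langle>\<phi>\<langle>\<phi>\<langle>X\<rangle>\<rangle>\<rangle> = \<epsilon> *\<^sub>R \<phi>\<langle>X\<rangle>"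
    using assms by (subst square[of X]) (simp_all add: fscale_simps)
  moreover have "\<phi>\<langle>\<phi>\<langle>\<phi>\<langle>X\<rangle>\<rangle>\<rangle> = \<epsilon> *\<^sub>R (\<phi>\<langle>X\<rangle> - \<eta>\<langle>\<phi>\<langle>X\<rangle>\<rangle> \<odot> \<xi>)"
    using assms by (intro square) simp
  ultimately have "\<eta>\<langle>\<phi>\<langle>X\<rangle>\<rangle> \<odot> \<xi> = 0" using sign_nz by simp
  then have "\<eta>\<langle>\<eta>\<langle>\<phi>\<langle>X\<rangle>\<rangle> \<odot> \<xi>\<rangle> = 0" by (simp only: eta_rules)
  then show ?thesis by simp
qed

lemma square_horizontal: "X \<in> \<Gamma> \<Longrightarrow> \<eta>\<langle>X\<rangle> = 0 \<Longrightarrow> \<phi>\<langle>\<phi>\<langle>X\<rangle>\<rangle> = \<epsilon> *\<^sub>R X"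
  by (simp add: square fscale_simps)

lemma app_eq_0D: "X \<in> \<Gamma> \<Longrightarrow> \<eta>\<langle>X\<rangle> = 0 \<Longrightarrow> \<phi>\<langle>X\<rangle> = 0 \<Longrightarrow> X = 0"
  using square_horizontal[of X] sign_nz by simp

lemma decompose: "X \<in> \<Gamma> \<Longrightarrow> \<epsilon> *\<^sub>R \<phi>\<langle>\<phi>\<langle>X\<rangle>\<rangle> + \<eta>\<langle>X\<rangle> \<odot> \<xi> = X"
  by (simp add: square sign)

lemma app_inj:
  "X \<in> \<Gamma> \<Longrightarrow> Y \<in> \<Gamma> \<Longrightarrow> \<eta>\<langle>X\<rangle> = 0 \<Longrightarrow> \<eta>\<langle>Y\<rangle> = 0 \<Longrightarrow> \<phi>\<langle>X\<rangle> = \<phi>\<langle>Y\<rangle> \<Longrightarrow> X = Y"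
  using app_eq_0D[of "X - Y"] by simp

text \<open>
  Normality at \<open>(\<xi>, X)\<close> says that \<open>\<phi>\<close> annihilates \<open>(L\<^sub>\<xi>\<phi>)X\<close>, which is horizontal because \<open>d\<eta>(\<xi>, X) = 0\<close>.
\<close>

lemma bracket_xi_app:
  assumes X: "X \<in> \<Gamma>"
  shows "lie_bracket \<xi> \<phi>\<langle>X\<rangle> = \<phi>\<langle>lie_bracket \<xi> X\<rangle>"
proof -
  define A where "A = lie_bracket \<xi> \<phi>\<langle>X\<rangle> - \<phi>\<langle>lie_bracket \<xi> X\<rangle>"
  have "nijenhuis \<phi> \<xi> X = 0" using normal[OF xi_in X] tau_xi(1)[OF X] by (simp add: fscale_simps)
  then have "\<phi>\<langle>A\<rangle> = 0" using X by (simp add: A_def nijenhuis_def bracket_minus)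
  moreover have "A \<in> \<Gamma>" "\<eta>\<langle>A\<rangle> = 0" using X by (simp_all add: A_def eta_xi_bracket)
  ultimately have "A = 0" by (blast intro: app_eq_0D)
  then show ?thesis by (simp add: A_def)
qed

lemma h_op_0: "X \<in> \<Gamma> \<Longrightarrow> h_op \<xi> \<phi> X = 0"
  by (simp add: h_op_def lie_deriv_tensor_def bracket_xi_app)

text \<open>
  The \<open>\<xi>\<close>-component of the normality condition: of the four terms of \<open>[\<phi>,\<phi>]\<close> only \<open>[\<phi>X, \<phi>Y]\<close> is not in the
  image of \<open>\<phi>\<close>.
\<close>

lemma tau_app:
  assumes "X \<in> \<Gamma>" "Y \<in> \<Gamma>"
  shows "\<tau> \<phi>\<langle>X\<rangle> \<phi>\<langle>Y\<rangle> = - \<epsilon> *\<^sub>R \<tau> X Y"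
proof -
  have "\<eta>\<langle>nijenhuis \<phi> X Y\<rangle> = \<eta>\<langle>lie_bracket \<phi>\<langle>X\<rangle> \<phi>\<langle>Y\<rangle>\<rangle>"
    using assms by (simp add: nijenhuis_def)
  also have "\<dots> = - \<tau> \<phi>\<langle>X\<rangle> \<phi>\<langle>Y\<rangle>"
    using assms by (subst eta_bracket) simp
  also have "nijenhuis \<phi> X Y = (\<epsilon> *\<^sub>R \<tau> X Y) \<odot> \<xi>" by (rule normal[OF assms])
  also have "\<eta>\<langle>(\<epsilon> *\<^sub>R \<tau> X Y) \<odot> \<xi>\<rangle> = \<epsilon> *\<^sub>R \<tau> X Y" using assms by simp
  finally show ?thesis by (simp add: fun_eq_iff)
qed

end

section \<open>Pairs of anticommuting structures\<close>

text \<open>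
  Every argument needs one structure and a second one that anticommutes with it. The pairs \<open>(\<phi>\<^sub>1,\<phi>\<^sub>2)\<close>,
  \<open>(\<phi>\<^sub>2,\<phi>\<^sub>1)\<close> and \<open>(\<phi>\<^sub>3,\<phi>\<^sub>1)\<close> give the three cases of each assertion.
\<close>

locale anti_pair = normal_tensor M \<eta> \<xi> \<phi> \<epsilon> + psi: normal_tensor M \<eta> \<xi> \<psi> \<delta>
  for M :: "('a::{t2_space,second_countable_topology}, 'e::euclidean_space) chart set"
    and \<eta> \<xi> \<phi> \<epsilon> \<psi> \<delta> +
  assumes anticommute: "X \<in> \<Gamma> \<Longrightarrow> \<phi>\<langle>\<psi>\<langle>X\<rangle>\<rangle> = - \<psi>\<langle>\<phi>\<langle>X\<rangle>\<rangle>"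
begin

lemma commuting_horizontal_0:
  assumes X: "X \<in> \<Gamma>" and "\<eta>\<langle>X\<rangle> = 0" "\<phi>\<langle>\<psi>\<langle>X\<rangle>\<rangle> = \<psi>\<langle>\<phi>\<langle>X\<rangle>\<rangle>"
  shows "X = 0"
proof -
  have "2 *\<^sub>R \<psi>\<langle>\<phi>\<langle>X\<rangle>\<rangle> = 0"
    using assms(3) anticommute[OF X] by (metis scaleR_2 add.right_inverse)
  then have "\<phi>\<langle>X\<rangle> = 0" using X psi.app_eq_0D[of "\<phi>\<langle>X\<rangle>"] by simp
  then show ?thesis using assms(2) app_eq_0D[OF X] by simp
qed

text \<open>
  \<open>S(\<phi>X, \<psi>Y)\<close> is \<open>\<phi>\<psi>S(X, Y)\<close> or \<open>\<psi>\<phi>S(X, Y)\<close>, depending on the slot treated first.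
\<close>

lemma bilinear_0:
  assumes "\<And>X Y. X \<in> \<Gamma> \<Longrightarrow> Y \<in> \<Gamma> \<Longrightarrow> S X Y \<in> \<Gamma> \<and> \<eta>\<langle>S X Y\<rangle> = 0
      \<and> S \<phi>\<langle>X\<rangle> Y = \<phi>\<langle>S X Y\<rangle> \<and> S X \<phi>\<langle>Y\<rangle> = \<phi>\<langle>S X Y\<rangle>
      \<and> S \<psi>\<langle>X\<rangle> Y = \<psi>\<langle>S X Y\<rangle> \<and> S X \<psi>\<langle>Y\<rangle> = \<psi>\<langle>S X Y\<rangle>"
    and "X \<in> \<Gamma>" "Y \<in> \<Gamma>"
  shows "S X Y = 0"
proof (rule commuting_horizontal_0)
  have "S \<phi>\<langle>X\<rangle> \<psi>\<langle>Y\<rangle> = \<phi>\<langle>\<psi>\<langle>S X Y\<rangle>\<rangle>" "S \<phi>\<langle>X\<rangle> \<psi>\<langle>Y\<rangle> = \<psi>\<langle>\<phi>\<langle>S X Y\<rangle>\<rangle>"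
    using assms(1)[of X "\<psi>\<langle>Y\<rangle>"] assms(1)[of X Y] assms(1)[of "\<phi>\<langle>X\<rangle>" Y] assms(2,3) by simp_all
  then show "\<phi>\<langle>\<psi>\<langle>S X Y\<rangle>\<rangle> = \<psi>\<langle>\<phi>\<langle>S X Y\<rangle>\<rangle>" by simp
qed (use assms in auto)

end

section \<open>Connections that preserve the structure and their torsion\<close>

locale parallel_pair = anti_pair M \<eta> \<xi> \<phi> \<epsilon> \<psi> \<delta> + connection M D
  for M :: "('a::{t2_space,second_countable_topology}, 'e::euclidean_space) chart set"
    and \<eta> \<xi> \<phi> \<epsilon> \<psi> \<delta> D +
  assumes D_xi [simp]: "X \<in> \<Gamma> \<Longrightarrow> D X \<xi> = 0"
    and D_phi: "X \<in> \<Gamma> \<Longrightarrow> Y \<in> \<Gamma> \<Longrightarrow> D X \<phi>\<langle>Y\<rangle> = \<phi>\<langle>D X Y\<rangle>"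
    and D_psi: "X \<in> \<Gamma> \<Longrightarrow> Y \<in> \<Gamma> \<Longrightarrow> D X \<psi>\<langle>Y\<rangle> = \<psi>\<langle>D X Y\<rangle>"
begin

text \<open>
  \<open>\<eta> \<otimes> \<xi>\<close> is parallel because \<open>\<phi>\<^sup>2\<close> and the identity are, and \<open>\<xi>\<close> is parallel, so \<open>\<eta>\<close> is parallel.
\<close>

lemma eta_D:
  assumes "X \<in> \<Gamma>" "Y \<in> \<Gamma>"
  shows "\<eta>\<langle>D X Y\<rangle> = X \<rhd> \<eta>\<langle>Y\<rangle>"
proof -
  have "D X \<phi>\<langle>\<phi>\<langle>Y\<rangle>\<rangle> = \<phi>\<langle>\<phi>\<langle>D X Y\<rangle>\<rangle>" using assms by (simp only: D_phi app_rules)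
  then have "\<epsilon> *\<^sub>R ((X \<rhd> \<eta>\<langle>Y\<rangle>) \<odot> \<xi>) = \<epsilon> *\<^sub>R (\<eta>\<langle>D X Y\<rangle> \<odot> \<xi>)"
    using assms by (auto simp add: square fscale_simps algebra_simps)
  then have "\<eta>\<langle>(X \<rhd> \<eta>\<langle>Y\<rangle>) \<odot> \<xi>\<rangle> = \<eta>\<langle>\<eta>\<langle>D X Y\<rangle> \<odot> \<xi>\<rangle>" using sign_nz by simp
  then show ?thesis using assms by simp
qed

text \<open>
  The deviation of the torsion from the prescribed one. It is horizontal because \<open>\<eta>\<close> is parallel.
\<close>

definition horizontal_torsion :: "'a vfield \<Rightarrow> 'a vfield \<Rightarrow> 'a vfield" where
  "horizontal_torsion X Y = torsion D X Y - \<tau> X Y \<odot> \<xi>"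

lemma horizontal_torsion_in [simp]: "X \<in> \<Gamma> \<Longrightarrow> Y \<in> \<Gamma> \<Longrightarrow> horizontal_torsion X Y \<in> \<Gamma>"
  by (simp add: horizontal_torsion_def)

lemma eta_horizontal_torsion [simp]: "X \<in> \<Gamma> \<Longrightarrow> Y \<in> \<Gamma> \<Longrightarrow> \<eta>\<langle>horizontal_torsion X Y\<rangle> = 0"
  by (simp add: horizontal_torsion_def torsion_def eta_D tau_eq)

lemma horizontal_torsion_skew: "X \<in> \<Gamma> \<Longrightarrow> Y \<in> \<Gamma> \<Longrightarrow> horizontal_torsion Y X = - horizontal_torsion X Y"
  unfolding horizontal_torsion_def torsion_skew[of X Y] tau_skew[of X Y] by (simp add: fscale_simps)

lemma horizontal_torsion_fscale: "X \<in> \<Gamma> \<Longrightarrow> Y \<in> \<Gamma> \<Longrightarrow> f \<in> C \<Longrightarrow> horizontal_torsion X (f \<odot> Y) = f \<odot> horizontal_torsion X Y"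
  unfolding horizontal_torsion_def by (simp only: tau_fscale torsion_fscale fscale_simps)

lemma horizontal_torsion_add: "X \<in> \<Gamma> \<Longrightarrow> Y \<in> \<Gamma> \<Longrightarrow> Z \<in> \<Gamma> \<Longrightarrow> horizontal_torsion X (Y + Z) = horizontal_torsion X Y + horizontal_torsion X Z"
  unfolding horizontal_torsion_def by (simp only: tau_add torsion_add fscale_simps) simp


text \<open>
  For a connection that preserves \<open>\<phi>\<close>, the tensor \<open>[\<phi>,\<phi>]\<close> is the expression
  \<open>- \<phi>\<^sup>2T(X,Y) - T(\<phi>X,\<phi>Y) + \<phi>T(\<phi>X,Y) + \<phi>T(X,\<phi>Y)\<close>; the covariant derivatives cancel. The horizontal part
  of the normality condition is then an identity for the horizontal torsion.
\<close>

lemma horizontal_torsion_normal: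
  assumes "X \<in> \<Gamma>" "Y \<in> \<Gamma>"
  shows "\<epsilon> *\<^sub>R horizontal_torsion X Y + horizontal_torsion \<phi>\<langle>X\<rangle> \<phi>\<langle>Y\<rangle>
    = \<phi>\<langle>horizontal_torsion \<phi>\<langle>X\<rangle> Y + horizontal_torsion X \<phi>\<langle>Y\<rangle>\<rangle>"
proof -
  have br: "lie_bracket X Y = D X Y - D Y X - horizontal_torsion X Y - \<tau> X Y \<odot> \<xi>" for X Y
    by (simp add: horizontal_torsion_def torsion_def)
  have "nijenhuis \<phi> X Y = - (\<epsilon> *\<^sub>R horizontal_torsion X Y) - horizontal_torsion \<phi>\<langle>X\<rangle> \<phi>\<langle>Y\<rangle>
      + \<phi>\<langle>horizontal_torsion \<phi>\<langle>X\<rangle> Y\<rangle> + \<phi>\<langle>horizontal_torsion X \<phi>\<langle>Y\<rangle>\<rangle> - \<tau> \<phi>\<langle>X\<rangle> \<phi>\<langle>Y\<rangle> \<odot> \<xi>"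
    unfolding nijenhuis_def br using assms
    by (simp add: D_phi square_horizontal[of "horizontal_torsion X Y"] fscale_simps)
  moreover have "nijenhuis \<phi> X Y = - \<tau> \<phi>\<langle>X\<rangle> \<phi>\<langle>Y\<rangle> \<odot> \<xi>"
    unfolding normal[OF assms] tau_app[OF assms] by (simp add: fscale_simps)
  ultimately show ?thesis
    using assms by (simp add: fscale_simps algebra_simps)
qed


lemma horizontal_torsion_minus:
  assumes "X \<in> \<Gamma>" "Y \<in> \<Gamma>"
  shows "horizontal_torsion X (k *\<^sub>R Y) = k *\<^sub>R horizontal_torsion X Y" "horizontal_torsion X 0 = 0" "horizontal_torsion 0 X = 0"
    "horizontal_torsion (- X) Y = - horizontal_torsion X Y" "horizontal_torsion X (- Y) = - horizontal_torsion X Y"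
proof -
  have sc: "horizontal_torsion X (k *\<^sub>R Y) = k *\<^sub>R horizontal_torsion X Y" if "X \<in> \<Gamma>" "Y \<in> \<Gamma>" for X Y k
    using horizontal_torsion_fscale[OF that C_const[of k]] by (simp add: fscale_const)
  then show "horizontal_torsion X (k *\<^sub>R Y) = k *\<^sub>R horizontal_torsion X Y" using assms .
  show 0: "horizontal_torsion X 0 = 0" using sc[OF assms, of 0] by simp
  show "horizontal_torsion 0 X = 0" using horizontal_torsion_skew[OF assms(1) vf_closed(1)] 0 by simp
  have m: "horizontal_torsion X (- Y) = - horizontal_torsion X Y" if "X \<in> \<Gamma>" "Y \<in> \<Gamma>" for X Y
    using sc[OF that, of "-1"] by simp
  then show "horizontal_torsion X (- Y) = - horizontal_torsion X Y" using assms .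
  show "horizontal_torsion (- X) Y = - horizontal_torsion X Y"
    using m[OF assms(2,1)] horizontal_torsion_skew[of Y X] horizontal_torsion_skew[of Y "- X"] assms by simp
qed

text \<open>
  Let \<open>S\<close> be the horizontal torsion. The hypothesis, the torsion condition for \<open>\<phi>\<close>, gives
   \<open>S(\<phi>X, \<phi>Y) = S(X, \<phi>\<^sup>2Y) = \<epsilon>S(X, Y)\<close>, provided
  that \<open>S(X, \<xi>) = 0\<close>, and the preceding identity becomes \<open>2\<epsilon>S(X, Y) = 2\<phi>S(\<phi>X, Y)\<close>.
\<close>

lemma horizontal_torsion_commutes:
  assumes balanced: "\<And>X Y. X \<in> \<Gamma> \<Longrightarrow> Y \<in> \<Gamma> \<Longrightarrow> horizontal_torsion \<phi>\<langle>X\<rangle> Y = horizontal_torsion X \<phi>\<langle>Y\<rangle>"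
    and "X \<in> \<Gamma>" "Y \<in> \<Gamma>"
  shows "horizontal_torsion \<phi>\<langle>X\<rangle> Y = \<phi>\<langle>horizontal_torsion X Y\<rangle>"
proof -
  have xi: "horizontal_torsion \<xi> X = 0" if X: "X \<in> \<Gamma>" for X
  proof -
    have "horizontal_torsion \<xi> \<phi>\<langle>\<phi>\<langle>X\<rangle>\<rangle> = 0"
      using balanced[OF xi_in, of "\<phi>\<langle>X\<rangle>"] X horizontal_torsion_minus(3)[OF app_rules(1)[OF X] xi_in] by simp
    moreover have "horizontal_torsion \<xi> \<xi> = 0"
    proof -
      have "2 *\<^sub>R horizontal_torsion \<xi> \<xi> = 0"
        using horizontal_torsion_skew[OF xi_in xi_in] by (metis scaleR_2 add.right_inverse)
      then show ?thesis by simp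
    qed
    moreover have "horizontal_torsion \<xi> X = horizontal_torsion \<xi> (\<epsilon> *\<^sub>R \<phi>\<langle>\<phi>\<langle>X\<rangle>\<rangle> + \<eta>\<langle>X\<rangle> \<odot> \<xi>)"
      using X by (simp only: decompose)
    moreover have "\<dots> = \<epsilon> *\<^sub>R horizontal_torsion \<xi> \<phi>\<langle>\<phi>\<langle>X\<rangle>\<rangle> + \<eta>\<langle>X\<rangle> \<odot> horizontal_torsion \<xi> \<xi>"
      using X by (simp only: horizontal_torsion_add horizontal_torsion_minus horizontal_torsion_fscale xi_in app_rules vf_closed
          fscale_in_vf eta_rules)
    ultimately show ?thesis by (simp add: fscale_simps)
  qed
  have sq: "horizontal_torsion X \<phi>\<langle>\<phi>\<langle>Y\<rangle>\<rangle> = \<epsilon> *\<^sub>R horizontal_torsion X Y"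
  proof -
    have "horizontal_torsion X Y = horizontal_torsion X (\<epsilon> *\<^sub>R \<phi>\<langle>\<phi>\<langle>Y\<rangle>\<rangle> + \<eta>\<langle>Y\<rangle> \<odot> \<xi>)"
      using assms by (simp only: decompose)
    also have "\<dots> = \<epsilon> *\<^sub>R horizontal_torsion X \<phi>\<langle>\<phi>\<langle>Y\<rangle>\<rangle> + \<eta>\<langle>Y\<rangle> \<odot> horizontal_torsion X \<xi>"
      using assms by (simp only: horizontal_torsion_add horizontal_torsion_minus horizontal_torsion_fscale xi_in app_rules vf_closed
          fscale_in_vf eta_rules)
    finally have "horizontal_torsion X Y = \<epsilon> *\<^sub>R horizontal_torsion X \<phi>\<langle>\<phi>\<langle>Y\<rangle>\<rangle> + \<eta>\<langle>Y\<rangle> \<odot> horizontal_torsion X \<xi>" .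
    moreover have "horizontal_torsion X \<xi> = 0" using horizontal_torsion_skew[of \<xi> X] xi assms by simp
    ultimately have "\<epsilon> *\<^sub>R horizontal_torsion X Y = (\<epsilon> * \<epsilon>) *\<^sub>R horizontal_torsion X \<phi>\<langle>\<phi>\<langle>Y\<rangle>\<rangle>"
      by (simp only: fscale_simps add_0_right scaleR_scaleR)
    then show ?thesis by (simp only: sign scaleR_one)
  qed
  have "2 *\<^sub>R (\<epsilon> *\<^sub>R horizontal_torsion X Y) = 2 *\<^sub>R \<phi>\<langle>horizontal_torsion \<phi>\<langle>X\<rangle> Y\<rangle>"
    using horizontal_torsion_normal[OF assms(2,3)] balanced[of X "\<phi>\<langle>Y\<rangle>"] balanced[of X Y] sq assms(2,3)
    by simp
  then have "\<epsilon> *\<^sub>R horizontal_torsion X Y = \<phi>\<langle>horizontal_torsion \<phi>\<langle>X\<rangle> Y\<rangle>"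
    by (metis scaleR_cancel_left zero_neq_numeral)
  then have "\<phi>\<langle>\<epsilon> *\<^sub>R horizontal_torsion X Y\<rangle> = \<phi>\<langle>\<phi>\<langle>horizontal_torsion \<phi>\<langle>X\<rangle> Y\<rangle>\<rangle>" by simp
  then show ?thesis using assms(2,3) sign_nz by (simp add: square_horizontal)
qed

lemma swapped: "parallel_pair M \<eta> \<xi> \<psi> \<delta> \<phi> \<epsilon> D"
  by unfold_locales (simp_all add: anticommute D_phi D_psi)

text \<open>
  Once the horizontal torsion \<open>S\<close> is bilinear over \<open>\<phi>\<close>, the normality identity of \<open>\<psi>\<close> at \<open>(\<phi>X, Y)\<close> and at \<open>(X, \<phi>Y)\<close> gives
  \<open>A = \<psi>G\<close> and \<open>A = - \<psi>G\<close> with the same \<open>A\<close> and with \<open>G = S(\<psi>X, Y) - S(X, \<psi>Y)\<close>. So \<open>\<psi>\<close> satisfies the torsion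
  condition as well, and \<open>S\<close> is bilinear over both structures.
\<close>

lemma horizontal_torsion_0:
  assumes "\<And>X Y. X \<in> \<Gamma> \<Longrightarrow> Y \<in> \<Gamma> \<Longrightarrow> horizontal_torsion \<phi>\<langle>X\<rangle> Y = horizontal_torsion X \<phi>\<langle>Y\<rangle>"
    and "X \<in> \<Gamma>" "Y \<in> \<Gamma>"
  shows "horizontal_torsion X Y = 0"
proof (rule bilinear_0[OF _ assms(2,3)])
  interpret swap: parallel_pair M \<eta> \<xi> \<psi> \<delta> \<phi> \<epsilon> D by (rule swapped)
  have phi: "horizontal_torsion \<phi>\<langle>X\<rangle> Y = \<phi>\<langle>horizontal_torsion X Y\<rangle>" "horizontal_torsion X \<phi>\<langle>Y\<rangle> = \<phi>\<langle>horizontal_torsion X Y\<rangle>"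
    if "X \<in> \<Gamma>" "Y \<in> \<Gamma>" for X Y
    using horizontal_torsion_commutes[OF assms(1)] assms(1) that by simp_all
  have balanced: "horizontal_torsion \<psi>\<langle>X\<rangle> Y = horizontal_torsion X \<psi>\<langle>Y\<rangle>" if XY: "X \<in> \<Gamma>" "Y \<in> \<Gamma>" for X Y
  proof -
    have psi_phi: "\<psi>\<langle>\<phi>\<langle>Z\<rangle>\<rangle> = - \<phi>\<langle>\<psi>\<langle>Z\<rangle>\<rangle>" if "Z \<in> \<Gamma>" for Z using anticommute[OF that] by simp
    define A where "A = \<delta> *\<^sub>R horizontal_torsion X Y - horizontal_torsion \<psi>\<langle>X\<rangle> \<psi>\<langle>Y\<rangle>"
    define G where "G = horizontal_torsion \<psi>\<langle>X\<rangle> Y - horizontal_torsion X \<psi>\<langle>Y\<rangle>"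
    have A: "A \<in> \<Gamma>" "\<eta>\<langle>A\<rangle> = 0" and G: "G \<in> \<Gamma>" "\<eta>\<langle>G\<rangle> = 0"
      using XY by (simp_all add: A_def G_def)
    have "\<phi>\<langle>A\<rangle> = \<phi>\<langle>\<psi>\<langle>G\<rangle>\<rangle>"
      using swap.horizontal_torsion_normal[of "\<phi>\<langle>X\<rangle>" Y] XY
      by (simp add: A_def G_def phi psi_phi horizontal_torsion_minus)
    moreover have "\<phi>\<langle>A\<rangle> = \<phi>\<langle>- \<psi>\<langle>G\<rangle>\<rangle>"
      using swap.horizontal_torsion_normal[of X "\<phi>\<langle>Y\<rangle>"] XY
      by (simp add: A_def G_def phi psi_phi horizontal_torsion_minus)
    ultimately have "A = \<psi>\<langle>G\<rangle>" "A = - \<psi>\<langle>G\<rangle>"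
      using app_inj[OF A(1) _ A(2), of "\<psi>\<langle>G\<rangle>"] app_inj[OF A(1) _ A(2), of "- \<psi>\<langle>G\<rangle>"] G by simp_all
    then have "2 *\<^sub>R \<psi>\<langle>G\<rangle> = 0" by (metis scaleR_2 add.right_inverse)
    then have "G = 0" using psi.app_eq_0D[OF G] by simp
    then show ?thesis by (simp add: G_def)
  qed
  have psi: "horizontal_torsion \<psi>\<langle>X\<rangle> Y = \<psi>\<langle>horizontal_torsion X Y\<rangle>" if "X \<in> \<Gamma>" "Y \<in> \<Gamma>" for X Y
    using swap.horizontal_torsion_commutes[OF balanced that] .
  fix X Y assume XY: "X \<in> \<Gamma>" "Y \<in> \<Gamma>"
  then show "horizontal_torsion X Y \<in> \<Gamma> \<and> \<eta>\<langle>horizontal_torsion X Y\<rangle> = 0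
      \<and> horizontal_torsion \<phi>\<langle>X\<rangle> Y = \<phi>\<langle>horizontal_torsion X Y\<rangle> \<and> horizontal_torsion X \<phi>\<langle>Y\<rangle> = \<phi>\<langle>horizontal_torsion X Y\<rangle>
      \<and> horizontal_torsion \<psi>\<langle>X\<rangle> Y = \<psi>\<langle>horizontal_torsion X Y\<rangle> \<and> horizontal_torsion X \<psi>\<langle>Y\<rangle> = \<psi>\<langle>horizontal_torsion X Y\<rangle>"
    using phi[OF XY] psi[OF XY] balanced[OF XY] by simp
qed

end

section \<open>Curvature and Ricci tensor\<close>

locale canonical_pair = parallel_pair M \<eta> \<xi> \<phi> \<epsilon> \<psi> \<delta> D
  for M :: "('a::{t2_space,second_countable_topology}, 'e::euclidean_space) chart set"
    and \<eta> \<xi> \<phi> \<epsilon> \<psi> \<delta> D +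
  assumes torsion: "X \<in> \<Gamma> \<Longrightarrow> Y \<in> \<Gamma> \<Longrightarrow> torsion D X Y = \<tau> X Y \<odot> \<xi>"
begin

lemma D_commutator:
  "X \<in> \<Gamma> \<Longrightarrow> Y \<in> \<Gamma> \<Longrightarrow> D X Y = D Y X + lie_bracket X Y + \<tau> X Y \<odot> \<xi>"
  using torsion[of X Y] by (simp add: torsion_def algebra_simps)

lemma eta_curvature [simp]: "X \<in> \<Gamma> \<Longrightarrow> Y \<in> \<Gamma> \<Longrightarrow> Z \<in> \<Gamma> \<Longrightarrow> \<eta>\<langle>curvature D X Y Z\<rangle> = 0"
  by (simp add: curvature_def eta_D bracket_directional)

lemma curvature_phi:
  "X \<in> \<Gamma> \<Longrightarrow> Y \<in> \<Gamma> \<Longrightarrow> Z \<in> \<Gamma> \<Longrightarrow> curvature D X Y \<phi>\<langle>Z\<rangle> = \<phi>\<langle>curvature D X Y Z\<rangle>"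
  by (simp add: curvature_def D_phi)

lemma curvature_psi:
  "X \<in> \<Gamma> \<Longrightarrow> Y \<in> \<Gamma> \<Longrightarrow> Z \<in> \<Gamma> \<Longrightarrow> curvature D X Y \<psi>\<langle>Z\<rangle> = \<psi>\<langle>curvature D X Y Z\<rangle>"
  by (simp add: curvature_def D_psi)

text \<open>
  Besides the Jacobi identity, the torsion contributes a multiple of \<open>\<xi>\<close>. It vanishes because all
  curvature terms are horizontal.
\<close>

lemma bianchi:
  assumes "X \<in> \<Gamma>" "Y \<in> \<Gamma>" "Z \<in> \<Gamma>"
  shows "curvature D X Y Z + curvature D Y Z X + curvature D Z X Y = 0"
proof -
  have step: "D X (D Y Z) = D X (D Z Y) + D (lie_bracket Y Z) X + lie_bracket X (lie_bracket Y Z)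
      + (\<tau> X (lie_bracket Y Z) + X \<rhd> \<tau> Y Z) \<odot> \<xi>"
    if "X \<in> \<Gamma>" "Y \<in> \<Gamma>" "Z \<in> \<Gamma>" for X Y Z
    using that D_commutator[of X "lie_bracket Y Z"]
    by (subst D_commutator[of Y Z]) (simp_all add: fscale_simps)
  define g where "g = \<tau> X (lie_bracket Y Z) + X \<rhd> \<tau> Y Z + (\<tau> Y (lie_bracket Z X) + Y \<rhd> \<tau> Z X)
      + (\<tau> Z (lie_bracket X Y) + Z \<rhd> \<tau> X Y)"
  have g: "g \<in> C" unfolding g_def using assms by simp
  have "curvature D X Y Z + curvature D Y Z X + curvature D Z X Y
      = (lie_bracket X (lie_bracket Y Z) + lie_bracket Y (lie_bracket Z X) + lie_bracket Z (lie_bracket X Y))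
        + g \<odot> \<xi>"
    using step[OF assms] step[OF assms(2,3,1)] step[OF assms(3,1,2)]
    by (simp add: curvature_def g_def fscale_simps)
  then have eq: "curvature D X Y Z + curvature D Y Z X + curvature D Z X Y + (- g) \<odot> \<xi> = 0"
    by (simp add: jacobi[OF assms] fscale_simps)
  show ?thesis
    by (rule horizontal_vertical_0(1)[OF _ _ _ eq]) (use assms g in simp_all)
qed

lemma bianchi_swap:
  assumes "X \<in> \<Gamma>" "Y \<in> \<Gamma>" "Z \<in> \<Gamma>"
  shows "curvature D Z X Y = curvature D Z Y X - curvature D X Y Z"
proof -
  have "curvature D Z X Y - (curvature D Z Y X - curvature D X Y Z) = 0"
    using bianchi[OF assms] curvature_skew[OF assms(3,2,1)] by (simp add: algebra_simps)
  then show ?thesis by simp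
qed

text \<open>
  Since \<open>R(X, Y)\<xi> = 0\<close>, the Bianchi identity makes \<open>R(\<xi>, X)Y\<close> symmetric in \<open>X\<close> and \<open>Y\<close>; it commutes with the
  structures in the slot of \<open>Y\<close>, hence in both.
\<close>

lemma curvature_xi:
  assumes "X \<in> \<Gamma>" "Y \<in> \<Gamma>"
  shows "curvature D \<xi> X Y = 0"
proof (rule bilinear_0[OF _ assms])
  have sym: "curvature D \<xi> Y X = curvature D \<xi> X Y" if "X \<in> \<Gamma>" "Y \<in> \<Gamma>" for X Y
  proof -
    have "curvature D X Y \<xi> = 0" using that by (simp add: curvature_def)
    then show ?thesis using bianchi[OF xi_in that] curvature_skew[OF xi_in that(2) that(1)] by simp
  qed
  fix X Y assume XY: "X \<in> \<Gamma>" "Y \<in> \<Gamma>"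
  have "curvature D \<xi> \<phi>\<langle>X\<rangle> Y = \<phi>\<langle>curvature D \<xi> X Y\<rangle>" "curvature D \<xi> \<psi>\<langle>X\<rangle> Y = \<psi>\<langle>curvature D \<xi> X Y\<rangle>"
    using XY sym[of X Y] sym[of "\<phi>\<langle>X\<rangle>" Y] sym[of "\<psi>\<langle>X\<rangle>" Y] by (simp_all add: curvature_phi curvature_psi)
  then show "curvature D \<xi> X Y \<in> \<Gamma> \<and> \<eta>\<langle>curvature D \<xi> X Y\<rangle> = 0
      \<and> curvature D \<xi> \<phi>\<langle>X\<rangle> Y = \<phi>\<langle>curvature D \<xi> X Y\<rangle> \<and> curvature D \<xi> X \<phi>\<langle>Y\<rangle> = \<phi>\<langle>curvature D \<xi> X Y\<rangle>
      \<and> curvature D \<xi> \<psi>\<langle>X\<rangle> Y = \<psi>\<langle>curvature D \<xi> X Y\<rangle> \<and> curvature D \<xi> X \<psi>\<langle>Y\<rangle> = \<psi>\<langle>curvature D \<xi> X Y\<rangle>"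
    using XY by (simp add: curvature_phi curvature_psi)
qed

lemma curvature_square:
  assumes "X \<in> \<Gamma>" "Y \<in> \<Gamma>" "Z \<in> \<Gamma>"
  shows "curvature D \<phi>\<langle>\<phi>\<langle>X\<rangle>\<rangle> Y Z = \<epsilon> *\<^sub>R curvature D X Y Z"
    "curvature D X \<phi>\<langle>\<phi>\<langle>Y\<rangle>\<rangle> Z = \<epsilon> *\<^sub>R curvature D X Y Z"
proof -
  have left: "curvature D \<phi>\<langle>\<phi>\<langle>X\<rangle>\<rangle> Y Z = \<epsilon> *\<^sub>R curvature D X Y Z"
    if "X \<in> \<Gamma>" "Y \<in> \<Gamma>" "Z \<in> \<Gamma>" for X Y Z
    using that by (simp add: square curvature_rules curvature_xi fscale_simps)
  then show "curvature D \<phi>\<langle>\<phi>\<langle>X\<rangle>\<rangle> Y Z = \<epsilon> *\<^sub>R curvature D X Y Z" using assms .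
  show "curvature D X \<phi>\<langle>\<phi>\<langle>Y\<rangle>\<rangle> Z = \<epsilon> *\<^sub>R curvature D X Y Z"
    using left[OF assms(2,1,3)] curvature_skew[OF assms] curvature_skew[of X "\<phi>\<langle>\<phi>\<langle>Y\<rangle>\<rangle>" Z] assms by simp
qed

text \<open>
  Let \<open>L = R(\<phi>X, \<phi>Y) + \<epsilon>R(X, Y)\<close> and \<open>G = R(\<phi>X, Y) + R(X, \<phi>Y)\<close>. The Bianchi identities for \<open>(\<phi>X, Y, Z)\<close> and
  \<open>(X, \<phi>Y, Z)\<close>, to which \<open>\<phi>\<close> is applied, minus those for \<open>(\<phi>X, \<phi>Y, Z)\<close> and \<open>\<epsilon>\<close> times \<open>(X, Y, Z)\<close> give \<open>L = \<phi>G\<close>.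
  As \<open>L\<close> and \<open>G\<close> commute with \<open>\<psi>\<close>, the structures \<open>\<phi>\<close> and \<open>\<psi>\<close> commute on the values of \<open>G\<close>, and \<open>G = 0\<close>.
\<close>

lemma curvature_phi_phi:
  assumes XY: "X \<in> \<Gamma>" "Y \<in> \<Gamma>" and "Z \<in> \<Gamma>"
  shows "curvature D \<phi>\<langle>X\<rangle> \<phi>\<langle>Y\<rangle> Z = - \<epsilon> *\<^sub>R curvature D X Y Z"
proof -
  define L where "L = (\<lambda>Z. curvature D \<phi>\<langle>X\<rangle> \<phi>\<langle>Y\<rangle> Z + \<epsilon> *\<^sub>R curvature D X Y Z)"
  define G where "G = (\<lambda>Z. curvature D \<phi>\<langle>X\<rangle> Y Z + curvature D X \<phi>\<langle>Y\<rangle> Z)"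
  have L_in: "L Z \<in> \<Gamma>" and G_in: "G Z \<in> \<Gamma>" and eta: "\<eta>\<langle>L Z\<rangle> = 0" "\<eta>\<langle>G Z\<rangle> = 0" if "Z \<in> \<Gamma>" for Z
    using that XY by (simp_all add: L_def G_def)
  have LG: "L Z = \<phi>\<langle>G Z\<rangle>" if Z: "Z \<in> \<Gamma>" for Z
  proof -
    note cl = XY Z app_rules(1)[OF XY(1)] app_rules(1)[OF XY(2)]
    have 1: "curvature D \<phi>\<langle>X\<rangle> Y Z = - \<phi>\<langle>curvature D Y Z X\<rangle> - curvature D Z \<phi>\<langle>X\<rangle> Y"
      using bianchi[of "\<phi>\<langle>X\<rangle>" Y Z] cl by (simp add: curvature_phi eq_neg_iff_add_eq_0 algebra_simps)
    have 2: "curvature D X \<phi>\<langle>Y\<rangle> Z = - curvature D \<phi>\<langle>Y\<rangle> Z X - \<phi>\<langle>curvature D Z X Y\<rangle>"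
      using bianchi[of X "\<phi>\<langle>Y\<rangle>" Z] cl by (simp add: curvature_phi eq_neg_iff_add_eq_0 algebra_simps)
    have 3: "curvature D X Y Z = - curvature D Y Z X - curvature D Z X Y"
      using bianchi[of X Y Z] cl by (simp add: eq_neg_iff_add_eq_0 algebra_simps)
    have 4: "curvature D \<phi>\<langle>X\<rangle> \<phi>\<langle>Y\<rangle> Z = - \<phi>\<langle>curvature D \<phi>\<langle>Y\<rangle> Z X\<rangle> - \<phi>\<langle>curvature D Z \<phi>\<langle>X\<rangle> Y\<rangle>"
      using bianchi[of "\<phi>\<langle>X\<rangle>" "\<phi>\<langle>Y\<rangle>" Z] cl by (simp add: curvature_phi eq_neg_iff_add_eq_0 algebra_simps)
    show ?thesis
      unfolding L_def G_def 1 2 3 4 using cl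
      by (simp add: square_horizontal algebra_simps)
  qed
  have psi: "L \<psi>\<langle>Z\<rangle> = \<psi>\<langle>L Z\<rangle>" "G \<psi>\<langle>Z\<rangle> = \<psi>\<langle>G Z\<rangle>" if "Z \<in> \<Gamma>" for Z
    using that XY by (simp_all add: L_def G_def curvature_psi)
  have "G Z = 0" if Z: "Z \<in> \<Gamma>" for Z
  proof (rule commuting_horizontal_0[OF G_in[OF Z] eta(2)[OF Z]])
    show "\<phi>\<langle>\<psi>\<langle>G Z\<rangle>\<rangle> = \<psi>\<langle>\<phi>\<langle>G Z\<rangle>\<rangle>"
      using psi[OF Z] LG[OF Z] LG[OF psi.app_rules(1)[OF Z]] by simp
  qed
  then have "L Z = 0" using LG[OF assms(3)] assms(3) by simp
  then show ?thesis by (simp add: L_def eq_neg_iff_add_eq_0)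
qed

lemma curvature_phi_shift:
  assumes "X \<in> \<Gamma>" "Y \<in> \<Gamma>" "Z \<in> \<Gamma>"
  shows "curvature D X \<phi>\<langle>Y\<rangle> Z = - curvature D \<phi>\<langle>X\<rangle> Y Z"
proof -
  have "\<epsilon> *\<^sub>R curvature D \<phi>\<langle>X\<rangle> Y Z = - \<epsilon> *\<^sub>R curvature D X \<phi>\<langle>Y\<rangle> Z"
    using curvature_phi_phi[OF assms(1) app_rules(1)[OF assms(2)] assms(3)]
      curvature_square(2)[OF app_rules(1)[OF assms(1)] assms(2,3)] by simp
  then have "\<epsilon> *\<^sub>R curvature D \<phi>\<langle>X\<rangle> Y Z = \<epsilon> *\<^sub>R - curvature D X \<phi>\<langle>Y\<rangle> Z" by simp
  then show ?thesis using sign_nz by (metis scaleR_cancel_left minus_minus)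
qed

lemma C_linear_phi: "C_linear F \<Longrightarrow> C_linear (\<lambda>Z. \<phi>\<langle>F Z\<rangle>)" and C_linear_app: "C_linear (\<lambda>Z. \<phi>\<langle>Z\<rangle>)"
  by (auto simp: C_linear_def)

text \<open>
  \<open>R(Z, \<phi>X)\<phi>Y = - \<phi>R(\<phi>Z, X)Y\<close>, and under the trace the outer \<open>\<phi>\<close> can be moved next to the inner one.
\<close>

lemma ricci_phi_phi:
  assumes "X \<in> \<Gamma>" "Y \<in> \<Gamma>"
  shows "ricci M D \<phi>\<langle>X\<rangle> \<phi>\<langle>Y\<rangle> = - \<epsilon> *\<^sub>R ricci M D X Y"
proof -
  let ?A = "\<lambda>Z. curvature D Z X Y"
  have A: "C_linear ?A" using assms by (rule curvature_C_linear_left)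
  have Ap: "C_linear (\<lambda>Z. ?A \<phi>\<langle>Z\<rangle>)"
    using A by (auto simp: C_linear_def)
  have "ricci M D \<phi>\<langle>X\<rangle> \<phi>\<langle>Y\<rangle> = trace_field M (\<lambda>Z. (-1) *\<^sub>R \<phi>\<langle>?A \<phi>\<langle>Z\<rangle>\<rangle>)"
    unfolding ricci_def using assms
    by (intro trace_cong) (simp add: curvature_phi curvature_phi_shift)
  also have "\<dots> = (-1) *\<^sub>R trace_field M (\<lambda>Z. \<phi>\<langle>?A \<phi>\<langle>Z\<rangle>\<rangle>)"
    by (intro trace_scaleR C_linear_phi Ap)
  also have "trace_field M (\<lambda>Z. \<phi>\<langle>?A \<phi>\<langle>Z\<rangle>\<rangle>) = trace_field M (\<lambda>Z. \<phi>\<langle>\<phi>\<langle>?A Z\<rangle>\<rangle>)"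
    by (rule trace_commute[OF C_linear_phi[OF A] C_linear_app])
  also have "\<dots> = trace_field M (\<lambda>Z. \<epsilon> *\<^sub>R ?A Z)"
    using assms by (intro trace_cong) (simp add: square_horizontal)
  also have "\<dots> = \<epsilon> *\<^sub>R ricci M D X Y"
    unfolding ricci_def by (rule trace_scaleR[OF A])
  finally show ?thesis by (simp add: fun_eq_iff)
qed

text \<open>
  Conjugation with \<open>\<psi>\<close> changes the sign of \<open>\<phi>R(X, Y)\<close>.
\<close>

lemma trace_phi_curvature:
  assumes "X \<in> \<Gamma>" "Y \<in> \<Gamma>"
  shows "trace_field M (\<lambda>Z. \<phi>\<langle>curvature D X Y Z\<rangle>) = 0"
proof -
  let ?F = "\<lambda>Z. \<phi>\<langle>curvature D X Y Z\<rangle>"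
  have F: "C_linear ?F" using curvature_C_linear_right[OF assms] by (rule C_linear_phi)
  have psi: "C_linear (\<lambda>Z. \<psi>\<langle>Z\<rangle>)" by (auto simp: C_linear_def)
  have psiF: "C_linear (\<lambda>Z. \<psi>\<langle>?F Z\<rangle>)" using F by (auto simp: C_linear_def)
  have "\<delta> *\<^sub>R trace_field M ?F = trace_field M (\<lambda>Z. \<psi>\<langle>\<psi>\<langle>?F Z\<rangle>\<rangle>)"
    unfolding trace_scaleR[OF F, symmetric]
    using assms by (intro trace_cong) (simp add: psi.square_horizontal)
  also have "\<dots> = trace_field M (\<lambda>Z. \<psi>\<langle>?F \<psi>\<langle>Z\<rangle>\<rangle>)"
    by (rule trace_commute[OF psi psiF])
  also have "\<dots> = trace_field M (\<lambda>Z. (- \<delta>) *\<^sub>R ?F Z)"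
    using assms by (intro trace_cong) (simp add: curvature_psi anticommute psi.square_horizontal)
  also have "\<dots> = (- \<delta>) *\<^sub>R trace_field M ?F" by (rule trace_scaleR[OF F])
  finally show ?thesis using psi.sign_nz by (simp add: fun_eq_iff)
qed

lemma ricci_bianchi:
  assumes "X \<in> \<Gamma>" "Y \<in> \<Gamma>"
  shows "ricci M D X Y = ricci M D Y X - trace_field M (curvature D X Y)"
proof -
  have "ricci M D X Y = trace_field M (\<lambda>Z. curvature D Z Y X - curvature D X Y Z)"
    unfolding ricci_def
  proof (rule trace_cong)
    fix Z assume Z: "Z \<in> \<Gamma>"
    show "curvature D Z X Y = curvature D Z Y X - curvature D X Y Z"
      using bianchi_swap[OF assms Z] by simp
  qed
  also have "\<dots> = ricci M D Y X - trace_field M (curvature D X Y)"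
    unfolding ricci_def
    by (rule trace_diff[OF curvature_C_linear_left[OF assms(2,1)] curvature_C_linear_right[OF assms]])
  finally show ?thesis .
qed

text \<open>
  The trace of \<open>\<phi>\<close> applied to the Bianchi identity; the term with \<open>R(X, Y)Z\<close> has trace 0.
\<close>

lemma ricci_phi_symmetric:
  assumes "X \<in> \<Gamma>" "Y \<in> \<Gamma>"
  shows "ricci M D X \<phi>\<langle>Y\<rangle> = ricci M D Y \<phi>\<langle>X\<rangle>"
proof -
  have "ricci M D X \<phi>\<langle>Y\<rangle> = trace_field M (\<lambda>Z. curvature D Z Y \<phi>\<langle>X\<rangle> - \<phi>\<langle>curvature D X Y Z\<rangle>)"
    unfolding ricci_def
  proof (rule trace_cong)
    fix Z assume Z: "Z \<in> \<Gamma>"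
    show "curvature D Z X \<phi>\<langle>Y\<rangle> = curvature D Z Y \<phi>\<langle>X\<rangle> - \<phi>\<langle>curvature D X Y Z\<rangle>"
      using assms Z bianchi_swap[OF assms Z] by (simp add: curvature_phi)
  qed
  also have "\<dots> = ricci M D Y \<phi>\<langle>X\<rangle> - trace_field M (\<lambda>Z. \<phi>\<langle>curvature D X Y Z\<rangle>)"
    unfolding ricci_def
    by (rule trace_diff[OF curvature_C_linear_left[OF assms(2) app_rules(1)[OF assms(1)]]
          C_linear_phi[OF curvature_C_linear_right[OF assms]]])
  finally show ?thesis unfolding trace_phi_curvature[OF assms] by simp
qed

text \<open>
  \<open>Ric(\<phi>X, \<phi>Y)\<close> is \<open>- \<epsilon>Ric(X, Y)\<close>, and by the preceding symmetry it is \<open>Ric(Y, \<phi>\<^sup>2X) = \<epsilon>Ric(Y, X)\<close>.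
\<close>

lemma ricci_skew:
  assumes "X \<in> \<Gamma>" "Y \<in> \<Gamma>"
  shows "ricci M D X Y = - ricci M D Y X"
proof -
  have "ricci M D \<phi>\<langle>X\<rangle> \<phi>\<langle>Y\<rangle> = ricci M D Y \<phi>\<langle>\<phi>\<langle>X\<rangle>\<rangle>"
    by (rule ricci_phi_symmetric) (use assms in simp_all)
  also have "\<dots> = trace_field M (\<lambda>Z. \<epsilon> *\<^sub>R curvature D Z Y X)"
    unfolding ricci_def using assms
    by (intro trace_cong) (simp add: curvature_phi square_horizontal)
  also have "\<dots> = \<epsilon> *\<^sub>R ricci M D Y X"
    unfolding ricci_def using assms(2,1) by (intro trace_scaleR curvature_C_linear_left)
  finally have "- \<epsilon> *\<^sub>R ricci M D X Y = \<epsilon> *\<^sub>R ricci M D Y X"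
    unfolding ricci_phi_phi[OF assms] .
  then have "\<epsilon> *\<^sub>R (ricci M D X Y + ricci M D Y X) = 0"
    by (simp add: fun_eq_iff algebra_simps) (metis neg_eq_iff_add_eq_0)
  then show ?thesis using sign_nz by (simp add: eq_neg_iff_add_eq_0)
qed

lemma ricci_trace:
  assumes "X \<in> \<Gamma>" "Y \<in> \<Gamma>"
  shows "ricci M D X Y = (- 1/2) *\<^sub>R trace_field M (curvature D X Y)"
proof
  fix p
  have "ricci M D X Y p = - ricci M D Y X p"
    "ricci M D X Y p = ricci M D Y X p - trace_field M (curvature D X Y) p"
    using ricci_skew[OF assms] ricci_bianchi[OF assms] by (simp_all add: fun_eq_iff)
  then show "ricci M D X Y p = ((- 1/2) *\<^sub>R trace_field M (curvature D X Y)) p" by simp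
qed

end

section \<open>Uniqueness and existence\<close>

text \<open>
  The difference tensor is symmetric because the torsions agree, and it commutes with \<open>\<phi>\<close> and \<open>\<psi>\<close> in the
  second slot, hence in both.
\<close>

lemma (in anti_pair) canonical_unique:
  assumes "canonical_pair M \<eta> \<xi> \<phi> \<epsilon> \<psi> \<delta> D" "canonical_pair M \<eta> \<xi> \<phi> \<epsilon> \<psi> \<delta> D'"
  shows "D = D'"
proof -
  interpret D: canonical_pair M \<eta> \<xi> \<phi> \<epsilon> \<psi> \<delta> D by (rule assms)
  interpret D': canonical_pair M \<eta> \<xi> \<phi> \<epsilon> \<psi> \<delta> D' by (rule assms)
  define A where "A = (\<lambda>X Y. D X Y - D' X Y)"
  have sym: "A Y X = A X Y" if "X \<in> \<Gamma>" "Y \<in> \<Gamma>" for X Y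
    using D.D_commutator[OF that] D'.D_commutator[OF that] by (simp add: A_def)
  have "A X Y = 0" if "X \<in> \<Gamma>" "Y \<in> \<Gamma>" for X Y
  proof (rule bilinear_0[OF _ that])
    fix X Y assume XY: "X \<in> \<Gamma>" "Y \<in> \<Gamma>"
    have right: "A X \<phi>\<langle>Y\<rangle> = \<phi>\<langle>A X Y\<rangle>" "A X \<psi>\<langle>Y\<rangle> = \<psi>\<langle>A X Y\<rangle>" if "X \<in> \<Gamma>" "Y \<in> \<Gamma>" for X Y
      using that by (simp_all add: A_def D.D_phi D'.D_phi D.D_psi D'.D_psi)
    have "A \<phi>\<langle>X\<rangle> Y = \<phi>\<langle>A X Y\<rangle>" "A \<psi>\<langle>X\<rangle> Y = \<psi>\<langle>A X Y\<rangle>"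
      using XY right[OF XY(2,1)] sym[OF XY] sym[of "\<phi>\<langle>X\<rangle>" Y] sym[of "\<psi>\<langle>X\<rangle>" Y] by simp_all
    moreover have "\<eta>\<langle>A X Y\<rangle> = 0" "A X Y \<in> \<Gamma>"
      using XY by (simp_all add: A_def D.eta_D D'.eta_D)
    ultimately show "A X Y \<in> \<Gamma> \<and> \<eta>\<langle>A X Y\<rangle> = 0
        \<and> A \<phi>\<langle>X\<rangle> Y = \<phi>\<langle>A X Y\<rangle> \<and> A X \<phi>\<langle>Y\<rangle> = \<phi>\<langle>A X Y\<rangle>
        \<and> A \<psi>\<langle>X\<rangle> Y = \<psi>\<langle>A X Y\<rangle> \<and> A X \<psi>\<langle>Y\<rangle> = \<psi>\<langle>A X Y\<rangle>"
      using right[OF XY] by simp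
  qed
  then have eq: "D X Y = D' X Y" if "X \<in> \<Gamma>" "Y \<in> \<Gamma>" for X Y
    using that by (simp add: A_def)
  have PiE: "D \<in> \<Gamma> \<rightarrow>\<^sub>E (\<Gamma> \<rightarrow>\<^sub>E \<Gamma>)" "D' \<in> \<Gamma> \<rightarrow>\<^sub>E (\<Gamma> \<rightarrow>\<^sub>E \<Gamma>)"
    using D.linear_connection D'.linear_connection by (auto simp: linear_connection_def)
  show ?thesis
  proof (rule PiE_ext[OF PiE])
    fix X assume X: "X \<in> \<Gamma>"
    show "D X = D' X"
      by (rule PiE_ext[OF PiE_mem[OF PiE(1) X] PiE_mem[OF PiE(2) X]]) (rule eq[OF X])
  qed
qed

text \<open>
  Both tensors \<open>h\<close> in the torsion condition are 0 by normality, and the condition says that the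
  horizontal torsion is balanced in \<open>\<phi>\<close>.
\<close>

lemma (in parallel_pair) torsion_condition_iff:
  "torsion_condition M \<eta> \<xi> \<phi> D \<longleftrightarrow> (\<forall>X\<in>\<Gamma>. \<forall>Y\<in>\<Gamma>. torsion D X Y = \<tau> X Y \<odot> \<xi>)"
proof
  assume tc: "torsion_condition M \<eta> \<xi> \<phi> D"
  have "horizontal_torsion \<phi>\<langle>X\<rangle> Y = horizontal_torsion X \<phi>\<langle>Y\<rangle>" if XY: "X \<in> \<Gamma>" "Y \<in> \<Gamma>" for X Y
  proof -
    have "torsion D \<phi>\<langle>X\<rangle> Y - torsion D X \<phi>\<langle>Y\<rangle> = (\<tau> \<phi>\<langle>X\<rangle> Y - \<tau> X \<phi>\<langle>Y\<rangle>) \<odot> \<xi>"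
      using tc XY by (simp add: torsion_condition_def \<tau>_def h_op_0 fscale_simps scaleR_diff_right)
    then show ?thesis by (simp add: horizontal_torsion_def fscale_simps algebra_simps)
  qed
  then show "\<forall>X\<in>\<Gamma>. \<forall>Y\<in>\<Gamma>. torsion D X Y = \<tau> X Y \<odot> \<xi>"
    using horizontal_torsion_0 by (simp add: horizontal_torsion_def)
next
  assume "\<forall>X\<in>\<Gamma>. \<forall>Y\<in>\<Gamma>. torsion D X Y = \<tau> X Y \<odot> \<xi>"
  then show "torsion_condition M \<eta> \<xi> \<phi> D"
    by (simp add: torsion_condition_def \<tau>_def h_op_0 fscale_simps scaleR_diff_right)
qed

locale paracontact_pair = anti_pair M \<eta> \<xi> \<phi> 1 \<psi> 1
  for M :: "('a::{t2_space,second_countable_topology}, 'e::euclidean_space) chart set"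
    and \<eta> \<xi> \<phi> \<psi>
begin

definition horizontal :: "'a vfield \<Rightarrow> 'a vfield" where
  "horizontal X = X - \<eta>\<langle>X\<rangle> \<odot> \<xi>"

lemma horizontal_in [simp]: "X \<in> \<Gamma> \<Longrightarrow> horizontal X \<in> \<Gamma>"
  and eta_horizontal [simp]: "X \<in> \<Gamma> \<Longrightarrow> \<eta>\<langle>horizontal X\<rangle> = 0"
  and app_app [simp]: "X \<in> \<Gamma> \<Longrightarrow> \<phi>\<langle>\<phi>\<langle>X\<rangle>\<rangle> = horizontal X" "X \<in> \<Gamma> \<Longrightarrow> \<psi>\<langle>\<psi>\<langle>X\<rangle>\<rangle> = horizontal X"
  and app_horizontal [simp]: "X \<in> \<Gamma> \<Longrightarrow> \<phi>\<langle>horizontal X\<rangle> = \<phi>\<langle>X\<rangle>" "X \<in> \<Gamma> \<Longrightarrow> \<psi>\<langle>horizontal X\<rangle> = \<psi>\<langle>X\<rangle>"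
  and horizontal_app [simp]: "X \<in> \<Gamma> \<Longrightarrow> horizontal \<phi>\<langle>X\<rangle> = \<phi>\<langle>X\<rangle>" "X \<in> \<Gamma> \<Longrightarrow> horizontal \<psi>\<langle>X\<rangle> = \<psi>\<langle>X\<rangle>"
  and horizontal_xi [simp]: "horizontal \<xi> = 0"
  by (simp_all add: horizontal_def square psi.square fscale_simps)

lemma horizontal_id [simp]: "\<eta>\<langle>X\<rangle> = 0 \<Longrightarrow> horizontal X = X"
  by (simp add: horizontal_def fscale_simps)

lemma horizontal_rules [simp]:
  "X \<in> \<Gamma> \<Longrightarrow> Y \<in> \<Gamma> \<Longrightarrow> horizontal (X + Y) = horizontal X + horizontal Y"
  "X \<in> \<Gamma> \<Longrightarrow> Y \<in> \<Gamma> \<Longrightarrow> horizontal (X - Y) = horizontal X - horizontal Y"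
  "X \<in> \<Gamma> \<Longrightarrow> horizontal (- X) = - horizontal X"
  "X \<in> \<Gamma> \<Longrightarrow> f \<in> C \<Longrightarrow> horizontal (f \<odot> X) = f \<odot> horizontal X"
  "X \<in> \<Gamma> \<Longrightarrow> horizontal (horizontal X) = horizontal X"
  by (simp_all add: horizontal_def fscale_simps)

text \<open>
  The horizontal part of the normality condition. It trades brackets under \<open>\<phi>\<close> for brackets that are
  only projected.
\<close>

lemma normal_horizontal:
  assumes "X \<in> \<Gamma>" "Y \<in> \<Gamma>"
  shows "\<phi>\<langle>lie_bracket \<phi>\<langle>X\<rangle> Y\<rangle> + \<phi>\<langle>lie_bracket X \<phi>\<langle>Y\<rangle>\<rangle>
    = horizontal (lie_bracket X Y) + horizontal (lie_bracket \<phi>\<langle>X\<rangle> \<phi>\<langle>Y\<rangle>)"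
proof -
  have "\<eta>\<langle>lie_bracket \<phi>\<langle>X\<rangle> \<phi>\<langle>Y\<rangle>\<rangle> = \<tau> X Y"
    using assms by (simp add: eta_bracket tau_app)
  then show ?thesis
    using normal[OF assms] assms
    by (simp add: nijenhuis_def horizontal_def[of "lie_bracket \<phi>\<langle>X\<rangle> \<phi>\<langle>Y\<rangle>"] algebra_simps)
qed

lemma swapped_pair: "paracontact_pair M \<eta> \<xi> \<psi> \<phi>"
  by unfold_locales (simp add: anticommute)

text \<open>
  With the projections \<open>P\<^sub>\<plusminus> = (\<phi>\<^sup>2 \<plusminus> \<phi>)/2\<close> to the eigenbundles of \<open>\<phi>\<close>, this is for horizontal \<open>X\<close> and \<open>Y\<close> the expression
  \<open>4 (P\<^sub>-[P\<^sub>+X, P\<^sub>-Y] + P\<^sub>+[P\<^sub>-X, P\<^sub>+Y])\<close>, expanded. It is four times the covariant derivative, along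
  one eigenbundle, of sections of the other.
\<close>

definition cross :: "'a vfield \<Rightarrow> 'a vfield \<Rightarrow> 'a vfield" where
  "cross X Y = horizontal (lie_bracket X Y) - horizontal (lie_bracket \<phi>\<langle>X\<rangle> \<phi>\<langle>Y\<rangle>)
    - \<phi>\<langle>lie_bracket \<phi>\<langle>X\<rangle> Y\<rangle> + \<phi>\<langle>lie_bracket X \<phi>\<langle>Y\<rangle>\<rangle>"

text \<open>
  The summand with \<open>\<psi>\<close>, which interchanges the eigenbundles, is four times the covariant derivative, along
  one eigenbundle, of sections of the same eigenbundle.
\<close>

definition nabla4 :: "'a vfield \<Rightarrow> 'a vfield \<Rightarrow> 'a vfield" where
  "nabla4 X Y = cross X Y + \<psi>\<langle>cross X \<psi>\<langle>Y\<rangle>\<rangle>"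

lemma cross_in [simp]: "X \<in> \<Gamma> \<Longrightarrow> Y \<in> \<Gamma> \<Longrightarrow> cross X Y \<in> \<Gamma>"
  and nabla4_in [simp]: "X \<in> \<Gamma> \<Longrightarrow> Y \<in> \<Gamma> \<Longrightarrow> nabla4 X Y \<in> \<Gamma>"
  by (simp_all add: cross_def nabla4_def)

lemma cross_rules:
  assumes "X \<in> \<Gamma>" "Y \<in> \<Gamma>"
  shows "Z \<in> \<Gamma> \<Longrightarrow> cross (X + Y) Z = cross X Z + cross Y Z"
    and "Z \<in> \<Gamma> \<Longrightarrow> cross X (Y + Z) = cross X Y + cross X Z"
    and "cross X (- Y) = - cross X Y"
    and "f \<in> C \<Longrightarrow> cross (f \<odot> X) Y = f \<odot> cross X Y"
    and "f \<in> C \<Longrightarrow> cross X (f \<odot> Y) = f \<odot> cross X Y + 2 *\<^sub>R ((X \<rhd> f) \<odot> horizontal Y)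
      - 2 *\<^sub>R ((\<phi>\<langle>X\<rangle> \<rhd> f) \<odot> \<phi>\<langle>Y\<rangle>)"
    and "\<eta>\<langle>Y\<rangle> = 0 \<Longrightarrow> cross X \<phi>\<langle>Y\<rangle> = \<phi>\<langle>cross X Y\<rangle>"
    and "horizontal (cross X Y) = cross X Y"
    and cross_commutator: "cross X Y - cross Y X
      = 2 *\<^sub>R horizontal (lie_bracket X Y) - 2 *\<^sub>R horizontal (lie_bracket \<phi>\<langle>X\<rangle> \<phi>\<langle>Y\<rangle>)"
  using assms bracket_skew[of X Y] bracket_skew[of "\<phi>\<langle>X\<rangle>" "\<phi>\<langle>Y\<rangle>"] bracket_skew[of X "\<phi>\<langle>Y\<rangle>"]
    bracket_skew[of "\<phi>\<langle>X\<rangle>" Y]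
  by (simp_all add: cross_def bracket_rules bracket_minus fscale_simps algebra_simps)


lemma psi_phi: "X \<in> \<Gamma> \<Longrightarrow> \<psi>\<langle>\<phi>\<langle>X\<rangle>\<rangle> = - \<phi>\<langle>\<psi>\<langle>X\<rangle>\<rangle>"
  by (simp add: anticommute)

lemma nabla4_rules:
  assumes "X \<in> \<Gamma>" "Y \<in> \<Gamma>"
  shows "Z \<in> \<Gamma> \<Longrightarrow> nabla4 (X + Y) Z = nabla4 X Z + nabla4 Y Z"
    and "Z \<in> \<Gamma> \<Longrightarrow> nabla4 X (Y + Z) = nabla4 X Y + nabla4 X Z"
    and "f \<in> C \<Longrightarrow> nabla4 (f \<odot> X) Y = f \<odot> nabla4 X Y"
    and "f \<in> C \<Longrightarrow> nabla4 X (f \<odot> Y) = f \<odot> nabla4 X Y + 4 *\<^sub>R ((X \<rhd> f) \<odot> horizontal Y)"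
    and "\<eta>\<langle>Y\<rangle> = 0 \<Longrightarrow> nabla4 X \<phi>\<langle>Y\<rangle> = \<phi>\<langle>nabla4 X Y\<rangle>"
    and "\<eta>\<langle>Y\<rangle> = 0 \<Longrightarrow> nabla4 X \<psi>\<langle>Y\<rangle> = \<psi>\<langle>nabla4 X Y\<rangle>"
  using assms
  by (simp_all add: nabla4_def cross_rules psi_phi fscale_simps algebra_simps)

text \<open>
  All brackets that occur are brackets of the eight fields \<open>X, \<phi>X, \<psi>X, \<psi>\<phi>X\<close> and \<open>Y, \<phi>Y, \<psi>Y, \<psi>\<phi>Y\<close>. Normality of
  \<open>\<psi>\<close> is used at \<open>(X, Y)\<close>, \<open>(\<phi>X, \<phi>Y)\<close>, \<open>(\<phi>X, Y)\<close> and \<open>(X, \<phi>Y)\<close>, and normality of \<open>\<phi>\<close> at \<open>(X, Y)\<close> and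
  \<open>(\<psi>X, \<psi>Y)\<close>. The brackets with a \<open>\<psi>\<close> in both slots then cancel.
\<close>

lemma cross_psi_commutator:
  assumes "X \<in> \<Gamma>" "Y \<in> \<Gamma>"
  shows "\<psi>\<langle>cross X \<psi>\<langle>Y\<rangle>\<rangle> - \<psi>\<langle>cross Y \<psi>\<langle>X\<rangle>\<rangle>
    = 2 *\<^sub>R horizontal (lie_bracket X Y) + 2 *\<^sub>R horizontal (lie_bracket \<phi>\<langle>X\<rangle> \<phi>\<langle>Y\<rangle>)"
proof -
  interpret swap: paracontact_pair M \<eta> \<xi> \<psi> \<phi> by (rule swapped_pair)
  define a where "a = \<phi>\<langle>X\<rangle>"
  define b where "b = \<phi>\<langle>Y\<rangle>"
  define B where "B = (\<lambda>X Y. horizontal (lie_bracket X Y))"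
  have ab [simp]: "a \<in> \<Gamma>" "b \<in> \<Gamma>" using assms by (simp_all add: a_def b_def)
  have in_vf [simp]: "X \<in> \<Gamma>" "Y \<in> \<Gamma>" by (rule assms)+
  have n1: "\<psi>\<langle>lie_bracket \<psi>\<langle>X\<rangle> Y\<rangle> + \<psi>\<langle>lie_bracket X \<psi>\<langle>Y\<rangle>\<rangle> = B X Y + B \<psi>\<langle>X\<rangle> \<psi>\<langle>Y\<rangle>"
    and n2: "\<psi>\<langle>lie_bracket \<psi>\<langle>a\<rangle> b\<rangle> + \<psi>\<langle>lie_bracket a \<psi>\<langle>b\<rangle>\<rangle> = B a b + B \<psi>\<langle>a\<rangle> \<psi>\<langle>b\<rangle>"
    and n3: "\<psi>\<langle>lie_bracket \<psi>\<langle>a\<rangle> Y\<rangle> + \<psi>\<langle>lie_bracket a \<psi>\<langle>Y\<rangle>\<rangle> = B a Y + B \<psi>\<langle>a\<rangle> \<psi>\<langle>Y\<rangle>"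
    and n4: "\<psi>\<langle>lie_bracket \<psi>\<langle>X\<rangle> b\<rangle> + \<psi>\<langle>lie_bracket X \<psi>\<langle>b\<rangle>\<rangle> = B X b + B \<psi>\<langle>X\<rangle> \<psi>\<langle>b\<rangle>"
    unfolding B_def by (simp_all only: swap.normal_horizontal ab in_vf)
  have n5: "\<phi>\<langle>B a Y\<rangle> + \<phi>\<langle>B X b\<rangle> = B X Y + B a b"
    using normal_horizontal[of X Y] by (simp add: B_def a_def b_def)
  have n6: "\<phi>\<langle>B \<psi>\<langle>a\<rangle> \<psi>\<langle>Y\<rangle>\<rangle> + \<phi>\<langle>B \<psi>\<langle>X\<rangle> \<psi>\<langle>b\<rangle>\<rangle> = - (B \<psi>\<langle>X\<rangle> \<psi>\<langle>Y\<rangle> + B \<psi>\<langle>a\<rangle> \<psi>\<langle>b\<rangle>)"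
  proof -
    have "\<phi>\<langle>lie_bracket (- \<psi>\<langle>a\<rangle>) \<psi>\<langle>Y\<rangle>\<rangle> + \<phi>\<langle>lie_bracket \<psi>\<langle>X\<rangle> (- \<psi>\<langle>b\<rangle>)\<rangle>
        = B \<psi>\<langle>X\<rangle> \<psi>\<langle>Y\<rangle> + B (- \<psi>\<langle>a\<rangle>) (- \<psi>\<langle>b\<rangle>)"
      using normal_horizontal[of "\<psi>\<langle>X\<rangle>" "\<psi>\<langle>Y\<rangle>"] by (simp only: B_def a_def b_def anticommute in_vf psi.app_rules(1))
    then have "- (\<phi>\<langle>B \<psi>\<langle>a\<rangle> \<psi>\<langle>Y\<rangle>\<rangle> + \<phi>\<langle>B \<psi>\<langle>X\<rangle> \<psi>\<langle>b\<rangle>\<rangle>) = B \<psi>\<langle>X\<rangle> \<psi>\<langle>Y\<rangle> + B \<psi>\<langle>a\<rangle> \<psi>\<langle>b\<rangle>"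
      by (simp add: bracket_minus B_def)
    then show ?thesis by (metis minus_minus)
  qed
  have E1: "\<psi>\<langle>cross X \<psi>\<langle>Y\<rangle>\<rangle> = \<psi>\<langle>lie_bracket X \<psi>\<langle>Y\<rangle>\<rangle> + \<psi>\<langle>lie_bracket a \<psi>\<langle>b\<rangle>\<rangle>
      + \<phi>\<langle>\<psi>\<langle>lie_bracket a \<psi>\<langle>Y\<rangle>\<rangle>\<rangle> + \<phi>\<langle>\<psi>\<langle>lie_bracket X \<psi>\<langle>b\<rangle>\<rangle>\<rangle>"
    by (simp add: cross_def a_def [symmetric] b_def [symmetric] psi_phi anticommute[of Y] bracket_minus)
  have E2: "\<psi>\<langle>cross Y \<psi>\<langle>X\<rangle>\<rangle> = - (\<psi>\<langle>lie_bracket \<psi>\<langle>X\<rangle> Y\<rangle> + \<psi>\<langle>lie_bracket \<psi>\<langle>a\<rangle> b\<rangle>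
      + \<phi>\<langle>\<psi>\<langle>lie_bracket \<psi>\<langle>X\<rangle> b\<rangle>\<rangle> + \<phi>\<langle>\<psi>\<langle>lie_bracket \<psi>\<langle>a\<rangle> Y\<rangle>\<rangle>)"
    by (simp add: cross_def a_def [symmetric] b_def [symmetric] psi_phi anticommute[of X] bracket_minus
        bracket_skew[of "\<psi>\<langle>X\<rangle>" Y] bracket_skew[of "\<psi>\<langle>a\<rangle>" b] bracket_skew[of "\<psi>\<langle>X\<rangle>" b]
        bracket_skew[of "\<psi>\<langle>a\<rangle>" Y])
  have "\<psi>\<langle>cross X \<psi>\<langle>Y\<rangle>\<rangle> - \<psi>\<langle>cross Y \<psi>\<langle>X\<rangle>\<rangle>
    = (\<psi>\<langle>lie_bracket \<psi>\<langle>X\<rangle> Y\<rangle> + \<psi>\<langle>lie_bracket X \<psi>\<langle>Y\<rangle>\<rangle>) + (\<psi>\<langle>lie_bracket \<psi>\<langle>a\<rangle> b\<rangle> + \<psi>\<langle>lie_bracket a \<psi>\<langle>b\<rangle>\<rangle>)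
      + \<phi>\<langle>\<psi>\<langle>lie_bracket \<psi>\<langle>a\<rangle> Y\<rangle> + \<psi>\<langle>lie_bracket a \<psi>\<langle>Y\<rangle>\<rangle>\<rangle>
      + \<phi>\<langle>\<psi>\<langle>lie_bracket \<psi>\<langle>X\<rangle> b\<rangle> + \<psi>\<langle>lie_bracket X \<psi>\<langle>b\<rangle>\<rangle>\<rangle>"
    unfolding E1 E2 by (simp add: algebra_simps)
  also have "\<dots> = (B X Y + B \<psi>\<langle>X\<rangle> \<psi>\<langle>Y\<rangle>) + (B a b + B \<psi>\<langle>a\<rangle> \<psi>\<langle>b\<rangle>)
      + (\<phi>\<langle>B a Y\<rangle> + \<phi>\<langle>B X b\<rangle>) + (\<phi>\<langle>B \<psi>\<langle>a\<rangle> \<psi>\<langle>Y\<rangle>\<rangle> + \<phi>\<langle>B \<psi>\<langle>X\<rangle> \<psi>\<langle>b\<rangle>\<rangle>)"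
    unfolding n1 n2 n3 n4 by (simp add: B_def algebra_simps)
  also have "\<dots> = 2 *\<^sub>R B X Y + 2 *\<^sub>R B a b"
    unfolding n5 n6 by simp
  finally show ?thesis by (simp only: B_def a_def b_def)
qed

lemma nabla4_commutator:
  assumes "X \<in> \<Gamma>" "Y \<in> \<Gamma>"
  shows "nabla4 X Y - nabla4 Y X = 4 *\<^sub>R horizontal (lie_bracket X Y)"
proof -
  have "nabla4 X Y - nabla4 Y X = (cross X Y - cross Y X) + (\<psi>\<langle>cross X \<psi>\<langle>Y\<rangle>\<rangle> - \<psi>\<langle>cross Y \<psi>\<langle>X\<rangle>\<rangle>)"
    by (simp add: nabla4_def)
  then show ?thesis unfolding cross_commutator[OF assms] cross_psi_commutator[OF assms]
    by (simp add: scaleR_left_distrib[symmetric])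
qed

text \<open>
  The three summands are \<open>\<nabla>\<^sub>X(\<eta>(Y)\<xi>)\<close>, the derivative in direction \<open>\<xi>\<close>, which is forced to be the bracket, and the
  derivative of the horizontal part of \<open>Y\<close> along the horizontal part of \<open>X\<close>.
\<close>

definition nabla :: "'a connection" where
  "nabla = (\<lambda>X\<in>\<Gamma>. \<lambda>Y\<in>\<Gamma>. (X \<rhd> \<eta>\<langle>Y\<rangle>) \<odot> \<xi> + \<eta>\<langle>X\<rangle> \<odot> horizontal (lie_bracket \<xi> Y)
     + (1/4) *\<^sub>R nabla4 (horizontal X) (horizontal Y))"

lemma nabla_eq:
  "X \<in> \<Gamma> \<Longrightarrow> Y \<in> \<Gamma> \<Longrightarrow> nabla X Y = (X \<rhd> \<eta>\<langle>Y\<rangle>) \<odot> \<xi> + \<eta>\<langle>X\<rangle> \<odot> horizontal (lie_bracket \<xi> Y)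
     + (1/4) *\<^sub>R nabla4 (horizontal X) (horizontal Y)"
  by (simp add: nabla_def)

lemma horizontal_directional: "horizontal X \<rhd> f = X \<rhd> f - \<eta>\<langle>X\<rangle> * (\<xi> \<rhd> f)"
  by (simp add: horizontal_def directional_rules)

lemma nabla_linear_connection: "linear_connection M nabla"
  unfolding linear_connection_def
proof (intro conjI ballI)
  show "nabla \<in> \<Gamma> \<rightarrow>\<^sub>E (\<Gamma> \<rightarrow>\<^sub>E \<Gamma>)"
    by (auto simp: nabla_def)
next
  fix X Y Z assume "X \<in> \<Gamma>" "Y \<in> \<Gamma>" "Z \<in> \<Gamma>"
  then show "nabla (X + Y) Z = nabla X Z + nabla Y Z" "nabla X (Y + Z) = nabla X Y + nabla X Z"
    by (simp_all add: nabla_eq nabla4_rules bracket_rules directional_rules directional_fun_rules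
        fscale_simps algebra_simps)
next
  fix f X Y assume fXY: "f \<in> C" "X \<in> \<Gamma>" "Y \<in> \<Gamma>"
  then show "nabla (f \<odot> X) Y = f \<odot> nabla X Y"
    by (simp add: nabla_eq nabla4_rules directional_rules fscale_simps)
  show "nabla X (f \<odot> Y) = (X \<rhd> f) \<odot> Y + f \<odot> nabla X Y"
  proof -
    have "(X \<rhd> f) \<odot> Y = (X \<rhd> f) \<odot> horizontal Y + ((X \<rhd> f) * \<eta>\<langle>Y\<rangle>) \<odot> \<xi>"
      by (simp add: horizontal_def fscale_simps)
    then show ?thesis
      using fXY by (simp add: nabla_eq nabla4_rules bracket_rules directional_fun_rules horizontal_directional
          fscale_simps algebra_simps)
  qed
qed

lemma nabla_torsion:
  assumes "X \<in> \<Gamma>" "Y \<in> \<Gamma>"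
  shows "torsion nabla X Y = \<tau> X Y \<odot> \<xi>"
proof -
  have "(1/4) *\<^sub>R nabla4 (horizontal X) (horizontal Y) - (1/4) *\<^sub>R nabla4 (horizontal Y) (horizontal X)
      = horizontal (lie_bracket (horizontal X) (horizontal Y))"
    using nabla4_commutator[of "horizontal X" "horizontal Y"] assms by (simp flip: scaleR_diff_right)
  also have "\<dots> = horizontal (lie_bracket X Y) - \<eta>\<langle>X\<rangle> \<odot> horizontal (lie_bracket \<xi> Y)
      + \<eta>\<langle>Y\<rangle> \<odot> horizontal (lie_bracket \<xi> X)"
    using assms unfolding horizontal_def[of X] horizontal_def[of Y]
    by (simp add: bracket_rules bracket_minus bracket_skew[of \<xi> X] fscale_simps algebra_simps)
  finally show ?thesis
    using assms
    by (simp add: torsion_def nabla_eq tau_eq horizontal_def[of "lie_bracket X Y"] fscale_simps algebra_simps)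
qed

lemma nabla_canonical: "canonical_pair M \<eta> \<xi> \<phi> 1 \<psi> 1 nabla"
proof unfold_locales
  show "linear_connection M nabla" by (rule nabla_linear_connection)
  show "torsion nabla X Y = \<tau> X Y \<odot> \<xi>" if "X \<in> \<Gamma>" "Y \<in> \<Gamma>" for X Y
    using that by (rule nabla_torsion)
  show "nabla X \<xi> = 0" if "X \<in> \<Gamma>" for X
    using that nabla4_rules(4)[of "horizontal X" 0 0] by (simp add: nabla_eq fscale_simps)
  show "nabla X \<phi>\<langle>Y\<rangle> = \<phi>\<langle>nabla X Y\<rangle>" "nabla X \<psi>\<langle>Y\<rangle> = \<psi>\<langle>nabla X Y\<rangle>" if "X \<in> \<Gamma>" "Y \<in> \<Gamma>" for X Y
    using that nabla4_rules(5)[of "horizontal X" "horizontal Y"] nabla4_rules(6)[of "horizontal X" "horizontal Y"]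
    by (simp_all add: nabla_eq bracket_xi_app psi.bracket_xi_app fscale_simps)
qed

end

section \<open>Normal almost bi-paracontact manifolds\<close>

text \<open>
  The structure equations are given at points and are needed for fields.
\<close>

lemma anti_pairI:
  assumes "smooth_atlas M" "one_form M \<eta>" "reeb_field M \<eta> \<xi>" "tensor11 M \<phi>" "tensor11 M \<psi>"
    and "\<epsilon> * \<epsilon> = 1" "\<delta> * \<delta> = 1"
    and sq: "\<And>p v. v \<in> tangent_space M p \<Longrightarrow> \<phi> p (\<phi> p v) = \<epsilon> *\<^sub>R (v - \<eta> p v *\<^sub>R \<xi> p)"
      "\<And>p v. v \<in> tangent_space M p \<Longrightarrow> \<psi> p (\<psi> p v) = \<delta> *\<^sub>R (v - \<eta> p v *\<^sub>R \<xi> p)"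
      "\<And>p v. v \<in> tangent_space M p \<Longrightarrow> \<phi> p (\<psi> p v) = - \<psi> p (\<phi> p v)"
    and normal: "\<And>X Y. X \<in> vector_fields M \<Longrightarrow> Y \<in> vector_fields M \<Longrightarrow>
        nijenhuis \<phi> X Y = (\<epsilon> *\<^sub>R (2 *\<^sub>R ext_d \<eta> X Y)) \<odot> \<xi>"
      "\<And>X Y. X \<in> vector_fields M \<Longrightarrow> Y \<in> vector_fields M \<Longrightarrow>
        nijenhuis \<psi> X Y = (\<delta> *\<^sub>R (2 *\<^sub>R ext_d \<eta> X Y)) \<odot> \<xi>"
  shows "anti_pair M \<eta> \<xi> \<phi> \<epsilon> \<psi> \<delta>"
proof -
  interpret reeb_manifold M \<eta> \<xi> using assms(1-3) by unfold_locales
  show ?thesis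
  proof unfold_locales
    fix X assume X: "X \<in> \<Gamma>"
    show "\<phi>\<langle>\<phi>\<langle>X\<rangle>\<rangle> = \<epsilon> *\<^sub>R (X - \<eta>\<langle>X\<rangle> \<odot> \<xi>)" "\<psi>\<langle>\<psi>\<langle>X\<rangle>\<rangle> = \<delta> *\<^sub>R (X - \<eta>\<langle>X\<rangle> \<odot> \<xi>)"
      "\<phi>\<langle>\<psi>\<langle>X\<rangle>\<rangle> = - \<psi>\<langle>\<phi>\<langle>X\<rangle>\<rangle>"
      using sq[OF vf_at[OF X]] by (auto simp: fun_eq_iff field_app_def fscale_def)
  qed (use assms in \<open>simp_all add: \<tau>_def\<close>)
qed

theorem corollary4p5:
  fixes M :: "('a::{t2_space,second_countable_topology}, 'e::euclidean_space) chart set"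
    and n :: nat
    and \<eta> :: "'a oneform" and \<xi> :: "'a vfield"
    and \<phi>1 \<phi>2 \<phi>3 :: "'a endofield"
  assumes "normal_almost_bi_paracontact M n \<eta> \<xi> \<phi>1 \<phi>2 \<phi>3"
  shows "(\<exists>!Dc. bi_paracontact_connection M \<eta> \<xi> \<phi>1 \<phi>2 \<phi>3 Dc) \<and>
    (\<forall>Dc. bi_paracontact_connection M \<eta> \<xi> \<phi>1 \<phi>2 \<phi>3 Dc \<longrightarrow>
      (\<forall>X\<in>vector_fields M. \<forall>Y\<in>vector_fields M. \<forall>Z\<in>vector_fields M.
         curvature Dc \<phi>1\<langle>X\<rangle> \<phi>1\<langle>Y\<rangle> Z = curvature Dc \<phi>2\<langle>X\<rangle> \<phi>2\<langle>Y\<rangle> Z \<and>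
         curvature Dc \<phi>2\<langle>X\<rangle> \<phi>2\<langle>Y\<rangle> Z = - curvature Dc \<phi>3\<langle>X\<rangle> \<phi>3\<langle>Y\<rangle> Z \<and>
         - curvature Dc \<phi>3\<langle>X\<rangle> \<phi>3\<langle>Y\<rangle> Z = - curvature Dc X Y Z) \<and>
      (\<forall>X\<in>vector_fields M. \<forall>Z\<in>vector_fields M. curvature Dc X \<xi> Z = 0) \<and>
      (\<forall>X\<in>vector_fields M. \<forall>Y\<in>vector_fields M.
         ricci M Dc X Y = (- 1/2) *\<^sub>R trace_field M (curvature Dc X Y) \<and>
         ricci M Dc X Y = - ricci M Dc Y X \<and>
         ricci M Dc \<phi>1\<langle>X\<rangle> \<phi>1\<langle>Y\<rangle> = ricci M Dc \<phi>2\<langle>X\<rangle> \<phi>2\<langle>Y\<rangle> \<and>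
         ricci M Dc \<phi>2\<langle>X\<rangle> \<phi>2\<langle>Y\<rangle> = - ricci M Dc \<phi>3\<langle>X\<rangle> \<phi>3\<langle>Y\<rangle> \<and>
         - ricci M Dc \<phi>3\<langle>X\<rangle> \<phi>3\<langle>Y\<rangle> = - ricci M Dc X Y) \<and>
      (\<forall>D. canonical_connection1 M \<eta> \<xi> \<phi>1 \<phi>2 \<phi>3 D \<longleftrightarrow> D = Dc) \<and>
      (\<forall>D. canonical_connection2 M \<eta> \<xi> \<phi>1 \<phi>2 \<phi>3 D \<longleftrightarrow> D = Dc) \<and>
      (\<forall>D. canonical_connection3 M \<eta> \<xi> \<phi>1 \<phi>2 \<phi>3 D \<longleftrightarrow> D = Dc))"
proof -
  have abp: "almost_bi_paracontact M n \<eta> \<xi> \<phi>1 \<phi>2 \<phi>3"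
    using assms by (simp add: normal_almost_bi_paracontact_def)
  have base: "smooth_atlas M" "one_form M \<eta>" "reeb_field M \<eta> \<xi>"
    "tensor11 M \<phi>1" "tensor11 M \<phi>2" "tensor11 M \<phi>3"
    using abp by (auto simp: almost_bi_paracontact_def contact_manifold_def)
  have pt: "\<phi>1 p (\<phi>2 p v) = - \<phi>2 p (\<phi>1 p v)" "\<phi>1 p (\<phi>1 p v) = v - \<eta> p v *\<^sub>R \<xi> p"
    "\<phi>2 p (\<phi>2 p v) = v - \<eta> p v *\<^sub>R \<xi> p" "\<phi>3 p v = \<phi>1 p (\<phi>2 p v)"
    "\<phi>3 p (\<phi>3 p v) = - v + \<eta> p v *\<^sub>R \<xi> p" if "v \<in> tangent_space M p" for p v
    using abp that unfolding almost_bi_paracontact_def by blast+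
  have nij: "nijenhuis \<phi>1 X Y = (2 *\<^sub>R ext_d \<eta> X Y) \<odot> \<xi>" "nijenhuis \<phi>2 X Y = (2 *\<^sub>R ext_d \<eta> X Y) \<odot> \<xi>"
    "nijenhuis \<phi>3 X Y = - ((2 *\<^sub>R ext_d \<eta> X Y) \<odot> \<xi>)"
    if "X \<in> vector_fields M" "Y \<in> vector_fields M" for X Y
    using assms that by (simp_all add: normal_almost_bi_paracontact_def eq_neg_iff_add_eq_0)
  have stable: "\<phi>1 p v \<in> tangent_space M p" "\<phi>2 p v \<in> tangent_space M p"
    if "v \<in> tangent_space M p" for p v
    using base(4,5) that by (simp_all add: tensor11_def)
  have neg: "\<phi>1 p (- v) = - \<phi>1 p v" if "v \<in> tangent_space M p" for p v
  proof -
    have "\<phi>1 p ((-1) *\<^sub>R v) = (-1) *\<^sub>R \<phi>1 p v" using base(4) that unfolding tensor11_def by blast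
    then show ?thesis by simp
  qed
  have P12: "anti_pair M \<eta> \<xi> \<phi>1 1 \<phi>2 1"
    using base pt nij by (intro anti_pairI) simp_all
  have P21: "anti_pair M \<eta> \<xi> \<phi>2 1 \<phi>1 1"
    using base pt nij by (intro anti_pairI) simp_all
  have P31: "anti_pair M \<eta> \<xi> \<phi>3 (-1) \<phi>1 1"
  proof (rule anti_pairI)
    show "\<phi>3 p (\<phi>1 p v) = - \<phi>1 p (\<phi>3 p v)" if v: "v \<in> tangent_space M p" for p v
    proof -
      have "\<phi>1 p (\<phi>3 p v) = \<phi>1 p (- \<phi>2 p (\<phi>1 p v))" by (simp only: pt(4)[OF v] pt(1)[OF v])
      also have "\<dots> = - \<phi>1 p (\<phi>2 p (\<phi>1 p v))" by (rule neg[OF stable(2)[OF stable(1)[OF v]]])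
      also have "\<dots> = - \<phi>3 p (\<phi>1 p v)" by (simp only: pt(4)[OF stable(1)[OF v]])
      finally show ?thesis by (simp only: minus_minus)
    qed
  qed (use base pt nij in \<open>simp_all add: fscale_simps\<close>)
  interpret P: anti_pair M \<eta> \<xi> \<phi>1 1 \<phi>2 1 by (rule P12)
  interpret P: paracontact_pair M \<eta> \<xi> \<phi>1 \<phi>2 by unfold_locales
  interpret Q: anti_pair M \<eta> \<xi> \<phi>2 1 \<phi>1 1 by (rule P21)
  interpret S: anti_pair M \<eta> \<xi> \<phi>3 "-1" \<phi>1 1 by (rule P31)
  have phi3: "\<phi>3\<langle>X\<rangle> = \<phi>1\<langle>\<phi>2\<langle>X\<rangle>\<rangle>" if "X \<in> P.\<Gamma>" for X
    using pt(4)[OF P.vf_at[OF that]] by (simp add: field_app_def fun_eq_iff)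

  \<comment> \<open>Since \<open>h\<^sub>\<alpha> = 0\<close>, each of the four notions of connection is parallelism of the structure together
    with a condition on the torsion, and these conditions are equivalent.\<close>
  let ?parallel = "\<lambda>D. linear_connection M D \<and> (\<forall>X\<in>P.\<Gamma>. D X \<xi> = 0) \<and>
    (\<forall>X\<in>P.\<Gamma>. \<forall>Y\<in>P.\<Gamma>. nabla_tensor D \<phi>1 X Y = 0 \<and> nabla_tensor D \<phi>2 X Y = 0 \<and> nabla_tensor D \<phi>3 X Y = 0)"
  let ?tors = "\<lambda>D. \<forall>X\<in>P.\<Gamma>. \<forall>Y\<in>P.\<Gamma>. torsion D X Y = P.\<tau> X Y \<odot> \<xi>"
  have bpc_iff: "bi_paracontact_connection M \<eta> \<xi> \<phi>1 \<phi>2 \<phi>3 D \<longleftrightarrow> ?parallel D \<and> ?tors D" for D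
    by (auto simp: bi_paracontact_connection_def P.\<tau>_def)
  have par12: "parallel_pair M \<eta> \<xi> \<phi>1 1 \<phi>2 1 D" and par21: "parallel_pair M \<eta> \<xi> \<phi>2 1 \<phi>1 1 D"
    and par31: "parallel_pair M \<eta> \<xi> \<phi>3 (-1) \<phi>1 1 D" if "?parallel D" for D
    using that by (unfold_locales; simp add: nabla_tensor_def)+
  note h0 = P.h_op_0 P.psi.h_op_0 S.h_op_0
  have cc1: "canonical_connection1 M \<eta> \<xi> \<phi>1 \<phi>2 \<phi>3 D \<longleftrightarrow> bi_paracontact_connection M \<eta> \<xi> \<phi>1 \<phi>2 \<phi>3 D" for D
  proof -
    have "canonical_connection1 M \<eta> \<xi> \<phi>1 \<phi>2 \<phi>3 D \<longleftrightarrow> ?parallel D \<and> torsion_condition M \<eta> \<xi> \<phi>1 D"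
      by (simp add: canonical_connection1_def Let_def h0 fscale_simps)
    also have "\<dots> \<longleftrightarrow> ?parallel D \<and> ?tors D"
      by (rule conj_cong[OF refl parallel_pair.torsion_condition_iff[OF par12]])
    finally show ?thesis unfolding bpc_iff .
  qed
  have cc2: "canonical_connection2 M \<eta> \<xi> \<phi>1 \<phi>2 \<phi>3 D \<longleftrightarrow> bi_paracontact_connection M \<eta> \<xi> \<phi>1 \<phi>2 \<phi>3 D" for D
  proof -
    have "canonical_connection2 M \<eta> \<xi> \<phi>1 \<phi>2 \<phi>3 D \<longleftrightarrow> ?parallel D \<and> torsion_condition M \<eta> \<xi> \<phi>2 D"
      by (simp add: canonical_connection2_def Let_def h0 fscale_simps)
    also have "\<dots> \<longleftrightarrow> ?parallel D \<and> ?tors D"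
      by (rule conj_cong[OF refl parallel_pair.torsion_condition_iff[OF par21]])
    finally show ?thesis unfolding bpc_iff .
  qed
  have cc3: "canonical_connection3 M \<eta> \<xi> \<phi>1 \<phi>2 \<phi>3 D \<longleftrightarrow> bi_paracontact_connection M \<eta> \<xi> \<phi>1 \<phi>2 \<phi>3 D" for D
  proof -
    have "canonical_connection3 M \<eta> \<xi> \<phi>1 \<phi>2 \<phi>3 D \<longleftrightarrow> ?parallel D \<and> torsion_condition M \<eta> \<xi> \<phi>3 D"
      by (simp add: canonical_connection3_def Let_def h0 fscale_simps)
    also have "\<dots> \<longleftrightarrow> ?parallel D \<and> ?tors D"
      by (rule conj_cong[OF refl parallel_pair.torsion_condition_iff[OF par31]])
    finally show ?thesis unfolding bpc_iff .
  qed
  have can12: "canonical_pair M \<eta> \<xi> \<phi>1 1 \<phi>2 1 D" and can21: "canonical_pair M \<eta> \<xi> \<phi>2 1 \<phi>1 1 D"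
    and can31: "canonical_pair M \<eta> \<xi> \<phi>3 (-1) \<phi>1 1 D"
    if "bi_paracontact_connection M \<eta> \<xi> \<phi>1 \<phi>2 \<phi>3 D" for D
    using that par12[of D] par21[of D] par31[of D] unfolding bpc_iff
    by (auto intro!: canonical_pair.intro canonical_pair_axioms.intro)
  have unique: "D = D'" if "bi_paracontact_connection M \<eta> \<xi> \<phi>1 \<phi>2 \<phi>3 D"
    "bi_paracontact_connection M \<eta> \<xi> \<phi>1 \<phi>2 \<phi>3 D'" for D D'
    using P.canonical_unique[OF can12 can12] that .
  have exists: "bi_paracontact_connection M \<eta> \<xi> \<phi>1 \<phi>2 \<phi>3 P.nabla"
  proof -
    interpret N: canonical_pair M \<eta> \<xi> \<phi>1 1 \<phi>2 1 P.nabla by (rule P.nabla_canonical)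
    show ?thesis
      unfolding bpc_iff using N.linear_connection
      by (auto simp: nabla_tensor_def N.D_phi N.D_psi N.torsion phi3)
  qed
  show ?thesis
  proof (intro conjI allI impI)
    show "\<exists>!Dc. bi_paracontact_connection M \<eta> \<xi> \<phi>1 \<phi>2 \<phi>3 Dc"
      using exists unique by blast
  next
    fix D
    assume D: "bi_paracontact_connection M \<eta> \<xi> \<phi>1 \<phi>2 \<phi>3 D"
    interpret C1: canonical_pair M \<eta> \<xi> \<phi>1 1 \<phi>2 1 D by (rule can12[OF D])
    interpret C2: canonical_pair M \<eta> \<xi> \<phi>2 1 \<phi>1 1 D by (rule can21[OF D])
    interpret C3: canonical_pair M \<eta> \<xi> \<phi>3 "-1" \<phi>1 1 D by (rule can31[OF D])
    show "\<forall>X\<in>vector_fields M. \<forall>Y\<in>vector_fields M. \<forall>Z\<in>vector_fields M.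
         curvature D \<phi>1\<langle>X\<rangle> \<phi>1\<langle>Y\<rangle> Z = curvature D \<phi>2\<langle>X\<rangle> \<phi>2\<langle>Y\<rangle> Z \<and>
         curvature D \<phi>2\<langle>X\<rangle> \<phi>2\<langle>Y\<rangle> Z = - curvature D \<phi>3\<langle>X\<rangle> \<phi>3\<langle>Y\<rangle> Z \<and>
         - curvature D \<phi>3\<langle>X\<rangle> \<phi>3\<langle>Y\<rangle> Z = - curvature D X Y Z"
      by (simp add: C1.curvature_phi_phi C2.curvature_phi_phi C3.curvature_phi_phi)
    show "\<forall>X\<in>vector_fields M. \<forall>Z\<in>vector_fields M. curvature D X \<xi> Z = 0"
      using C1.curvature_xi C1.curvature_skew[OF P.xi_in] by simp
    show "\<forall>X\<in>vector_fields M. \<forall>Y\<in>vector_fields M.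
         ricci M D X Y = (- 1/2) *\<^sub>R trace_field M (curvature D X Y) \<and>
         ricci M D X Y = - ricci M D Y X \<and>
         ricci M D \<phi>1\<langle>X\<rangle> \<phi>1\<langle>Y\<rangle> = ricci M D \<phi>2\<langle>X\<rangle> \<phi>2\<langle>Y\<rangle> \<and>
         ricci M D \<phi>2\<langle>X\<rangle> \<phi>2\<langle>Y\<rangle> = - ricci M D \<phi>3\<langle>X\<rangle> \<phi>3\<langle>Y\<rangle> \<and>
         - ricci M D \<phi>3\<langle>X\<rangle> \<phi>3\<langle>Y\<rangle> = - ricci M D X Y"
    proof (intro ballI conjI)
      fix X Y assume XY: "X \<in> vector_fields M" "Y \<in> vector_fields M"
      show "ricci M D X Y = (- 1/2) *\<^sub>R trace_field M (curvature D X Y)" by (rule C1.ricci_trace[OF XY])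
      show "ricci M D X Y = - ricci M D Y X" by (rule C1.ricci_skew[OF XY])
    qed (simp_all add: C1.ricci_phi_phi C2.ricci_phi_phi C3.ricci_phi_phi)
    show "canonical_connection1 M \<eta> \<xi> \<phi>1 \<phi>2 \<phi>3 D' \<longleftrightarrow> D' = D"
      "canonical_connection2 M \<eta> \<xi> \<phi>1 \<phi>2 \<phi>3 D' \<longleftrightarrow> D' = D"
      "canonical_connection3 M \<eta> \<xi> \<phi>1 \<phi>2 \<phi>3 D' \<longleftrightarrow> D' = D" for D'
      unfolding cc1 cc2 cc3 using unique D by blast+
  qed
qed

end
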